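(* Let $(H,\mathcal{R})$ be a triangular bialgebra. The following are equivalent. (1) There are triangular bialgebras $(H_1,\mathcal{R}_1)$ and $(H_2,\mathcal{R}_2)$ and an invertible 1-cell $(f,\mathcal{F}):(H,\mathcal{R})\to(H_1,\mathcal{R}_1)\otimes(H_2,\mathcal{R}_2)$ in $\mathsf{TwTr}$. (2) There are triangular bialgebras $(H_1,\mathcal{R}_1)$ and $(H_2,\mathcal{R}_2)$, twists $\mathcal{F}_i$ of $H_i$ and surjective morphisms $f_i:(H,\mathcal{R})\to((H_i)_{\mathcal{F}_i},(\mathcal{R}_i)_{\mathcal{F}_i})$ of triangular bialgebras, for $i=1,2$, such that the diagonal morphism $\langle(f_1,\mathcal{F}_1),(f_2,\mathcal{F}_2)\rangle:(H,\mathcal{R})\to(H_1,\mathcal{R}_1)\otimes(H_2,\mathcal{R}_2)$ is an invertible 1-cell in $\mathsf{TwTr}$. (3) There are triangular bialgebras $(H_1,\mathcal{R}_1)$ and $(H_2,\mathcal{R}_2)$, a twist $\mathcal{F}$ on $H_1\otimes H_2$ and an isomorphism $f:(H,\mathcal{R})\to((H_1\otimes H_2)_{\mathcal{F}},\widetilde{\mathcal{R}}_{\mathcal{F}})$ of triangular bialgebras, where $\widetilde{\mathcal{R}}=(\mathrm{Id}\otimes\tau\otimes\mathrm{Id})(\mathcal{R}_1\otimes\mathcal{R}_2)$; i.e. $(H,\mathcal{R})$ is a twisted tensor product of $(H_1,\mathcal{R}_1)$ and $(H_2,\mathcal{R}_2)$. (4) There are bialgebras $H_1$ and $H_2$, twists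 $\mathcal{F}_i$ of $H_i$ and surjective bialgebra maps $f_i:H\to(H_i)_{\mathcal{F}_i}$, $i=1,2$, such that $(f_1\otimes f_2)\Delta:H\to(H_1\otimes H_2)_{\mathcal{F}}$ is a bialgebra isomorphism, where $$\mathcal{F}:=\big(1\otimes(f_2\otimes f_1)(\mathcal{R}^{-1})\otimes1\big)\big((\mathrm{Id}\otimes\tau\otimes\mathrm{Id})(\mathcal{F}_1\otimes\mathcal{F}_2)\big).$$
   Context: $\Bbbk$ is an arbitrary field; bialgebras and tensor products are over $\Bbbk$. $\tau$ is the canonical flip, $\varepsilon$ the counit. For $T=T^i\otimes T_i\in H\otimes H$ (summation understood), $T^{\mathrm{op}}=T_i\otimes T^i$. A quasitriangular bialgebra is a pair $(H,\mathcal{R})$ with $H$ a bialgebra and $\mathcal{R}\in H\otimes H$ invertible such that $\Delta^{\mathrm{op}}(\cdot)=\mathcal{R}\Delta(\cdot)\mathcal{R}^{-1}$, $(\mathrm{Id}\otimes\Delta)(\mathcal{R})=\mathcal{R}_{13}\mathcal{R}_{12}$, $(\Delta\otimes\mathrm{Id})(\mathcal{R})=\mathcal{R}_{13}\mathcal{R}_{23}$ (leg notation); it is triangular if moreover $\mathcal{R}^{-1}=\mathcal{R}^{\mathrm{op}}$. A morphism $f:(H,\mathcal{R})\to(H',\mathcal{R}')$ of (quasi)triangular bialgebras is a bialgebra map with $(f\otimes f)(\mathcal{R})=\mathcal{R}'$. A twist on (or of) $H$ is an invertible $\mathcal{F}\in H\otimes H$ with $(\mathcal{F}\otimes1)(\Delta\otimes\mathrm{Id})(\mathcal{F})=(1\otimes\mathcal{F})(\mathrm{Id}\otimes\Delta)(\mathcal{F})$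 and $(\varepsilon\otimes\mathrm{Id})(\mathcal{F})=1=(\mathrm{Id}\otimes\varepsilon)(\mathcal{F})$. Then $H_{\mathcal{F}}$ is the bialgebra with the same algebra and counit and comultiplication $\Delta_{\mathcal{F}}(\cdot)=\mathcal{F}\Delta(\cdot)\mathcal{F}^{-1}$; if $(H,\mathcal{R})$ is (quasi)triangular, so is $(H_{\mathcal{F}},\mathcal{R}_{\mathcal{F}})$ with $\mathcal{R}_{\mathcal{F}}:=\mathcal{F}^{\mathrm{op}}\mathcal{R}\mathcal{F}^{-1}$. $\mathsf{TwTr}$ is the 2-category whose 0-cells are triangular bialgebras and whose 1-cells $(f,\mathcal{F}):(H,\mathcal{R})\to(H',\mathcal{R}')$ are pairs with $\mathcal{F}$ a twist on $H'$ and $f:(H,\mathcal{R})\to(H'_{\mathcal{F}},\mathcal{R}'_{\mathcal{F}})$ a morphism of triangular bialgebras, with composition $(f',\mathcal{F}')\circ(f,\mathcal{F})=(f'f,(f'\otimes f')(\mathcal{F})\mathcal{F}')$ and identities $(\mathrm{Id},1\otimes1)$ (2-cells are not needed to state the result). A 1-cell is invertible if it has a two-sided inverse for this composition. $(H_1,\mathcal{R}_1)\otimes(H_2,\mathcal{R}_2):=(H_1\otimes H_2,\widetilde{\mathcal{R}})$, where $H_1\otimes H_2$ is the tensor product bialgebra (comultiplication $(\mathrm{Id}\otimes\tau\otimes\mathrm{Id})(\Delta_{H_1}\otimes\Delta_{H_2})$) and $\widetilde{\mathcal{R}}=(\mathrm{Id}\otimes\tau\otimes\mathrm{Id})(\mathcal{R}_1\otimes\mathcal{R}_2)$.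 For 1-cells $(f_i,\mathcal{F}_i):(H,\mathcal{R})\to(H_i,\mathcal{R}_i)$, $i=1,2$, the diagonal morphism is the 1-cell $\langle(f_1,\mathcal{F}_1),(f_2,\mathcal{F}_2)\rangle=\big((f_1\otimes f_2)\Delta_H,\ (1\otimes(f_2\otimes f_1)(\mathcal{R}^{-1})\otimes1)((\mathrm{Id}\otimes\tau\otimes\mathrm{Id})(\mathcal{F}_1\otimes\mathcal{F}_2))\big)$ from $(H,\mathcal{R})$ to $(H_1,\mathcal{R}_1)\otimes(H_2,\mathcal{R}_2)$. A quasitriangular bialgebra $(H,\mathcal{R})$ is a twisted tensor product of quasitriangular bialgebras $(H_1,\mathcal{R}_1)$ and $(H_2,\mathcal{R}_2)$ if there is a twist $\mathcal{F}$ on $H_1\otimes H_2$ and an isomorphism of quasitriangular bialgebras $(H,\mathcal{R})\to((H_1\otimes H_2)_{\mathcal{F}},\widetilde{\mathcal{R}}_{\mathcal{F}})$. *)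

theory Defs
  imports "HOL-Algebra.AbelCoset" "HOL-Algebra.Module"
begin

section \<open>Tensor products of modules and algebras\<close>

definition free_module :: "('k, 'm) ring_scheme \<Rightarrow> 's set \<Rightarrow> ('k, 's \<Rightarrow> 'k) module" where
  "free_module K S =
    \<lparr>carrier = {x. (\<forall>s\<in>S. x s \<in> carrier K) \<and> (\<forall>s. s \<notin> S \<longrightarrow> x s = \<zero>\<^bsub>K\<^esub>) \<and> finite {s. x s \<noteq> \<zero>\<^bsub>K\<^esub>}},
     monoid.mult = undefined,
     one = undefined,
     zero = (\<lambda>s. \<zero>\<^bsub>K\<^esub>),
     add = (\<lambda>x y s. x s \<oplus>\<^bsub>K\<^esub> y s),
     smult = (\<lambda>c x s. c \<otimes>\<^bsub>K\<^esub> x s)\<rparr>"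

definition free_gen :: "('k, 'm) ring_scheme \<Rightarrow> 's \<Rightarrow> 's \<Rightarrow> 'k" where
  "free_gen K s = (\<lambda>t. if t = s then \<one>\<^bsub>K\<^esub> else \<zero>\<^bsub>K\<^esub>)"

type_synonym ('k, 'a, 'b) tens = "('a \<times> 'b \<Rightarrow> 'k) set"

text \<open>The tensor product of two modules is the free module on pairs modulo the submodule
  of bilinearity relations. Its elements are therefore cosets of formal sums.\<close>

definition bilinear_rels ::
  "('k, 'm) ring_scheme \<Rightarrow> ('k, 'a, 'n) module_scheme \<Rightarrow> ('k, 'b, 'p) module_scheme
    \<Rightarrow> ('a \<times> 'b \<Rightarrow> 'k) set" where
  "bilinear_rels K A B =
    (let F = free_module K (carrier A \<times> carrier B); g = (\<lambda>a b. free_gen K (a, b)) in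
       {g (a \<oplus>\<^bsub>A\<^esub> a') b \<ominus>\<^bsub>F\<^esub> (g a b \<oplus>\<^bsub>F\<^esub> g a' b) | a a' b.
          a \<in> carrier A \<and> a' \<in> carrier A \<and> b \<in> carrier B}
     \<union> {g a (b \<oplus>\<^bsub>B\<^esub> b') \<ominus>\<^bsub>F\<^esub> (g a b \<oplus>\<^bsub>F\<^esub> g a b') | a b b'.
          a \<in> carrier A \<and> b \<in> carrier B \<and> b' \<in> carrier B}
     \<union> {g (c \<odot>\<^bsub>A\<^esub> a) b \<ominus>\<^bsub>F\<^esub> (c \<odot>\<^bsub>F\<^esub> g a b) | c a b.
          c \<in> carrier K \<and> a \<in> carrier A \<and> b \<in> carrier B}
     \<union> {g a (c \<odot>\<^bsub>B\<^esub> b) \<ominus>\<^bsub>F\<^esub> (c \<odot>\<^bsub>F\<^esub> g a b) | c a b.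
          c \<in> carrier K \<and> a \<in> carrier A \<and> b \<in> carrier B})"

definition tensor_null ::
  "('k, 'm) ring_scheme \<Rightarrow> ('k, 'a, 'n) module_scheme \<Rightarrow> ('k, 'b, 'p) module_scheme
    \<Rightarrow> ('a \<times> 'b \<Rightarrow> 'k) set" where
  "tensor_null K A B =
    \<Inter>{N. submodule N K (free_module K (carrier A \<times> carrier B)) \<and> bilinear_rels K A B \<subseteq> N}"

definition pure_tensor ::
  "('k, 'm) ring_scheme \<Rightarrow> ('k, 'a, 'n) module_scheme \<Rightarrow> ('k, 'b, 'p) module_scheme
    \<Rightarrow> 'a \<Rightarrow> 'b \<Rightarrow> ('k, 'a, 'b) tens" where
  "pure_tensor K A B a b =
    tensor_null K A B +>\<^bsub>free_module K (carrier A \<times> carrier B)\<^esub> free_gen K (a, b)"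

definition tensor_module ::
  "('k, 'm) ring_scheme \<Rightarrow> ('k, 'a, 'n) module_scheme \<Rightarrow> ('k, 'b, 'p) module_scheme
    \<Rightarrow> ('k, ('k, 'a, 'b) tens) module" where
  "tensor_module K A B =
    (let F = free_module K (carrier A \<times> carrier B); N = tensor_null K A B in
     \<lparr>carrier = a_rcosets\<^bsub>F\<^esub> N,
      monoid.mult = undefined,
      one = undefined,
      zero = N,
      add = (\<lambda>X Y. X <+>\<^bsub>F\<^esub> Y),
      smult = (\<lambda>c X. \<Union>x\<in>X. N +>\<^bsub>F\<^esub> (c \<odot>\<^bsub>F\<^esub> x))\<rparr>)"

text \<open>\<open>tensor_lift K C \<beta>\<close> is the linear map into \<open>C\<close> induced by a bilinear map \<open>\<beta>\<close>.
  Bilinearity makes the value independent of the formal sum representing the tensor, so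
  that the image set below is a singleton.\<close>

definition tensor_lift ::
  "('k, 'm) ring_scheme \<Rightarrow> ('k, 'c, 'q) module_scheme \<Rightarrow> ('a \<Rightarrow> 'b \<Rightarrow> 'c)
    \<Rightarrow> ('k, 'a, 'b) tens \<Rightarrow> 'c" where
  "tensor_lift K C \<beta> X =
    the_elem ((\<lambda>x. finsum C (\<lambda>(a, b). x (a, b) \<odot>\<^bsub>C\<^esub> \<beta> a b) {p. x p \<noteq> \<zero>\<^bsub>K\<^esub>}) ` X)"

definition tensor ::
  "('k, 'm) ring_scheme \<Rightarrow> ('k, 'a, 'n) module_scheme \<Rightarrow> ('k, 'b, 'p) module_scheme
    \<Rightarrow> ('k, ('k, 'a, 'b) tens) module" where
  "tensor K A B =
    (tensor_module K A B)
      \<lparr>monoid.mult := (\<lambda>X Y.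
          tensor_lift K (tensor_module K A B) (\<lambda>a b.
            tensor_lift K (tensor_module K A B) (\<lambda>a' b'.
              pure_tensor K A B (a \<otimes>\<^bsub>A\<^esub> a') (b \<otimes>\<^bsub>B\<^esub> b')) Y) X),
       one := pure_tensor K A B \<one>\<^bsub>A\<^esub> \<one>\<^bsub>B\<^esub>\<rparr>"

text \<open>In \<open>tensor_map K C D f g\<close>, the map \<open>f \<otimes> g\<close>, only the codomains \<open>C\<close> and \<open>D\<close> are needed.\<close>

definition tensor_map ::
  "('k, 'm) ring_scheme \<Rightarrow> ('k, 'c, 'n) module_scheme \<Rightarrow> ('k, 'd, 'p) module_scheme
    \<Rightarrow> ('a \<Rightarrow> 'c) \<Rightarrow> ('b \<Rightarrow> 'd) \<Rightarrow> ('k, 'a, 'b) tens \<Rightarrow> ('k, 'c, 'd) tens" where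
  "tensor_map K C D f g =
    tensor_lift K (tensor K C D) (\<lambda>a b. pure_tensor K C D (f a) (g b))"

definition tensor_flip ::
  "('k, 'm) ring_scheme \<Rightarrow> ('k, 'a, 'n) module_scheme \<Rightarrow> ('k, 'b, 'p) module_scheme
    \<Rightarrow> ('k, 'a, 'b) tens \<Rightarrow> ('k, 'b, 'a) tens" where
  "tensor_flip K A B = tensor_lift K (tensor K B A) (\<lambda>a b. pure_tensor K B A b a)"

text \<open>The canonical identification of \<open>(A \<otimes> B) \<otimes> C\<close> with \<open>A \<otimes> (B \<otimes> C)\<close>. Below, threefold
  tensors always live in \<open>A \<otimes> (B \<otimes> C)\<close>.\<close>

definition tensor_assoc ::
  "('k, 'm) ring_scheme \<Rightarrow> ('k, 'a, 'n) module_scheme \<Rightarrow> ('k, 'b, 'p) module_scheme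
    \<Rightarrow> ('k, 'c, 'q) module_scheme
    \<Rightarrow> ('k, ('k, 'a, 'b) tens, 'c) tens \<Rightarrow> ('k, 'a, ('k, 'b, 'c) tens) tens" where
  "tensor_assoc K A B C =
    tensor_lift K (tensor K A (tensor K B C)) (\<lambda>X c.
      tensor_lift K (tensor K A (tensor K B C)) (\<lambda>a b.
        pure_tensor K A (tensor K B C) a (pure_tensor K B C b c)) X)"

text \<open>\<open>Id \<otimes> \<tau> \<otimes> Id\<close>, as a map from \<open>(A \<otimes> B) \<otimes> (C \<otimes> D)\<close> to \<open>(A \<otimes> C) \<otimes> (B \<otimes> D)\<close>.\<close>

definition middle_flip ::
  "('k, 'm) ring_scheme \<Rightarrow> ('k, 'a, 'n) module_scheme \<Rightarrow> ('k, 'b, 'p) module_scheme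
    \<Rightarrow> ('k, 'c, 'q) module_scheme \<Rightarrow> ('k, 'd, 'r) module_scheme
    \<Rightarrow> ('k, ('k, 'a, 'b) tens, ('k, 'c, 'd) tens) tens
    \<Rightarrow> ('k, ('k, 'a, 'c) tens, ('k, 'b, 'd) tens) tens" where
  "middle_flip K A B C D =
    (let T = tensor K (tensor K A C) (tensor K B D) in
     tensor_lift K T (\<lambda>X Y.
       tensor_lift K T (\<lambda>a b.
         tensor_lift K T (\<lambda>c d.
           pure_tensor K (tensor K A C) (tensor K B D)
             (pure_tensor K A C a c) (pure_tensor K B D b d)) Y) X))"


section \<open>Bialgebras\<close>

text \<open>The library's locale \<open>algebra\<close> only covers commutative algebras.\<close>

locale assoc_algebra = module K A + field K + ring A for K (structure) and A (structure) +
  assumes smult_mult_left: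
      "\<lbrakk>c \<in> carrier K; x \<in> carrier A; y \<in> carrier A\<rbrakk>
        \<Longrightarrow> (c \<odot>\<^bsub>A\<^esub> x) \<otimes>\<^bsub>A\<^esub> y = c \<odot>\<^bsub>A\<^esub> (x \<otimes>\<^bsub>A\<^esub> y)"
    and smult_mult_right:
      "\<lbrakk>c \<in> carrier K; x \<in> carrier A; y \<in> carrier A\<rbrakk>
        \<Longrightarrow> x \<otimes>\<^bsub>A\<^esub> (c \<odot>\<^bsub>A\<^esub> y) = c \<odot>\<^bsub>A\<^esub> (x \<otimes>\<^bsub>A\<^esub> y)"

definition ground :: "('k, 'm) ring_scheme \<Rightarrow> ('k, 'k) module" where
  "ground K =
    \<lparr>carrier = carrier K, monoid.mult = monoid.mult K, one = one K,
     zero = zero K, add = add K, smult = monoid.mult K\<rparr>"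

definition alg_hom ::
  "('k, 'm) ring_scheme \<Rightarrow> ('k, 'a, 'n) module_scheme \<Rightarrow> ('k, 'b, 'p) module_scheme
    \<Rightarrow> ('a \<Rightarrow> 'b) set" where
  "alg_hom K A B =
    {f \<in> ring_hom A B. \<forall>c\<in>carrier K. \<forall>x\<in>carrier A. f (c \<odot>\<^bsub>A\<^esub> x) = c \<odot>\<^bsub>B\<^esub> f x}"

text \<open>A bialgebra has an arbitrary carrier set inside its type \<open>'h\<close>. Quantifying existentially
  over bialgebras of type \<open>('k, 'a) bialgebra\<close> thus ranges, up to isomorphism, over all bialgebras
  whose cardinality is at most that of \<open>'a\<close>. A bialgebra that is a quotient of \<open>H\<close> or a tensor
  factor of \<open>H\<close> is always covered by taking \<open>'a\<close> to be the type of \<open>H\<close>.\<close>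

record ('k, 'h) bialgebra = "('k, 'h) module" +
  comult :: "'h \<Rightarrow> ('k, 'h, 'h) tens"
  counit :: "'h \<Rightarrow> 'k"

text \<open>The maps \<open>\<epsilon> \<otimes> Id\<close> and \<open>Id \<otimes> \<epsilon>\<close> from \<open>H \<otimes> H\<close>, with \<open>\<bbbk> \<otimes> H\<close> and \<open>H \<otimes> \<bbbk>\<close> identified with \<open>H\<close>.\<close>

definition counit_left ::
  "('k, 'm) ring_scheme \<Rightarrow> ('k, 'h, 'n) bialgebra_scheme \<Rightarrow> ('k, 'h, 'h) tens \<Rightarrow> 'h" where
  "counit_left K H = tensor_lift K H (\<lambda>a b. counit H a \<odot>\<^bsub>H\<^esub> b)"

definition counit_right ::
  "('k, 'm) ring_scheme \<Rightarrow> ('k, 'h, 'n) bialgebra_scheme \<Rightarrow> ('k, 'h, 'h) tens \<Rightarrow> 'h" where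
  "counit_right K H = tensor_lift K H (\<lambda>a b. counit H b \<odot>\<^bsub>H\<^esub> a)"

text \<open>\<open>\<Delta> \<otimes> Id\<close> and \<open>Id \<otimes> \<Delta>\<close>.\<close>

definition comult_left ::
  "('k, 'm) ring_scheme \<Rightarrow> ('k, 'h, 'n) bialgebra_scheme \<Rightarrow> ('k, 'h, 'h) tens
    \<Rightarrow> ('k, ('k, 'h, 'h) tens, 'h) tens" where
  "comult_left K H = tensor_map K (tensor K H H) H (comult H) (\<lambda>x. x)"

definition comult_right ::
  "('k, 'm) ring_scheme \<Rightarrow> ('k, 'h, 'n) bialgebra_scheme \<Rightarrow> ('k, 'h, 'h) tens
    \<Rightarrow> ('k, 'h, ('k, 'h, 'h) tens) tens" where
  "comult_right K H = tensor_map K H (tensor K H H) (\<lambda>x. x) (comult H)"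

locale bialgebra = assoc_algebra K H for K (structure) and H (structure) +
  assumes comult_hom: "comult H \<in> alg_hom K H (tensor K H H)"
    and counit_hom: "counit H \<in> alg_hom K H (ground K)"
    and coassoc: "h \<in> carrier H \<Longrightarrow>
      tensor_assoc K H H H (comult_left K H (comult H h)) = comult_right K H (comult H h)"
    and counit_left: "h \<in> carrier H \<Longrightarrow> counit_left K H (comult H h) = h"
    and counit_right: "h \<in> carrier H \<Longrightarrow> counit_right K H (comult H h) = h"

definition bialgebra_hom ::
  "('k, 'm) ring_scheme \<Rightarrow> ('k, 'a, 'n) bialgebra_scheme \<Rightarrow> ('k, 'b, 'p) bialgebra_scheme
    \<Rightarrow> ('a \<Rightarrow> 'b) set" where
  "bialgebra_hom K H H' =
    {f \<in> alg_hom K H H'. \<forall>h\<in>carrier H.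
       comult H' (f h) = tensor_map K H' H' f f (comult H h) \<and> counit H' (f h) = counit H h}"

definition bialgebra_iso ::
  "('k, 'm) ring_scheme \<Rightarrow> ('k, 'a, 'n) bialgebra_scheme \<Rightarrow> ('k, 'b, 'p) bialgebra_scheme
    \<Rightarrow> ('a \<Rightarrow> 'b) set" where
  "bialgebra_iso K H H' = {f \<in> bialgebra_hom K H H'. bij_betw f (carrier H) (carrier H')}"

definition tensor_bialgebra ::
  "('k, 'm) ring_scheme \<Rightarrow> ('k, 'a, 'n) bialgebra_scheme \<Rightarrow> ('k, 'b, 'p) bialgebra_scheme
    \<Rightarrow> ('k, ('k, 'a, 'b) tens) bialgebra" where
  "tensor_bialgebra K H1 H2 =
    (let T = tensor K H1 H2 in
     \<lparr>carrier = carrier T, monoid.mult = monoid.mult T, one = one T,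
      zero = zero T, add = add T, smult = smult T,
      comult = (\<lambda>X. middle_flip K H1 H1 H2 H2
        (tensor_map K (tensor K H1 H1) (tensor K H2 H2) (comult H1) (comult H2) X)),
      counit = tensor_lift K (ground K) (\<lambda>a b. counit H1 a \<otimes>\<^bsub>K\<^esub> counit H2 b)\<rparr>)"

text \<open>\<open>(Id \<otimes> \<tau> \<otimes> Id)(X\<^sub>1 \<otimes> X\<^sub>2)\<close> for \<open>X\<^sub>i \<in> H\<^sub>i \<otimes> H\<^sub>i\<close>, an element of the tensor square of \<open>H\<^sub>1 \<otimes> H\<^sub>2\<close>.
  Applied to universal R-matrices it gives the triangular structure of the tensor product.\<close>

definition interleave ::
  "('k, 'm) ring_scheme \<Rightarrow> ('k, 'a, 'n) module_scheme \<Rightarrow> ('k, 'b, 'p) module_scheme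
    \<Rightarrow> ('k, 'a, 'a) tens \<Rightarrow> ('k, 'b, 'b) tens
    \<Rightarrow> ('k, ('k, 'a, 'b) tens, ('k, 'a, 'b) tens) tens" where
  "interleave K H1 H2 X1 X2 =
    middle_flip K H1 H1 H2 H2 (pure_tensor K (tensor K H1 H1) (tensor K H2 H2) X1 X2)"


section \<open>Quasitriangular and triangular bialgebras\<close>

definition leg12 ::
  "('k, 'm) ring_scheme \<Rightarrow> ('k, 'h, 'n) module_scheme \<Rightarrow> ('k, 'h, 'h) tens
    \<Rightarrow> ('k, 'h, ('k, 'h, 'h) tens) tens" where
  "leg12 K H = tensor_map K H (tensor K H H) (\<lambda>x. x) (\<lambda>y. pure_tensor K H H y \<one>\<^bsub>H\<^esub>)"

definition leg13 ::
  "('k, 'm) ring_scheme \<Rightarrow> ('k, 'h, 'n) module_scheme \<Rightarrow> ('k, 'h, 'h) tens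
    \<Rightarrow> ('k, 'h, ('k, 'h, 'h) tens) tens" where
  "leg13 K H = tensor_map K H (tensor K H H) (\<lambda>x. x) (\<lambda>y. pure_tensor K H H \<one>\<^bsub>H\<^esub> y)"

definition leg23 ::
  "('k, 'm) ring_scheme \<Rightarrow> ('k, 'h, 'n) module_scheme \<Rightarrow> ('k, 'h, 'h) tens
    \<Rightarrow> ('k, 'h, ('k, 'h, 'h) tens) tens" where
  "leg23 K H X = pure_tensor K H (tensor K H H) \<one>\<^bsub>H\<^esub> X"

locale quasitriangular_bialgebra = bialgebra K H for K (structure) and H (structure) +
  fixes R :: "('a, 'c, 'c) tens"
  assumes R_unit: "R \<in> Units (tensor K H H)"
    and R_comult: "h \<in> carrier H \<Longrightarrow>
      tensor_flip K H H (comult H h)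
        = R \<otimes>\<^bsub>tensor K H H\<^esub> comult H h \<otimes>\<^bsub>tensor K H H\<^esub> inv\<^bsub>tensor K H H\<^esub> R"
    and R_comult_right:
      "comult_right K H R = leg13 K H R \<otimes>\<^bsub>tensor K H (tensor K H H)\<^esub> leg12 K H R"
    and R_comult_left:
      "tensor_assoc K H H H (comult_left K H R)
        = leg13 K H R \<otimes>\<^bsub>tensor K H (tensor K H H)\<^esub> leg23 K H R"

locale triangular_bialgebra = quasitriangular_bialgebra K H R
  for K (structure) and H (structure) and R +
  assumes R_inverse: "inv\<^bsub>tensor K H H\<^esub> R = tensor_flip K H H R"

definition triangular_hom ::
  "('k, 'm) ring_scheme \<Rightarrow> ('k, 'a, 'n) bialgebra_scheme \<Rightarrow> ('k, 'a, 'a) tens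
    \<Rightarrow> ('k, 'b, 'p) bialgebra_scheme \<Rightarrow> ('k, 'b, 'b) tens \<Rightarrow> ('a \<Rightarrow> 'b) set" where
  "triangular_hom K H R H' R' = {f \<in> bialgebra_hom K H H'. tensor_map K H' H' f f R = R'}"

definition triangular_iso ::
  "('k, 'm) ring_scheme \<Rightarrow> ('k, 'a, 'n) bialgebra_scheme \<Rightarrow> ('k, 'a, 'a) tens
    \<Rightarrow> ('k, 'b, 'p) bialgebra_scheme \<Rightarrow> ('k, 'b, 'b) tens \<Rightarrow> ('a \<Rightarrow> 'b) set" where
  "triangular_iso K H R H' R' =
    {f \<in> triangular_hom K H R H' R'. bij_betw f (carrier H) (carrier H')}"


section \<open>Twists and the category TwTr\<close>

definition is_twist ::
  "('k, 'm) ring_scheme \<Rightarrow> ('k, 'h, 'n) bialgebra_scheme \<Rightarrow> ('k, 'h, 'h) tens \<Rightarrow> bool" where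
  "is_twist K H F \<longleftrightarrow>
     F \<in> Units (tensor K H H) \<and>
     tensor_assoc K H H H
       (pure_tensor K (tensor K H H) H F \<one>\<^bsub>H\<^esub> \<otimes>\<^bsub>tensor K (tensor K H H) H\<^esub> comult_left K H F)
     = pure_tensor K H (tensor K H H) \<one>\<^bsub>H\<^esub> F \<otimes>\<^bsub>tensor K H (tensor K H H)\<^esub> comult_right K H F \<and>
     counit_left K H F = \<one>\<^bsub>H\<^esub> \<and>
     counit_right K H F = \<one>\<^bsub>H\<^esub>"

definition twisted ::
  "('k, 'm) ring_scheme \<Rightarrow> ('k, 'h, 'n) bialgebra_scheme \<Rightarrow> ('k, 'h, 'h) tens
    \<Rightarrow> ('k, 'h, 'n) bialgebra_scheme" where
  "twisted K H F =
    H\<lparr>comult := (\<lambda>h. F \<otimes>\<^bsub>tensor K H H\<^esub> comult H h \<otimes>\<^bsub>tensor K H H\<^esub> inv\<^bsub>tensor K H H\<^esub> F)\<rparr>"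

definition twisted_R ::
  "('k, 'm) ring_scheme \<Rightarrow> ('k, 'h, 'n) bialgebra_scheme \<Rightarrow> ('k, 'h, 'h) tens
    \<Rightarrow> ('k, 'h, 'h) tens \<Rightarrow> ('k, 'h, 'h) tens" where
  "twisted_R K H F R =
    tensor_flip K H H F \<otimes>\<^bsub>tensor K H H\<^esub> R \<otimes>\<^bsub>tensor K H H\<^esub> inv\<^bsub>tensor K H H\<^esub> F"

definition is_onecell ::
  "('k, 'm) ring_scheme \<Rightarrow> ('k, 'a, 'n) bialgebra_scheme \<Rightarrow> ('k, 'a, 'a) tens
    \<Rightarrow> ('k, 'b, 'p) bialgebra_scheme \<Rightarrow> ('k, 'b, 'b) tens
    \<Rightarrow> ('a \<Rightarrow> 'b) \<times> ('k, 'b, 'b) tens \<Rightarrow> bool" where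
  "is_onecell K H R H' R' = (\<lambda>(f, F).
     triangular_bialgebra K H R \<and> triangular_bialgebra K H' R' \<and>
     is_twist K H' F \<and> f \<in> triangular_hom K H R (twisted K H' F) (twisted_R K H' F R'))"

text \<open>Composition \<open>(f', F') \<circ> (f, F)\<close>; the parameter \<open>H''\<close> is the target of \<open>f'\<close>.\<close>

definition onecell_comp ::
  "('k, 'm) ring_scheme \<Rightarrow> ('k, 'c, 'n) bialgebra_scheme
    \<Rightarrow> ('b \<Rightarrow> 'c) \<times> ('k, 'c, 'c) tens \<Rightarrow> ('a \<Rightarrow> 'b) \<times> ('k, 'b, 'b) tens
    \<Rightarrow> ('a \<Rightarrow> 'c) \<times> ('k, 'c, 'c) tens" where
  "onecell_comp K H'' = (\<lambda>(f', F') (f, F).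
     (f' \<circ> f, tensor_map K H'' H'' f' f' F \<otimes>\<^bsub>tensor K H'' H''\<^esub> F'))"

definition onecell_id ::
  "('k, 'm) ring_scheme \<Rightarrow> ('k, 'a, 'n) bialgebra_scheme \<Rightarrow> ('a \<Rightarrow> 'a) \<times> ('k, 'a, 'a) tens" where
  "onecell_id K H = (\<lambda>x. x, pure_tensor K H H \<one>\<^bsub>H\<^esub> \<one>\<^bsub>H\<^esub>)"

text \<open>Maps are HOL functions on whole types, so equality of 1-cells with domain \<open>H\<close> only
  compares their values on \<open>carrier H\<close>.\<close>

definition onecell_eq ::
  "('k, 'a, 'n) bialgebra_scheme \<Rightarrow> ('a \<Rightarrow> 'b) \<times> ('k, 'b, 'b) tens
    \<Rightarrow> ('a \<Rightarrow> 'b) \<times> ('k, 'b, 'b) tens \<Rightarrow> bool" where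
  "onecell_eq H = (\<lambda>(f, F) (g, G). (\<forall>x\<in>carrier H. f x = g x) \<and> F = G)"

definition invertible_onecell ::
  "('k, 'm) ring_scheme \<Rightarrow> ('k, 'a, 'n) bialgebra_scheme \<Rightarrow> ('k, 'a, 'a) tens
    \<Rightarrow> ('k, 'b, 'p) bialgebra_scheme \<Rightarrow> ('k, 'b, 'b) tens
    \<Rightarrow> ('a \<Rightarrow> 'b) \<times> ('k, 'b, 'b) tens \<Rightarrow> bool" where
  "invertible_onecell K H R H' R' \<phi> \<longleftrightarrow>
     is_onecell K H R H' R' \<phi> \<and>
     (\<exists>\<psi>. is_onecell K H' R' H R \<psi> \<and>
        onecell_eq H (onecell_comp K H \<psi> \<phi>) (onecell_id K H) \<and>
        onecell_eq H' (onecell_comp K H' \<phi> \<psi>) (onecell_id K H'))"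

text \<open>The map \<open>x \<mapsto> 1 \<otimes> x \<otimes> 1\<close> from \<open>H\<^sub>2 \<otimes> H\<^sub>1\<close> to \<open>H\<^sub>1 \<otimes> H\<^sub>2 \<otimes> H\<^sub>1 \<otimes> H\<^sub>2\<close>, bracketed as \<open>(H\<^sub>1 \<otimes> H\<^sub>2) \<otimes> (H\<^sub>1 \<otimes> H\<^sub>2)\<close>.\<close>

definition middle_embed ::
  "('k, 'm) ring_scheme \<Rightarrow> ('k, 'a, 'n) module_scheme \<Rightarrow> ('k, 'b, 'p) module_scheme
    \<Rightarrow> ('k, 'b, 'a) tens \<Rightarrow> ('k, ('k, 'a, 'b) tens, ('k, 'a, 'b) tens) tens" where
  "middle_embed K H1 H2 =
    tensor_map K (tensor K H1 H2) (tensor K H1 H2)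
      (\<lambda>y. pure_tensor K H1 H2 \<one>\<^bsub>H1\<^esub> y) (\<lambda>x. pure_tensor K H1 H2 x \<one>\<^bsub>H2\<^esub>)"

definition diagonal_map ::
  "('k, 'm) ring_scheme \<Rightarrow> ('k, 'h, 'n) bialgebra_scheme
    \<Rightarrow> ('k, 'a, 'p) bialgebra_scheme \<Rightarrow> ('k, 'b, 'q) bialgebra_scheme
    \<Rightarrow> ('h \<Rightarrow> 'a) \<Rightarrow> ('h \<Rightarrow> 'b) \<Rightarrow> 'h \<Rightarrow> ('k, 'a, 'b) tens" where
  "diagonal_map K H H1 H2 f1 f2 h = tensor_map K H1 H2 f1 f2 (comult H h)"

definition diagonal_twist ::
  "('k, 'm) ring_scheme \<Rightarrow> ('k, 'h, 'n) bialgebra_scheme \<Rightarrow> ('k, 'h, 'h) tens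
    \<Rightarrow> ('k, 'a, 'p) bialgebra_scheme \<Rightarrow> ('k, 'b, 'q) bialgebra_scheme
    \<Rightarrow> ('h \<Rightarrow> 'a) \<times> ('k, 'a, 'a) tens \<Rightarrow> ('h \<Rightarrow> 'b) \<times> ('k, 'b, 'b) tens
    \<Rightarrow> ('k, ('k, 'a, 'b) tens, ('k, 'a, 'b) tens) tens" where
  "diagonal_twist K H R H1 H2 = (\<lambda>(f1, F1) (f2, F2).
     middle_embed K H1 H2 (tensor_map K H2 H1 f2 f1 (inv\<^bsub>tensor K H H\<^esub> R))
       \<otimes>\<^bsub>tensor K (tensor K H1 H2) (tensor K H1 H2)\<^esub> interleave K H1 H2 F1 F2)"

definition diagonal_onecell ::
  "('k, 'm) ring_scheme \<Rightarrow> ('k, 'h, 'n) bialgebra_scheme \<Rightarrow> ('k, 'h, 'h) tens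
    \<Rightarrow> ('k, 'a, 'p) bialgebra_scheme \<Rightarrow> ('k, 'b, 'q) bialgebra_scheme
    \<Rightarrow> ('h \<Rightarrow> 'a) \<times> ('k, 'a, 'a) tens \<Rightarrow> ('h \<Rightarrow> 'b) \<times> ('k, 'b, 'b) tens
    \<Rightarrow> ('h \<Rightarrow> ('k, 'a, 'b) tens) \<times> ('k, ('k, 'a, 'b) tens, ('k, 'a, 'b) tens) tens" where
  "diagonal_onecell K H R H1 H2 \<phi>1 \<phi>2 =
     (diagonal_map K H H1 H2 (fst \<phi>1) (fst \<phi>2), diagonal_twist K H R H1 H2 \<phi>1 \<phi>2)"

text \<open>Morphisms of quasitriangular bialgebras are defined by the same conditions as in the
  triangular case, so \<open>triangular_iso\<close> serves for both.\<close>

definition twisted_tensor_product ::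
  "('k, 'm) ring_scheme \<Rightarrow> ('k, 'h, 'n) bialgebra_scheme \<Rightarrow> ('k, 'h, 'h) tens
    \<Rightarrow> ('k, 'a, 'p) bialgebra_scheme \<Rightarrow> ('k, 'a, 'a) tens
    \<Rightarrow> ('k, 'b, 'q) bialgebra_scheme \<Rightarrow> ('k, 'b, 'b) tens \<Rightarrow> bool" where
  "twisted_tensor_product K H R H1 R1 H2 R2 \<longleftrightarrow>
     quasitriangular_bialgebra K H R \<and>
     quasitriangular_bialgebra K H1 R1 \<and> quasitriangular_bialgebra K H2 R2 \<and>
     (\<exists>f F. is_twist K (tensor_bialgebra K H1 H2) F \<and>
        f \<in> triangular_iso K H R (twisted K (tensor_bialgebra K H1 H2) F)
          (twisted_R K (tensor_bialgebra K H1 H2) F (interleave K H1 H2 R1 R2)))"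

lemma twisted_tensor_product_triangular:
  assumes "triangular_bialgebra K H R" "triangular_bialgebra K H1 R1" "triangular_bialgebra K H2 R2"
  shows "twisted_tensor_product K H R H1 R1 H2 R2 \<longleftrightarrow>
    (\<exists>F f. is_twist K (tensor_bialgebra K H1 H2) F \<and>
       f \<in> triangular_iso K H R (twisted K (tensor_bialgebra K H1 H2) F)
         (twisted_R K (tensor_bialgebra K H1 H2) F (interleave K H1 H2 R1 R2)))"
  using assms[THEN triangular_bialgebra.axioms(1)] unfolding twisted_tensor_product_def by blast

end

theory Submission
  imports Defs
begin

text \<open>
  Once the tensor product of algebras, built from cosets of formal sums, is known to have its
  universal property, everything is proved in the language of points. For algebras \<open>A\<close>, \<open>B\<close>, \<open>T\<close>,
  an algebra map \<open>A \<otimes> B \<rightarrow> T\<close> is the same thing as a pair of algebra maps \<open>x : A \<rightarrow> T\<close>, \<open>y : B \<rightarrow> T\<close>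
  with commuting images; write \<open>X[x, y]\<close> for the value at \<open>X \<in> A \<otimes> B\<close> of the map corresponding to
  the pair (this is \<open>copair K T x y X\<close> below), and call the algebra maps \<open>H \<rightarrow> T\<close> the points of \<open>H\<close>
  in \<open>T\<close>. Commuting points of a bialgebra have a convolution product \<open>x * y = [x, y] \<circ> \<Delta>\<close>, and all
  axioms become identities in the single algebra \<open>T\<close>: \<open>*\<close> is associative with unit \<open>\<epsilon>\<close>; a twist
  satisfies \<open>F[x, y] F[x * y, z] = F[y, z] F[x, y * z]\<close>; an R-matrix satisfies \<open>R[x, y] (x * y) =
  (y * x) R[x, y]\<close> and \<open>R[x, y * z] = R[x, z] R[x, y]\<close>; triangularity is \<open>R[y, x] R[x, y] = 1\<close>,
  and given this the second hexagon identity follows from the first. Conversely, the axioms follow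
  by inserting the canonical inclusions of \<open>H\<close> into \<open>H \<otimes> H\<close> and \<open>H \<otimes> (H \<otimes> H)\<close>. A point of \<open>H\<^sub>1 \<otimes>
  H\<^sub>2\<close> is a commuting pair \<open>p = (p\<^sub>1, p\<^sub>2)\<close> of points, and convolution and R-matrix of the tensor
  product bialgebra are componentwise.

  The diagonal of \<open>(f\<^sub>1, F\<^sub>1)\<close> and \<open>(f\<^sub>2, F\<^sub>2)\<close> has the twist \<open>F[p, q] = R[q\<^sub>1 f\<^sub>1, p\<^sub>2 f\<^sub>2]
  F\<^sub>1[p\<^sub>1, q\<^sub>1] F\<^sub>2[p\<^sub>2, q\<^sub>2]\<close>, since \<open>R\<^sup>-\<^sup>1[x, y] = R[y, x]\<close>, and the map \<open>D\<close> with \<open>p \<circ> D = (p\<^sub>1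
  f\<^sub>1) * (p\<^sub>2 f\<^sub>2)\<close>. That it is always a 1-cell (\<open>FF_twist\<close>, \<open>D_bialgebra_hom\<close>,
  \<open>D_triangular_hom\<close>) is a computation with these formulas. A 1-cell \<open>(f, F)\<close> is invertible if and
  only if \<open>f\<close> is bijective, with inverse \<open>(g, (g \<otimes> g)(F\<^sup>-\<^sup>1))\<close> for \<open>g = f\<^sup>-\<^sup>1\<close>
  (\<open>invertible_onecell_bij\<close>, \<open>bijective_onecell.invertible\<close>); this is the equivalence of \<open>P1\<close> and
  \<open>P3\<close>, and it makes \<open>P2\<close> imply \<open>P4\<close>.

  For \<open>P3\<close> implies \<open>P2\<close>, compose \<open>f\<close> with the projections \<open>Id \<otimes> \<epsilon>\<close> and \<open>\<epsilon> \<otimes> Id\<close>, which are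
  morphisms of triangular bialgebras. Since \<open>(proj1 \<otimes> proj2) \<Delta>\<close> is the identity, the resulting
  diagonal map is \<open>h \<mapsto> A f(h) A\<^sup>-\<^sup>1\<close> with \<open>A = (proj1 \<otimes> proj2)(F)\<close>. Hence it is bijective and the
  diagonal 1-cell is invertible (\<open>split_bijective_onecell\<close>). For \<open>P4\<close> implies \<open>P2\<close>, the
  surjections \<open>f\<^sub>i\<close> carry the R-matrix to \<open>(H\<^sub>i)\<^sub>F\<close>, and undoing the twist gives \<open>R\<^sub>i[x, y] =
  F\<^sub>i[y, x]\<^sup>-\<^sup>1 R[x f\<^sub>i, y f\<^sub>i] F\<^sub>i[x, y]\<close>, which makes \<open>H\<^sub>i\<close> triangular and \<open>f\<^sub>i\<close> a morphism of
  triangular bialgebras (\<open>untwisting\<close>).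
\<close>

section \<open>Tensor products of modules\<close>

text \<open>\<open>\<beta>\<close> is bilinear as a map from the carriers of \<open>A\<close> and \<open>B\<close> to the carrier of \<open>C\<close>; its values
  elsewhere are irrelevant.\<close>

definition bilinear ::
  "('k, 'm) ring_scheme \<Rightarrow> ('k, 'a, 'n) module_scheme \<Rightarrow> ('k, 'b, 'p) module_scheme
    \<Rightarrow> ('k, 'c, 'q) module_scheme \<Rightarrow> ('a \<Rightarrow> 'b \<Rightarrow> 'c) \<Rightarrow> bool" where
  "bilinear K A B C \<beta> \<longleftrightarrow>
     (\<forall>a\<in>carrier A. \<forall>b\<in>carrier B. \<beta> a b \<in> carrier C) \<and>
     (\<forall>a\<in>carrier A. \<forall>a'\<in>carrier A. \<forall>b\<in>carrier B. \<beta> (a \<oplus>\<^bsub>A\<^esub> a') b = \<beta> a b \<oplus>\<^bsub>C\<^esub> \<beta> a' b) \<and>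
     (\<forall>a\<in>carrier A. \<forall>b\<in>carrier B. \<forall>b'\<in>carrier B. \<beta> a (b \<oplus>\<^bsub>B\<^esub> b') = \<beta> a b \<oplus>\<^bsub>C\<^esub> \<beta> a b') \<and>
     (\<forall>c\<in>carrier K. \<forall>a\<in>carrier A. \<forall>b\<in>carrier B. \<beta> (c \<odot>\<^bsub>A\<^esub> a) b = c \<odot>\<^bsub>C\<^esub> \<beta> a b) \<and>
     (\<forall>c\<in>carrier K. \<forall>a\<in>carrier A. \<forall>b\<in>carrier B. \<beta> a (c \<odot>\<^bsub>B\<^esub> b) = c \<odot>\<^bsub>C\<^esub> \<beta> a b)"

lemma bilinearI:
  assumes "\<And>a b. a \<in> carrier A \<Longrightarrow> b \<in> carrier B \<Longrightarrow> \<beta> a b \<in> carrier C"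
    and "\<And>a a' b. a \<in> carrier A \<Longrightarrow> a' \<in> carrier A \<Longrightarrow> b \<in> carrier B
          \<Longrightarrow> \<beta> (a \<oplus>\<^bsub>A\<^esub> a') b = \<beta> a b \<oplus>\<^bsub>C\<^esub> \<beta> a' b"
    and "\<And>a b b'. a \<in> carrier A \<Longrightarrow> b \<in> carrier B \<Longrightarrow> b' \<in> carrier B
          \<Longrightarrow> \<beta> a (b \<oplus>\<^bsub>B\<^esub> b') = \<beta> a b \<oplus>\<^bsub>C\<^esub> \<beta> a b'"
    and "\<And>c a b. c \<in> carrier K \<Longrightarrow> a \<in> carrier A \<Longrightarrow> b \<in> carrier B
          \<Longrightarrow> \<beta> (c \<odot>\<^bsub>A\<^esub> a) b = c \<odot>\<^bsub>C\<^esub> \<beta> a b"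
    and "\<And>c a b. c \<in> carrier K \<Longrightarrow> a \<in> carrier A \<Longrightarrow> b \<in> carrier B
          \<Longrightarrow> \<beta> a (c \<odot>\<^bsub>B\<^esub> b) = c \<odot>\<^bsub>C\<^esub> \<beta> a b"
  shows "bilinear K A B C \<beta>"
  using assms unfolding bilinear_def by blast

lemma bilinearD:
  assumes "bilinear K A B C \<beta>"
  shows "\<And>a b. a \<in> carrier A \<Longrightarrow> b \<in> carrier B \<Longrightarrow> \<beta> a b \<in> carrier C"
    and "\<And>a a' b. a \<in> carrier A \<Longrightarrow> a' \<in> carrier A \<Longrightarrow> b \<in> carrier B
          \<Longrightarrow> \<beta> (a \<oplus>\<^bsub>A\<^esub> a') b = \<beta> a b \<oplus>\<^bsub>C\<^esub> \<beta> a' b"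
    and "\<And>a b b'. a \<in> carrier A \<Longrightarrow> b \<in> carrier B \<Longrightarrow> b' \<in> carrier B
          \<Longrightarrow> \<beta> a (b \<oplus>\<^bsub>B\<^esub> b') = \<beta> a b \<oplus>\<^bsub>C\<^esub> \<beta> a b'"
    and "\<And>c a b. c \<in> carrier K \<Longrightarrow> a \<in> carrier A \<Longrightarrow> b \<in> carrier B
          \<Longrightarrow> \<beta> (c \<odot>\<^bsub>A\<^esub> a) b = c \<odot>\<^bsub>C\<^esub> \<beta> a b"
    and "\<And>c a b. c \<in> carrier K \<Longrightarrow> a \<in> carrier A \<Longrightarrow> b \<in> carrier B
          \<Longrightarrow> \<beta> a (c \<odot>\<^bsub>B\<^esub> b) = c \<odot>\<^bsub>C\<^esub> \<beta> a b"
  using assms unfolding bilinear_def by blast+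

lemma free_module_simps [simp]:
  "zero (free_module K S) = (\<lambda>s. \<zero>\<^bsub>K\<^esub>)"
  "add (free_module K S) x y = (\<lambda>s. x s \<oplus>\<^bsub>K\<^esub> y s)"
  "smult (free_module K S) c x = (\<lambda>s. c \<otimes>\<^bsub>K\<^esub> x s)"
  by (simp_all add: free_module_def)

lemma free_module_carrier_iff:
  "x \<in> carrier (free_module K S) \<longleftrightarrow>
    (\<forall>s\<in>S. x s \<in> carrier K) \<and> (\<forall>s. s \<notin> S \<longrightarrow> x s = \<zero>\<^bsub>K\<^esub>) \<and> finite {s. x s \<noteq> \<zero>\<^bsub>K\<^esub>}"
  by (simp add: free_module_def)

lemma free_module_coeff:
  assumes "cring K" "x \<in> carrier (free_module K S)"
  shows "x s \<in> carrier K"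
proof -
  interpret cring K by fact
  show ?thesis using assms(2) by (cases "s \<in> S") (auto simp: free_module_carrier_iff)
qed

lemma free_module_module:
  assumes "cring K"
  shows "module K (free_module K S)"
proof -
  interpret cring K by fact
  let ?F = "free_module K S"
  note cf = free_module_coeff[OF assms]
  have add: "x \<oplus>\<^bsub>?F\<^esub> y \<in> carrier ?F" if "x \<in> carrier ?F" "y \<in> carrier ?F" for x y
  proof -
    have "{s. x s \<oplus>\<^bsub>K\<^esub> y s \<noteq> \<zero>\<^bsub>K\<^esub>} \<subseteq> {s. x s \<noteq> \<zero>\<^bsub>K\<^esub>} \<union> {s. y s \<noteq> \<zero>\<^bsub>K\<^esub>}"
      using that by (auto simp: free_module_carrier_iff)
    with that show ?thesis
      by (auto simp: free_module_carrier_iff intro: finite_subset)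
  qed
  have sm: "c \<odot>\<^bsub>?F\<^esub> x \<in> carrier ?F" if "c \<in> carrier K" "x \<in> carrier ?F" for c x
  proof -
    have "{s. c \<otimes>\<^bsub>K\<^esub> x s \<noteq> \<zero>\<^bsub>K\<^esub>} \<subseteq> {s. x s \<noteq> \<zero>\<^bsub>K\<^esub>}"
      using that by auto
    with that show ?thesis
      by (auto simp: free_module_carrier_iff intro: finite_subset)
  qed
  have inv: "\<exists>y\<in>carrier ?F. y \<oplus>\<^bsub>?F\<^esub> x = \<zero>\<^bsub>?F\<^esub>" if "x \<in> carrier ?F" for x
  proof (rule bexI)
    show "(\<ominus>\<^bsub>K\<^esub> \<one>\<^bsub>K\<^esub>) \<odot>\<^bsub>?F\<^esub> x \<in> carrier ?F" using that by (intro sm) auto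
    show "(\<ominus>\<^bsub>K\<^esub> \<one>\<^bsub>K\<^esub>) \<odot>\<^bsub>?F\<^esub> x \<oplus>\<^bsub>?F\<^esub> x = \<zero>\<^bsub>?F\<^esub>"
      using cf[OF that] by (auto simp: l_minus l_neg)
  qed
  show ?thesis
  proof (rule moduleI[OF assms])
    show "abelian_group ?F"
    proof (rule abelian_groupI)
      show "\<zero>\<^bsub>?F\<^esub> \<in> carrier ?F" by (auto simp: free_module_carrier_iff)
    qed (use add inv in \<open>auto simp: cf a_ac\<close>)
  qed (use sm in \<open>auto simp: cf l_distr r_distr m_assoc\<close>)
qed

lemma free_gen_closed:
  assumes "cring K" "p \<in> S"
  shows "free_gen K p \<in> carrier (free_module K S)"
proof -
  interpret cring K by fact
  have "{s. free_gen K p s \<noteq> \<zero>\<^bsub>K\<^esub>} \<subseteq> {p}" by (auto simp: free_gen_def)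
  then show ?thesis
    using assms(2) by (auto simp: free_module_carrier_iff free_gen_def intro: finite_subset)
qed

text \<open>Every formal sum is obtained from zero by successively adding multiples of generators.\<close>

lemma free_module_induct [consumes 2, case_names zero step]:
  assumes K: "cring K" and x: "x \<in> carrier (free_module K S)"
    and zero: "P (\<lambda>s. \<zero>\<^bsub>K\<^esub>)"
    and step: "\<And>c p y. c \<in> carrier K \<Longrightarrow> p \<in> S \<Longrightarrow> y \<in> carrier (free_module K S) \<Longrightarrow> P y
      \<Longrightarrow> P ((c \<odot>\<^bsub>free_module K S\<^esub> free_gen K p) \<oplus>\<^bsub>free_module K S\<^esub> y)"
  shows "P x"
  using x
proof (induction "card {s. x s \<noteq> \<zero>\<^bsub>K\<^esub>}" arbitrary: x)
  case 0
  then have "{s. x s \<noteq> \<zero>\<^bsub>K\<^esub>} = {}" by (simp add: free_module_carrier_iff)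
  then have "x = (\<lambda>s. \<zero>\<^bsub>K\<^esub>)" by auto
  then show ?case using zero by simp
next
  case (Suc n)
  interpret cring K by fact
  have fin: "finite {s. x s \<noteq> \<zero>\<^bsub>K\<^esub>}" using Suc.prems by (simp add: free_module_carrier_iff)
  from Suc.hyps(2) have "{s. x s \<noteq> \<zero>\<^bsub>K\<^esub>} \<noteq> {}" by force
  then obtain p where p: "x p \<noteq> \<zero>\<^bsub>K\<^esub>" by auto
  then have pS: "p \<in> S" using Suc.prems by (auto simp: free_module_carrier_iff)
  have xp: "x p \<in> carrier K" using free_module_coeff[OF K Suc.prems] .
  let ?y = "x(p := \<zero>\<^bsub>K\<^esub>)"
  have supp: "{s. ?y s \<noteq> \<zero>\<^bsub>K\<^esub>} = {s. x s \<noteq> \<zero>\<^bsub>K\<^esub>} - {p}" by auto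
  have y: "?y \<in> carrier (free_module K S)"
    using Suc.prems fin supp by (auto simp: free_module_carrier_iff)
  have "n = card {s. ?y s \<noteq> \<zero>\<^bsub>K\<^esub>}"
    unfolding supp using Suc.hyps(2) fin p by (simp add: card_Diff_singleton)
  from Suc.hyps(1)[OF this y] have "P ?y" .
  from step[OF xp pS y this]
  have "P ((x p \<odot>\<^bsub>free_module K S\<^esub> free_gen K p) \<oplus>\<^bsub>free_module K S\<^esub> ?y)" .
  also have "(x p \<odot>\<^bsub>free_module K S\<^esub> free_gen K p) \<oplus>\<^bsub>free_module K S\<^esub> ?y = x"
    using free_module_coeff[OF K Suc.prems] by (auto simp: free_gen_def)
  finally show ?case .
qed

text \<open>Facts on the tensor product of two modules: \<open>F\<close> is the module of formal sums and \<open>N\<close> the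
  submodule of bilinearity relations.\<close>

locale module_pair = A: module K A + B: module K B for K (structure) and A and B
begin

abbreviation "F \<equiv> free_module K (carrier A \<times> carrier B)"
abbreviation "N \<equiv> tensor_null K A B"

sublocale F: module K F
  by (rule free_module_module) (rule A.R.is_cring)

lemma gen_closed: "a \<in> carrier A \<Longrightarrow> b \<in> carrier B \<Longrightarrow> free_gen K (a, b) \<in> carrier F"
  by (rule free_gen_closed) (auto simp: A.R.is_cring)

lemma bilinear_rels_subset: "bilinear_rels K A B \<subseteq> carrier F"
  unfolding bilinear_rels_def Let_def
  by (auto simp del: free_module_simps intro!: F.minus_closed F.add.m_closed F.smult_closed gen_closed)

lemma null_submodule: "submodule N K F"
proof (rule F.submoduleI)
  let ?S = "{N. submodule N K F \<and> bilinear_rels K A B \<subseteq> N}"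
  have "carrier F \<in> ?S" using F.carrier_is_submodule bilinear_rels_subset by simp
  then show "N \<subseteq> carrier F" unfolding tensor_null_def by blast
  show "\<zero>\<^bsub>F\<^esub> \<in> N" unfolding tensor_null_def
    using subgroup.one_closed[OF submodule.axioms(1)] by fastforce
qed (auto simp: tensor_null_def F.submoduleE simp del: free_module_simps)

lemma bilinear_rels_null: "bilinear_rels K A B \<subseteq> N"
  unfolding tensor_null_def by blast

sublocale N: abelian_subgroup N F
  by (rule abelian_subgroupI3)
    (auto intro: additive_subgroupI submodule.axioms(1)[OF null_submodule] F.abelian_group_axioms)

lemma tensor_module_simps:
  "carrier (tensor_module K A B) = a_rcosets\<^bsub>F\<^esub> N"
  "zero (tensor_module K A B) = N"
  "add (tensor_module K A B) X Y = X <+>\<^bsub>F\<^esub> Y"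
  "smult (tensor_module K A B) c X = (\<Union>x\<in>X. N +>\<^bsub>F\<^esub> (c \<odot>\<^bsub>F\<^esub> x))"
  by (simp_all add: tensor_module_def Let_def)

lemma coset_smult:
  assumes "c \<in> carrier K" "x \<in> carrier F"
  shows "c \<odot>\<^bsub>tensor_module K A B\<^esub> (N +>\<^bsub>F\<^esub> x) = N +>\<^bsub>F\<^esub> (c \<odot>\<^bsub>F\<^esub> x)"
proof -
  have *: "N +>\<^bsub>F\<^esub> (c \<odot>\<^bsub>F\<^esub> y) = N +>\<^bsub>F\<^esub> (c \<odot>\<^bsub>F\<^esub> x)" if "y \<in> N +>\<^bsub>F\<^esub> x" for y
  proof -
    from that obtain n where n: "n \<in> N" "y = n \<oplus>\<^bsub>F\<^esub> x"
      by (auto simp: a_r_coset_def')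
    have "c \<odot>\<^bsub>F\<^esub> y = c \<odot>\<^bsub>F\<^esub> n \<oplus>\<^bsub>F\<^esub> c \<odot>\<^bsub>F\<^esub> x"
      using assms n by (simp only: n(2) F.smult_r_distr N.a_Hcarr)
    moreover have "c \<odot>\<^bsub>F\<^esub> n \<in> N"
      using submodule.smult_closed[OF null_submodule] assms(1) n(1) by blast
    ultimately have "c \<odot>\<^bsub>F\<^esub> y \<in> N +>\<^bsub>F\<^esub> (c \<odot>\<^bsub>F\<^esub> x)" by (auto simp: a_r_coset_def')
    then show ?thesis
      using N.a_repr_independence' F.smult_closed[OF assms] by metis
  qed
  have "x \<in> N +>\<^bsub>F\<^esub> x" using N.a_rcos_self assms(2) by blast
  with * show ?thesis unfolding tensor_module_simps by blast
qed

lemma coset_add: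
  assumes "x \<in> carrier F" "y \<in> carrier F"
  shows "(N +>\<^bsub>F\<^esub> x) \<oplus>\<^bsub>tensor_module K A B\<^esub> (N +>\<^bsub>F\<^esub> y) = N +>\<^bsub>F\<^esub> (x \<oplus>\<^bsub>F\<^esub> y)"
  unfolding tensor_module_simps using assms by (rule N.a_rcos_sum)

lemma coset_closed: "x \<in> carrier F \<Longrightarrow> N +>\<^bsub>F\<^esub> x \<in> carrier (tensor_module K A B)"
  unfolding tensor_module_simps using F.a_rcosetsI N.a_subset by blast

lemma coset_cases:
  assumes "X \<in> carrier (tensor_module K A B)"
  obtains x where "x \<in> carrier F" "X = N +>\<^bsub>F\<^esub> x"
  using assms unfolding tensor_module_simps A_RCOSETS_def' by auto

lemma coset_zero: "\<zero>\<^bsub>tensor_module K A B\<^esub> = N +>\<^bsub>F\<^esub> \<zero>\<^bsub>F\<^esub>"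
  unfolding tensor_module_simps using F.a_coset_add_zero[OF N.a_subset] by simp

lemma tensor_module_module: "module K (tensor_module K A B)"
proof (rule moduleI)
  let ?T = "tensor_module K A B"
  show "abelian_group ?T"
  proof (rule abelian_groupI)
    show "\<zero>\<^bsub>?T\<^esub> \<in> carrier ?T" unfolding coset_zero by (intro coset_closed F.zero_closed)
  next
    fix X Y assume "X \<in> carrier ?T" "Y \<in> carrier ?T"
    then obtain x y where xy: "x \<in> carrier F" "X = N +>\<^bsub>F\<^esub> x" "y \<in> carrier F" "Y = N +>\<^bsub>F\<^esub> y"
      by (metis coset_cases)
    show "X \<oplus>\<^bsub>?T\<^esub> Y \<in> carrier ?T"
      using xy by (simp only: coset_add coset_closed F.add.m_closed)
    show "X \<oplus>\<^bsub>?T\<^esub> Y = Y \<oplus>\<^bsub>?T\<^esub> X"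
      using xy by (simp only: coset_add F.a_comm)
    fix Z assume "Z \<in> carrier ?T"
    then obtain z where z: "z \<in> carrier F" "Z = N +>\<^bsub>F\<^esub> z" by (rule coset_cases)
    show "X \<oplus>\<^bsub>?T\<^esub> Y \<oplus>\<^bsub>?T\<^esub> Z = X \<oplus>\<^bsub>?T\<^esub> (Y \<oplus>\<^bsub>?T\<^esub> Z)"
      using xy z by (simp only: coset_add F.a_assoc F.add.m_closed)
  next
    fix X assume "X \<in> carrier ?T"
    then obtain x where x: "x \<in> carrier F" "X = N +>\<^bsub>F\<^esub> x" by (rule coset_cases)
    show "\<zero>\<^bsub>?T\<^esub> \<oplus>\<^bsub>?T\<^esub> X = X"
      unfolding coset_zero x(2) coset_add[OF F.zero_closed x(1)] F.l_zero[OF x(1)] ..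
    have "(N +>\<^bsub>F\<^esub> (\<ominus>\<^bsub>F\<^esub> x)) \<oplus>\<^bsub>?T\<^esub> X = \<zero>\<^bsub>?T\<^esub>"
      unfolding coset_zero x(2) coset_add[OF F.a_inv_closed[OF x(1)] x(1)] F.l_neg[OF x(1)] ..
    then show "\<exists>Y\<in>carrier ?T. Y \<oplus>\<^bsub>?T\<^esub> X = \<zero>\<^bsub>?T\<^esub>"
      using coset_closed[OF F.a_inv_closed[OF x(1)]] by blast
  qed
  show "cring K" by (rule A.R.is_cring)
  fix c X assume c: "c \<in> carrier K" and X: "X \<in> carrier ?T"
  from X obtain x where x: "x \<in> carrier F" "X = N +>\<^bsub>F\<^esub> x" by (rule coset_cases)
  show "c \<odot>\<^bsub>?T\<^esub> X \<in> carrier ?T" using c x by (simp only: coset_smult coset_closed F.smult_closed)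
  { fix d assume d: "d \<in> carrier K"
    show "(c \<oplus> d) \<odot>\<^bsub>?T\<^esub> X = c \<odot>\<^bsub>?T\<^esub> X \<oplus>\<^bsub>?T\<^esub> d \<odot>\<^bsub>?T\<^esub> X"
      using c d x by (simp only: coset_smult coset_add F.smult_closed F.smult_l_distr A.R.add.m_closed)
    show "(c \<otimes> d) \<odot>\<^bsub>?T\<^esub> X = c \<odot>\<^bsub>?T\<^esub> (d \<odot>\<^bsub>?T\<^esub> X)"
      using c d x by (simp only: coset_smult F.smult_closed F.smult_assoc1 A.R.m_closed) }
  { fix Y assume "Y \<in> carrier ?T"
    then obtain y where y: "y \<in> carrier F" "Y = N +>\<^bsub>F\<^esub> y" by (rule coset_cases)
    show "c \<odot>\<^bsub>?T\<^esub> (X \<oplus>\<^bsub>?T\<^esub> Y) = c \<odot>\<^bsub>?T\<^esub> X \<oplus>\<^bsub>?T\<^esub> c \<odot>\<^bsub>?T\<^esub> Y"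
      using c x y by (simp only: coset_smult coset_add F.smult_closed F.smult_r_distr F.add.m_closed) }
next
  let ?T = "tensor_module K A B"
  fix X assume X: "X \<in> carrier ?T"
  then obtain x where x: "x \<in> carrier F" "X = N +>\<^bsub>F\<^esub> x" by (rule coset_cases)
  show "\<one> \<odot>\<^bsub>?T\<^esub> X = X" using x by (simp only: coset_smult A.R.one_closed F.smult_one)
qed

lemma coset_eqI:
  assumes "x \<in> carrier F" "y \<in> carrier F" "x \<ominus>\<^bsub>F\<^esub> y \<in> N"
  shows "N +>\<^bsub>F\<^esub> x = N +>\<^bsub>F\<^esub> y"
  using assms N.a_rcos_module_rev[of y x] N.a_repr_independence'[of x y]
  unfolding a_minus_def by blast

lemma pure_closed [simp, intro]:
  "a \<in> carrier A \<Longrightarrow> b \<in> carrier B \<Longrightarrow> pure_tensor K A B a b \<in> carrier (tensor_module K A B)"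
  unfolding pure_tensor_def by (intro coset_closed gen_closed)

lemma pure_bilinear: "bilinear K A B (tensor_module K A B) (pure_tensor K A B)"
proof (rule bilinearI)
  let ?T = "tensor_module K A B" and ?p = "pure_tensor K A B"
  note rels = subsetD[OF bilinear_rels_null]
  show "?p a b \<in> carrier ?T" if "a \<in> carrier A" "b \<in> carrier B" for a b
    using that by (rule pure_closed)
  show "?p (a \<oplus>\<^bsub>A\<^esub> a') b = ?p a b \<oplus>\<^bsub>?T\<^esub> ?p a' b"
    if *: "a \<in> carrier A" "a' \<in> carrier A" "b \<in> carrier B" for a a' b
    unfolding pure_tensor_def coset_add[OF gen_closed[OF *(1,3)] gen_closed[OF *(2,3)]]
    using * by (intro coset_eqI rels gen_closed F.add.m_closed A.add.m_closed)
      (assumption+, unfold bilinear_rels_def Let_def, rule UnI1, rule UnI1, rule UnI1, blast)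
  show "?p a (b \<oplus>\<^bsub>B\<^esub> b') = ?p a b \<oplus>\<^bsub>?T\<^esub> ?p a b'"
    if *: "a \<in> carrier A" "b \<in> carrier B" "b' \<in> carrier B" for a b b'
    unfolding pure_tensor_def coset_add[OF gen_closed[OF *(1,2)] gen_closed[OF *(1,3)]]
    using * by (intro coset_eqI rels gen_closed F.add.m_closed B.add.m_closed)
      (assumption+, unfold bilinear_rels_def Let_def, rule UnI1, rule UnI1, rule UnI2, blast)
  show "?p (c \<odot>\<^bsub>A\<^esub> a) b = c \<odot>\<^bsub>?T\<^esub> ?p a b"
    if *: "c \<in> carrier K" "a \<in> carrier A" "b \<in> carrier B" for c a b
    unfolding pure_tensor_def coset_smult[OF *(1) gen_closed[OF *(2,3)]]
    using * by (intro coset_eqI rels gen_closed F.smult_closed A.smult_closed)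
      (assumption+, unfold bilinear_rels_def Let_def, rule UnI1, rule UnI2, blast)
  show "?p a (c \<odot>\<^bsub>B\<^esub> b) = c \<odot>\<^bsub>?T\<^esub> ?p a b"
    if *: "c \<in> carrier K" "a \<in> carrier A" "b \<in> carrier B" for c a b
    unfolding pure_tensor_def coset_smult[OF *(1) gen_closed[OF *(2,3)]]
    using * by (intro coset_eqI rels gen_closed F.smult_closed B.smult_closed)
      (assumption+, unfold bilinear_rels_def Let_def, rule UnI2, blast)
qed

text \<open>Scalars can be absorbed into a pure tensor, so sums of pure tensors exhaust the tensor
  product.\<close>

lemma tensor_module_induct:
  assumes X: "X \<in> carrier (tensor_module K A B)"
    and pure: "\<And>a b. a \<in> carrier A \<Longrightarrow> b \<in> carrier B \<Longrightarrow> P (pure_tensor K A B a b)"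
    and add: "\<And>X Y. X \<in> carrier (tensor_module K A B) \<Longrightarrow> Y \<in> carrier (tensor_module K A B)
      \<Longrightarrow> P X \<Longrightarrow> P Y \<Longrightarrow> P (X \<oplus>\<^bsub>tensor_module K A B\<^esub> Y)"
  shows "P X"
proof -
  let ?T = "tensor_module K A B"
  interpret T: module K ?T by (rule tensor_module_module)
  note bil = bilinearD[OF pure_bilinear]
  obtain x where x: "x \<in> carrier F" "X = N +>\<^bsub>F\<^esub> x" using X by (rule coset_cases)
  from A.R.is_cring x(1) have "P (N +>\<^bsub>F\<^esub> x)"
  proof (induction rule: free_module_induct)
    case zero
    have "pure_tensor K A B \<zero>\<^bsub>A\<^esub> \<zero>\<^bsub>B\<^esub> = pure_tensor K A B (\<zero> \<odot>\<^bsub>A\<^esub> \<zero>\<^bsub>A\<^esub>) \<zero>\<^bsub>B\<^esub>" by simp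
    also have "\<dots> = \<zero>\<^bsub>?T\<^esub>" by (subst bil(4)) auto
    finally show ?case using pure[of "\<zero>\<^bsub>A\<^esub>" "\<zero>\<^bsub>B\<^esub>"] coset_zero by simp
  next
    case (step c p y)
    obtain a b where p: "p = (a, b)" "a \<in> carrier A" "b \<in> carrier B" using step(2) by (cases p) auto
    have g: "free_gen K p \<in> carrier F" using gen_closed p by simp
    have "N +>\<^bsub>F\<^esub> ((c \<odot>\<^bsub>F\<^esub> free_gen K p) \<oplus>\<^bsub>F\<^esub> y)
        = c \<odot>\<^bsub>?T\<^esub> pure_tensor K A B a b \<oplus>\<^bsub>?T\<^esub> (N +>\<^bsub>F\<^esub> y)"
      unfolding pure_tensor_def p(1)[symmetric] using g step(1,3)
      by (simp only: coset_smult coset_add F.smult_closed)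
    also have "\<dots> = pure_tensor K A B (c \<odot>\<^bsub>A\<^esub> a) b \<oplus>\<^bsub>?T\<^esub> (N +>\<^bsub>F\<^esub> y)"
      using step(1) p by (simp add: bil(4))
    finally show ?case using step p by (auto intro!: add pure coset_closed)
  qed
  then show ?thesis using x(2) by simp
qed

end

text \<open>For bilinear \<open>\<beta>\<close>, the linear extension of \<open>\<beta>\<close> to formal sums vanishes on the bilinearity
  relations and hence is constant on cosets. Therefore \<open>tensor_lift\<close> has the universal property.\<close>

locale bilinear_map = module_pair K A B + C: module K C
  for K (structure) and A and B and C +
  fixes \<beta>
  assumes bilin: "bilinear K A B C \<beta>"
begin

text \<open>The linear extension of \<open>\<beta>\<close> to formal sums.\<close>

definition "ev x = finsum C (\<lambda>(a, b). x (a, b) \<odot>\<^bsub>C\<^esub> \<beta> a b) {p. x p \<noteq> \<zero>}"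

lemmas bil = bilinearD[OF bilin]

lemma ev_supp:
  assumes x: "x \<in> carrier F" and "finite S" "{p. x p \<noteq> \<zero>} \<subseteq> S" "S \<subseteq> carrier A \<times> carrier B"
  shows "ev x = finsum C (\<lambda>(a, b). x (a, b) \<odot>\<^bsub>C\<^esub> \<beta> a b) S"
  unfolding ev_def using assms free_module_coeff[OF A.R.is_cring x]
  by (intro C.add.finprod_mono_neutral_cong_left) (auto simp: bil)

lemma supp: "x \<in> carrier F \<Longrightarrow> {p. x p \<noteq> \<zero>} \<subseteq> carrier A \<times> carrier B"
  "x \<in> carrier F \<Longrightarrow> finite {p. x p \<noteq> \<zero>}"
  by (auto simp: free_module_carrier_iff)

lemma ev_closed: "x \<in> carrier F \<Longrightarrow> ev x \<in> carrier C"
  unfolding ev_def using supp free_module_coeff[OF A.R.is_cring]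
  by (intro C.finsum_closed) (fastforce simp: bil)

lemma ev_add:
  assumes x: "x \<in> carrier F" and y: "y \<in> carrier F"
  shows "ev (x \<oplus>\<^bsub>F\<^esub> y) = ev x \<oplus>\<^bsub>C\<^esub> ev y"
proof -
  let ?S = "{p. x p \<noteq> \<zero>} \<union> {p. y p \<noteq> \<zero>}"
  note cf = free_module_coeff[OF A.R.is_cring x] free_module_coeff[OF A.R.is_cring y]
  have S: "finite ?S" "?S \<subseteq> carrier A \<times> carrier B" using supp x y by blast+
  have "{p. (x \<oplus>\<^bsub>F\<^esub> y) p \<noteq> \<zero>} \<subseteq> ?S" by auto
  then have "ev (x \<oplus>\<^bsub>F\<^esub> y) = finsum C (\<lambda>(a, b). (x \<oplus>\<^bsub>F\<^esub> y) (a, b) \<odot>\<^bsub>C\<^esub> \<beta> a b) ?S"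
    using S F.add.m_closed[OF x y] by (intro ev_supp) auto
  also have "\<dots> = finsum C (\<lambda>p. (case p of (a, b) \<Rightarrow> x (a, b) \<odot>\<^bsub>C\<^esub> \<beta> a b) \<oplus>\<^bsub>C\<^esub>
      (case p of (a, b) \<Rightarrow> y (a, b) \<odot>\<^bsub>C\<^esub> \<beta> a b)) ?S"
    using S(2) by (intro C.finsum_cong') (auto simp: cf bil C.smult_l_distr)
  also have "\<dots> = finsum C (\<lambda>(a, b). x (a, b) \<odot>\<^bsub>C\<^esub> \<beta> a b) ?S
      \<oplus>\<^bsub>C\<^esub> finsum C (\<lambda>(a, b). y (a, b) \<odot>\<^bsub>C\<^esub> \<beta> a b) ?S"
    using S(2) by (intro C.finsum_addf) (auto simp: cf bil)
  also have "\<dots> = ev x \<oplus>\<^bsub>C\<^esub> ev y"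
    using S ev_supp[OF x, of ?S] ev_supp[OF y, of ?S] by simp
  finally show ?thesis .
qed

lemma ev_smult:
  assumes c: "c \<in> carrier K" and x: "x \<in> carrier F"
  shows "ev (c \<odot>\<^bsub>F\<^esub> x) = c \<odot>\<^bsub>C\<^esub> ev x"
proof -
  let ?S = "{p. x p \<noteq> \<zero>}"
  note cf = free_module_coeff[OF A.R.is_cring x]
  note S = supp[OF x]
  have "{p. (c \<odot>\<^bsub>F\<^esub> x) p \<noteq> \<zero>} \<subseteq> ?S" using c by auto
  then have "ev (c \<odot>\<^bsub>F\<^esub> x) = finsum C (\<lambda>(a, b). (c \<odot>\<^bsub>F\<^esub> x) (a, b) \<odot>\<^bsub>C\<^esub> \<beta> a b) ?S"
    using S F.smult_closed[OF c x] by (intro ev_supp) auto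
  also have "\<dots> = finsum C (\<lambda>p. c \<odot>\<^bsub>C\<^esub> (case p of (a, b) \<Rightarrow> x (a, b) \<odot>\<^bsub>C\<^esub> \<beta> a b)) ?S"
    using S(1) c by (intro C.finsum_cong') (auto simp: cf bil C.smult_assoc1)
  also have "\<dots> = c \<odot>\<^bsub>C\<^esub> ev x"
    unfolding ev_def using S c
    by (intro C.finsum_smult_ldistr[symmetric]) (auto simp: cf bil)
  finally show ?thesis .
qed

lemma ev_gen:
  assumes "a \<in> carrier A" "b \<in> carrier B"
  shows "ev (free_gen K (a, b)) = \<beta> a b"
proof -
  have "ev (free_gen K (a, b)) = finsum C (\<lambda>(a', b'). free_gen K (a, b) (a', b') \<odot>\<^bsub>C\<^esub> \<beta> a' b') {(a, b)}"
    using assms by (intro ev_supp gen_closed) (auto simp: free_gen_def)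
  also have "\<dots> = \<beta> a b"
    using assms by (simp add: free_gen_def bil)
  finally show ?thesis .
qed

lemma ev_kernel: "submodule {x \<in> carrier F. ev x = \<zero>\<^bsub>C\<^esub>} K F"
proof (rule F.submoduleI)
  have z: "ev \<zero>\<^bsub>F\<^esub> = \<zero>\<^bsub>C\<^esub>" by (simp add: ev_def)
  then show "\<zero>\<^bsub>F\<^esub> \<in> {x \<in> carrier F. ev x = \<zero>\<^bsub>C\<^esub>}" using F.zero_closed by blast
  fix x assume "x \<in> {x \<in> carrier F. ev x = \<zero>\<^bsub>C\<^esub>}"
  then have x: "x \<in> carrier F" "ev x = \<zero>\<^bsub>C\<^esub>" by auto
  have "ev (\<ominus>\<^bsub>F\<^esub> x) \<oplus>\<^bsub>C\<^esub> ev x = \<zero>\<^bsub>C\<^esub>"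
    using ev_add[OF F.a_inv_closed[OF x(1)] x(1)] F.l_neg[OF x(1)] z by simp
  then show "\<ominus>\<^bsub>F\<^esub> x \<in> {x \<in> carrier F. ev x = \<zero>\<^bsub>C\<^esub>}"
    using x ev_closed[OF F.a_inv_closed[OF x(1)]] F.a_inv_closed[OF x(1)] by simp
qed (use ev_add ev_smult F.add.m_closed F.smult_closed in \<open>auto simp del: free_module_simps\<close>)

lemma ev_minus:
  assumes x: "x \<in> carrier F" and y: "y \<in> carrier F" and eq: "ev x = ev y"
  shows "x \<ominus>\<^bsub>F\<^esub> y \<in> {x \<in> carrier F. ev x = \<zero>\<^bsub>C\<^esub>}"
proof -
  have d: "x \<ominus>\<^bsub>F\<^esub> y \<in> carrier F" using F.minus_closed[OF x y] .
  have "(x \<ominus>\<^bsub>F\<^esub> y) \<oplus>\<^bsub>F\<^esub> y = x"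
    unfolding a_minus_def
    using F.a_assoc[OF x F.a_inv_closed[OF y] y] F.l_neg[OF y] F.r_zero[OF x] by presburger
  then have "ev (x \<ominus>\<^bsub>F\<^esub> y) \<oplus>\<^bsub>C\<^esub> ev y = ev y" using ev_add[OF d y] eq by simp
  then have "ev (x \<ominus>\<^bsub>F\<^esub> y) = \<zero>\<^bsub>C\<^esub>"
    using C.add.l_cancel_one'[OF ev_closed[OF y] ev_closed[OF d]] ev_closed[OF d] ev_closed[OF y]
    by (metis C.add.r_cancel_one')
  with d show ?thesis by simp
qed

lemma ev_null: "n \<in> N \<Longrightarrow> ev n = \<zero>\<^bsub>C\<^esub>"
proof -
  have "bilinear_rels K A B \<subseteq> {x \<in> carrier F. ev x = \<zero>\<^bsub>C\<^esub>}"
    unfolding bilinear_rels_def Let_def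
  proof (intro Un_least subsetI; elim CollectE exE conjE; hypsubst)
    fix a a' b assume *: "a \<in> carrier A" "a' \<in> carrier A" "b \<in> carrier B"
    show "free_gen K (a \<oplus>\<^bsub>A\<^esub> a', b) \<ominus>\<^bsub>F\<^esub> (free_gen K (a, b) \<oplus>\<^bsub>F\<^esub> free_gen K (a', b))
        \<in> {x \<in> carrier F. ev x = \<zero>\<^bsub>C\<^esub>}"
      using * by (intro ev_minus gen_closed F.add.m_closed A.add.m_closed)
        (simp_all only: ev_add ev_gen gen_closed bil A.add.m_closed)
  next
    fix a b b' assume *: "a \<in> carrier A" "b \<in> carrier B" "b' \<in> carrier B"
    show "free_gen K (a, b \<oplus>\<^bsub>B\<^esub> b') \<ominus>\<^bsub>F\<^esub> (free_gen K (a, b) \<oplus>\<^bsub>F\<^esub> free_gen K (a, b'))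
        \<in> {x \<in> carrier F. ev x = \<zero>\<^bsub>C\<^esub>}"
      using * by (intro ev_minus gen_closed F.add.m_closed B.add.m_closed)
        (simp_all only: ev_add ev_gen gen_closed bil B.add.m_closed)
  next
    fix c a b assume *: "c \<in> carrier K" "a \<in> carrier A" "b \<in> carrier B"
    show "free_gen K (c \<odot>\<^bsub>A\<^esub> a, b) \<ominus>\<^bsub>F\<^esub> (c \<odot>\<^bsub>F\<^esub> free_gen K (a, b)) \<in> {x \<in> carrier F. ev x = \<zero>\<^bsub>C\<^esub>}"
      using * by (intro ev_minus gen_closed F.smult_closed A.smult_closed)
        (simp_all only: ev_smult ev_gen gen_closed bil A.smult_closed)
    show "free_gen K (a, c \<odot>\<^bsub>B\<^esub> b) \<ominus>\<^bsub>F\<^esub> (c \<odot>\<^bsub>F\<^esub> free_gen K (a, b)) \<in> {x \<in> carrier F. ev x = \<zero>\<^bsub>C\<^esub>}"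
      using * by (intro ev_minus gen_closed F.smult_closed B.smult_closed)
        (simp_all only: ev_smult ev_gen gen_closed bil B.smult_closed)
  qed
  then have "N \<subseteq> {x \<in> carrier F. ev x = \<zero>\<^bsub>C\<^esub>}"
    unfolding tensor_null_def using ev_kernel by blast
  then show "n \<in> N \<Longrightarrow> ev n = \<zero>\<^bsub>C\<^esub>" by blast
qed

lemma lift_coset:
  assumes x: "x \<in> carrier F"
  shows "tensor_lift K C \<beta> (N +>\<^bsub>F\<^esub> x) = ev x"
proof -
  have const: "ev y = ev x" if "y \<in> N +>\<^bsub>F\<^esub> x" for y
  proof -
    from that obtain n where n: "n \<in> N" "y = n \<oplus>\<^bsub>F\<^esub> x" by (auto simp: a_r_coset_def')
    have "ev y = ev n \<oplus>\<^bsub>C\<^esub> ev x" unfolding n(2) using n(1) x by (intro ev_add) auto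
    then show ?thesis using ev_null[OF n(1)] ev_closed[OF x] by simp
  qed
  have "ev ` (N +>\<^bsub>F\<^esub> x) = (\<lambda>_. ev x) ` (N +>\<^bsub>F\<^esub> x)" by (rule image_cong[OF refl const])
  also have "\<dots> = {ev x}" by (rule image_constant[OF N.a_rcos_self[OF x]])
  finally have "ev ` (N +>\<^bsub>F\<^esub> x) = {ev x}" .
  moreover have "tensor_lift K C \<beta> X = the_elem (ev ` X)" for X
    by (simp only: tensor_lift_def ev_def[abs_def])
  ultimately show ?thesis by simp
qed

lemma lift_pure: "a \<in> carrier A \<Longrightarrow> b \<in> carrier B \<Longrightarrow> tensor_lift K C \<beta> (pure_tensor K A B a b) = \<beta> a b"
  unfolding pure_tensor_def by (simp only: lift_coset gen_closed ev_gen)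

lemma lift_closed: "X \<in> carrier (tensor_module K A B) \<Longrightarrow> tensor_lift K C \<beta> X \<in> carrier C"
  by (metis coset_cases ev_closed lift_coset)

lemma lift_add:
  assumes "X \<in> carrier (tensor_module K A B)" "Y \<in> carrier (tensor_module K A B)"
  shows "tensor_lift K C \<beta> (X \<oplus>\<^bsub>tensor_module K A B\<^esub> Y) = tensor_lift K C \<beta> X \<oplus>\<^bsub>C\<^esub> tensor_lift K C \<beta> Y"
proof -
  obtain x y where xy: "x \<in> carrier F" "X = N +>\<^bsub>F\<^esub> x" "y \<in> carrier F" "Y = N +>\<^bsub>F\<^esub> y"
    by (metis coset_cases assms)
  then show ?thesis by (simp only: coset_add lift_coset ev_add F.add.m_closed)
qed

lemma lift_smult:
  assumes "c \<in> carrier K" "X \<in> carrier (tensor_module K A B)"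
  shows "tensor_lift K C \<beta> (c \<odot>\<^bsub>tensor_module K A B\<^esub> X) = c \<odot>\<^bsub>C\<^esub> tensor_lift K C \<beta> X"
proof -
  obtain x where x: "x \<in> carrier F" "X = N +>\<^bsub>F\<^esub> x" using assms(2) by (rule coset_cases)
  with assms(1) show ?thesis by (simp only: coset_smult lift_coset ev_smult F.smult_closed)
qed

end

section \<open>Tensor products of algebras\<close>

text \<open>Being a module only depends on the additive structure and the scalar multiplication. The
  records may have different extension fields.\<close>

lemma module_cong:
  assumes M: "module K M"
    and eq: "carrier M' = carrier M" "zero M' = zero M"
      "\<And>x y. x \<oplus>\<^bsub>M'\<^esub> y = x \<oplus>\<^bsub>M\<^esub> y" "\<And>c x. c \<odot>\<^bsub>M'\<^esub> x = c \<odot>\<^bsub>M\<^esub> x"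
  shows "module K M'"
proof -
  interpret M: module K M by fact
  have "abelian_group M'"
    by (rule abelian_groupI) (use M.l_neg in \<open>auto simp: eq M.a_ac\<close>)
  then show ?thesis
    by (intro moduleI)
      (auto simp: eq M.R.is_cring M.smult_l_distr M.smult_r_distr M.smult_assoc1)
qed

lemma tensor_simps:
  "carrier (tensor K A B) = carrier (tensor_module K A B)"
  "zero (tensor K A B) = zero (tensor_module K A B)"
  "add (tensor K A B) = add (tensor_module K A B)"
  "smult (tensor K A B) = smult (tensor_module K A B)"
  "one (tensor K A B) = pure_tensor K A B \<one>\<^bsub>A\<^esub> \<one>\<^bsub>B\<^esub>"
  by (simp_all add: tensor_def tensor_module_def Let_def)

lemma assoc_algebra_module: "assoc_algebra K A \<Longrightarrow> module K A"
  by (simp add: assoc_algebra_def)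

lemma assoc_algebraI:
  assumes "module K A" "field K" "ring A"
    and "\<And>c x y. c \<in> carrier K \<Longrightarrow> x \<in> carrier A \<Longrightarrow> y \<in> carrier A
      \<Longrightarrow> (c \<odot>\<^bsub>A\<^esub> x) \<otimes>\<^bsub>A\<^esub> y = c \<odot>\<^bsub>A\<^esub> (x \<otimes>\<^bsub>A\<^esub> y)"
    and "\<And>c x y. c \<in> carrier K \<Longrightarrow> x \<in> carrier A \<Longrightarrow> y \<in> carrier A
      \<Longrightarrow> x \<otimes>\<^bsub>A\<^esub> (c \<odot>\<^bsub>A\<^esub> y) = c \<odot>\<^bsub>A\<^esub> (x \<otimes>\<^bsub>A\<^esub> y)"
  shows "assoc_algebra K A"
  using assms by (intro assoc_algebra.intro assoc_algebra_axioms.intro)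

context module_pair
begin

abbreviation "T \<equiv> tensor K A B"

lemma tensor_module: "module K T"
  by (rule module_cong[OF tensor_module_module]) (simp_all add: tensor_simps)

lemmas tensor_induct = tensor_module_induct[folded tensor_simps(1)[of K A B] tensor_simps(3)[of K A B]]
lemmas pure_tensor_closed [simp, intro] = pure_closed[folded tensor_simps(1)[of K A B]]

lemma pure_tensor_bilinear: "bilinear K A B T (pure_tensor K A B)"
  using pure_bilinear by (simp add: bilinear_def tensor_simps)

lemmas pure_bil = bilinearD[OF pure_tensor_bilinear]

lemma tensor_additive_eqI:
  assumes X: "X \<in> carrier T"
    and f: "\<And>X Y. X \<in> carrier T \<Longrightarrow> Y \<in> carrier T \<Longrightarrow> f (X \<oplus>\<^bsub>T\<^esub> Y) = f X \<oplus>\<^bsub>C\<^esub> f Y"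
    and g: "\<And>X Y. X \<in> carrier T \<Longrightarrow> Y \<in> carrier T \<Longrightarrow> g (X \<oplus>\<^bsub>T\<^esub> Y) = g X \<oplus>\<^bsub>C\<^esub> g Y"
    and eq: "\<And>a b. a \<in> carrier A \<Longrightarrow> b \<in> carrier B
      \<Longrightarrow> f (pure_tensor K A B a b) = g (pure_tensor K A B a b)"
  shows "f X = g X"
  using X by (rule tensor_induct) (simp_all add: f g eq)

end

context bilinear_map
begin

lemmas tensor_lift_closed = lift_closed[folded tensor_simps(1)[of K A B]]
lemmas tensor_lift_add =
  lift_add[folded tensor_simps(1)[of K A B] tensor_simps(3)[of K A B]]
lemmas tensor_lift_smult =
  lift_smult[folded tensor_simps(1)[of K A B] tensor_simps(4)[of K A B]]

lemma lift_unique: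
  assumes X: "X \<in> carrier T"
    and f: "\<And>X Y. X \<in> carrier T \<Longrightarrow> Y \<in> carrier T \<Longrightarrow> f (X \<oplus>\<^bsub>T\<^esub> Y) = f X \<oplus>\<^bsub>C\<^esub> f Y"
    and eq: "\<And>a b. a \<in> carrier A \<Longrightarrow> b \<in> carrier B \<Longrightarrow> f (pure_tensor K A B a b) = \<beta> a b"
  shows "tensor_lift K C \<beta> X = f X"
  using X by (rule tensor_additive_eqI) (simp_all add: f tensor_lift_add eq lift_pure)

end

lemma tensor_lift_cong:
  assumes "module K A" "module K B" "module K C" "bilinear K A B C \<beta>"
    and eq: "\<And>a b. a \<in> carrier A \<Longrightarrow> b \<in> carrier B \<Longrightarrow> \<beta> a b = \<beta>' a b"
    and X: "X \<in> carrier (tensor K A B)"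
  shows "tensor_lift K C \<beta> X = tensor_lift K C \<beta>' X"
proof -
  interpret A: module K A + B: module K B by fact+
  have "bilinear K A B C \<beta>'"
    using bilinearD[OF assms(4)] by (intro bilinearI) (simp_all add: eq[symmetric])
  with assms interpret b: bilinear_map K A B C \<beta> + b': bilinear_map K A B C \<beta>'
    by (simp_all add: bilinear_map_def bilinear_map_axioms_def module_pair_def)
  show ?thesis using X by (rule b.lift_unique) (simp_all add: b'.tensor_lift_add b'.lift_pure eq)
qed

text \<open>The product of \<open>tensor K A B\<close> is defined by two nested lifts, the inner one in the second
  factor.\<close>

locale algebra_pair = A: assoc_algebra K A + B: assoc_algebra K B for K (structure) and A and B
begin

sublocale module_pair K A B ..

sublocale T: module K T by (rule tensor_module)

lemma field: "field K" ..

abbreviation "inner a b \<equiv> (\<lambda>a' b'. pure_tensor K A B (a \<otimes>\<^bsub>A\<^esub> a') (b \<otimes>\<^bsub>B\<^esub> b'))"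

lemma inner_map:
  assumes ab: "a \<in> carrier A" "b \<in> carrier B"
  shows "bilinear_map K A B T (inner a b)"
proof
  show "bilinear K A B T (inner a b)"
    by (rule bilinearI)
     (use ab in \<open>simp_all add: pure_bil A.r_distr B.r_distr A.smult_mult_right B.smult_mult_right\<close>)
qed

lemma outer_map:
  assumes Y: "Y \<in> carrier T"
  shows "bilinear_map K A B T (\<lambda>a b. tensor_lift K T (inner a b) Y)"
proof
  note lift = bilinear_map.lift_pure[OF inner_map] bilinear_map.tensor_lift_add[OF inner_map]
    bilinear_map.tensor_lift_smult[OF inner_map] bilinear_map.tensor_lift_closed[OF inner_map]
  show "bilinear K A B T (\<lambda>a b. tensor_lift K T (inner a b) Y)"
    by (rule bilinearI; rule tensor_induct[OF Y])
     (simp_all add: pure_bil lift A.l_distr B.l_distr A.smult_mult_left B.smult_mult_left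
       T.a_ac T.smult_r_distr)
qed

lemma tensor_mult_def:
  "X \<otimes>\<^bsub>T\<^esub> Y = tensor_lift K T (\<lambda>a b. tensor_lift K T (inner a b) Y) X"
  by (simp add: tensor_def tensor_lift_def tensor_module_def Let_def finsum_def)

end

context algebra_pair
begin

lemma mult_pure_left:
  assumes "a \<in> carrier A" "b \<in> carrier B" "Y \<in> carrier T"
  shows "pure_tensor K A B a b \<otimes>\<^bsub>T\<^esub> Y = tensor_lift K T (inner a b) Y"
  unfolding tensor_mult_def using assms by (intro bilinear_map.lift_pure[OF outer_map])

lemma mult_closed: "X \<in> carrier T \<Longrightarrow> Y \<in> carrier T \<Longrightarrow> X \<otimes>\<^bsub>T\<^esub> Y \<in> carrier T"
  unfolding tensor_mult_def by (intro bilinear_map.tensor_lift_closed[OF outer_map])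

lemma mult_add_left:
  "X \<in> carrier T \<Longrightarrow> X' \<in> carrier T \<Longrightarrow> Y \<in> carrier T
    \<Longrightarrow> (X \<oplus>\<^bsub>T\<^esub> X') \<otimes>\<^bsub>T\<^esub> Y = X \<otimes>\<^bsub>T\<^esub> Y \<oplus>\<^bsub>T\<^esub> X' \<otimes>\<^bsub>T\<^esub> Y"
  unfolding tensor_mult_def by (intro bilinear_map.tensor_lift_add[OF outer_map])

lemma mult_smult_left:
  "c \<in> carrier K \<Longrightarrow> X \<in> carrier T \<Longrightarrow> Y \<in> carrier T
    \<Longrightarrow> (c \<odot>\<^bsub>T\<^esub> X) \<otimes>\<^bsub>T\<^esub> Y = c \<odot>\<^bsub>T\<^esub> (X \<otimes>\<^bsub>T\<^esub> Y)"
  unfolding tensor_mult_def by (intro bilinear_map.tensor_lift_smult[OF outer_map])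

lemma mult_add_right:
  assumes "X \<in> carrier T" and Y: "Y \<in> carrier T" "Y' \<in> carrier T"
  shows "X \<otimes>\<^bsub>T\<^esub> (Y \<oplus>\<^bsub>T\<^esub> Y') = X \<otimes>\<^bsub>T\<^esub> Y \<oplus>\<^bsub>T\<^esub> X \<otimes>\<^bsub>T\<^esub> Y'"
  using assms(1)
proof (rule tensor_induct)
  fix a b assume "a \<in> carrier A" "b \<in> carrier B"
  then show "pure_tensor K A B a b \<otimes>\<^bsub>T\<^esub> (Y \<oplus>\<^bsub>T\<^esub> Y')
      = pure_tensor K A B a b \<otimes>\<^bsub>T\<^esub> Y \<oplus>\<^bsub>T\<^esub> pure_tensor K A B a b \<otimes>\<^bsub>T\<^esub> Y'"
    using Y by (simp add: mult_pure_left bilinear_map.tensor_lift_add[OF inner_map])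
qed (use Y in \<open>simp add: mult_add_left mult_closed T.a_ac\<close>)

lemma mult_smult_right:
  assumes c: "c \<in> carrier K" and "X \<in> carrier T" and Y: "Y \<in> carrier T"
  shows "X \<otimes>\<^bsub>T\<^esub> (c \<odot>\<^bsub>T\<^esub> Y) = c \<odot>\<^bsub>T\<^esub> (X \<otimes>\<^bsub>T\<^esub> Y)"
  using assms(2)
proof (rule tensor_induct)
  fix a b assume "a \<in> carrier A" "b \<in> carrier B"
  then show "pure_tensor K A B a b \<otimes>\<^bsub>T\<^esub> (c \<odot>\<^bsub>T\<^esub> Y) = c \<odot>\<^bsub>T\<^esub> (pure_tensor K A B a b \<otimes>\<^bsub>T\<^esub> Y)"
    using c Y by (simp add: mult_pure_left bilinear_map.tensor_lift_smult[OF inner_map])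
qed (use c Y in \<open>simp add: mult_add_left mult_closed T.smult_r_distr\<close>)

lemma mult_pure:
  "a \<in> carrier A \<Longrightarrow> b \<in> carrier B \<Longrightarrow> a' \<in> carrier A \<Longrightarrow> b' \<in> carrier B
    \<Longrightarrow> pure_tensor K A B a b \<otimes>\<^bsub>T\<^esub> pure_tensor K A B a' b'
      = pure_tensor K A B (a \<otimes>\<^bsub>A\<^esub> a') (b \<otimes>\<^bsub>B\<^esub> b')"
  by (simp add: mult_pure_left bilinear_map.lift_pure[OF inner_map])

lemma mult_assoc:
  assumes X: "X \<in> carrier T" and Y: "Y \<in> carrier T" and Z: "Z \<in> carrier T"
  shows "X \<otimes>\<^bsub>T\<^esub> Y \<otimes>\<^bsub>T\<^esub> Z = X \<otimes>\<^bsub>T\<^esub> (Y \<otimes>\<^bsub>T\<^esub> Z)"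
  using X
proof (rule tensor_induct)
  fix a b assume ab: "a \<in> carrier A" "b \<in> carrier B"
  from Y show "pure_tensor K A B a b \<otimes>\<^bsub>T\<^esub> Y \<otimes>\<^bsub>T\<^esub> Z = pure_tensor K A B a b \<otimes>\<^bsub>T\<^esub> (Y \<otimes>\<^bsub>T\<^esub> Z)"
  proof (rule tensor_induct)
    fix a' b' assume ab': "a' \<in> carrier A" "b' \<in> carrier B"
    from Z show "pure_tensor K A B a b \<otimes>\<^bsub>T\<^esub> pure_tensor K A B a' b' \<otimes>\<^bsub>T\<^esub> Z
        = pure_tensor K A B a b \<otimes>\<^bsub>T\<^esub> (pure_tensor K A B a' b' \<otimes>\<^bsub>T\<^esub> Z)"
      by (rule tensor_induct)
        (use ab ab' in \<open>simp_all add: mult_pure A.m_assoc B.m_assoc mult_add_right mult_closed\<close>)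
  qed (use ab Z in \<open>simp add: mult_add_left mult_add_right mult_closed\<close>)
qed (use Y Z in \<open>simp add: mult_add_left mult_closed\<close>)

lemma mult_one:
  assumes X: "X \<in> carrier T"
  shows "\<one>\<^bsub>T\<^esub> \<otimes>\<^bsub>T\<^esub> X = X" "X \<otimes>\<^bsub>T\<^esub> \<one>\<^bsub>T\<^esub> = X"
  unfolding tensor_simps(5)
  by (rule tensor_induct[OF X]; simp add: mult_pure mult_add_left mult_add_right)+

lemma tensor_algebra: "assoc_algebra K T"
proof (rule assoc_algebraI)
  have "monoid T"
    by (rule monoidI) (simp_all add: mult_closed mult_assoc mult_one, simp add: tensor_simps(5))
  then show "ring T"
    by (intro ringI) (simp_all add: T.abelian_group_axioms mult_add_left mult_add_right)
qed (simp_all add: tensor_module field mult_smult_left mult_smult_right)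

end

lemma tensor_algebra:
  "assoc_algebra K A \<Longrightarrow> assoc_algebra K B \<Longrightarrow> assoc_algebra K (tensor K A B)"
  using algebra_pair.tensor_algebra algebra_pair.intro by blast

section \<open>Algebra maps out of a tensor product\<close>

text \<open>\<open>commuting K A B T x y\<close>: \<open>x : A \<rightarrow> T\<close> and \<open>y : B \<rightarrow> T\<close> are algebra maps with commuting images.
  Such a pair is the same thing as an algebra map \<open>A \<otimes> B \<rightarrow> T\<close>. The algebra axioms are part of the
  predicate, so that it is the only side condition in what follows.\<close>

definition commuting ::
  "('k, 'm) ring_scheme \<Rightarrow> ('k, 'a, 'n) module_scheme \<Rightarrow> ('k, 'b, 'p) module_scheme
    \<Rightarrow> ('k, 't, 'q) module_scheme \<Rightarrow> ('a \<Rightarrow> 't) \<Rightarrow> ('b \<Rightarrow> 't) \<Rightarrow> bool" where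
  "commuting K A B T x y \<longleftrightarrow>
     assoc_algebra K A \<and> assoc_algebra K B \<and> assoc_algebra K T \<and>
     x \<in> alg_hom K A T \<and> y \<in> alg_hom K B T \<and>
     (\<forall>a\<in>carrier A. \<forall>b\<in>carrier B. x a \<otimes>\<^bsub>T\<^esub> y b = y b \<otimes>\<^bsub>T\<^esub> x a)"

text \<open>The algebra map \<open>A \<otimes> B \<rightarrow> T\<close> determined by a commuting pair, \<open>a \<otimes> b \<mapsto> x a \<cdot> y b\<close>.\<close>

definition copair ::
  "('k, 'm) ring_scheme \<Rightarrow> ('k, 't, 'q) module_scheme \<Rightarrow> ('a \<Rightarrow> 't) \<Rightarrow> ('b \<Rightarrow> 't)
    \<Rightarrow> ('k, 'a, 'b) tens \<Rightarrow> 't" where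
  "copair K T x y = tensor_lift K T (\<lambda>a b. x a \<otimes>\<^bsub>T\<^esub> y b)"

text \<open>The inclusions of \<open>A\<close> and \<open>B\<close> into \<open>A \<otimes> B\<close>; they form the universal commuting pair.\<close>

definition incl1 where "incl1 K A B a = pure_tensor K A B a \<one>\<^bsub>B\<^esub>"
definition incl2 where "incl2 K A B b = pure_tensor K A B \<one>\<^bsub>A\<^esub> b"

lemma alg_homI:
  assumes "\<And>x. x \<in> carrier A \<Longrightarrow> f x \<in> carrier B"
    and "\<And>x y. x \<in> carrier A \<Longrightarrow> y \<in> carrier A \<Longrightarrow> f (x \<otimes>\<^bsub>A\<^esub> y) = f x \<otimes>\<^bsub>B\<^esub> f y"
    and "\<And>x y. x \<in> carrier A \<Longrightarrow> y \<in> carrier A \<Longrightarrow> f (x \<oplus>\<^bsub>A\<^esub> y) = f x \<oplus>\<^bsub>B\<^esub> f y"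
    and "f \<one>\<^bsub>A\<^esub> = \<one>\<^bsub>B\<^esub>"
    and "\<And>c x. c \<in> carrier K \<Longrightarrow> x \<in> carrier A \<Longrightarrow> f (c \<odot>\<^bsub>A\<^esub> x) = c \<odot>\<^bsub>B\<^esub> f x"
  shows "f \<in> alg_hom K A B"
  using assms unfolding alg_hom_def ring_hom_def by auto

lemma alg_homD:
  assumes "f \<in> alg_hom K A B"
  shows "\<And>x. x \<in> carrier A \<Longrightarrow> f x \<in> carrier B"
    and "\<And>x y. x \<in> carrier A \<Longrightarrow> y \<in> carrier A \<Longrightarrow> f (x \<otimes>\<^bsub>A\<^esub> y) = f x \<otimes>\<^bsub>B\<^esub> f y"
    and "\<And>x y. x \<in> carrier A \<Longrightarrow> y \<in> carrier A \<Longrightarrow> f (x \<oplus>\<^bsub>A\<^esub> y) = f x \<oplus>\<^bsub>B\<^esub> f y"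
    and "f \<one>\<^bsub>A\<^esub> = \<one>\<^bsub>B\<^esub>"
    and "\<And>c x. c \<in> carrier K \<Longrightarrow> x \<in> carrier A \<Longrightarrow> f (c \<odot>\<^bsub>A\<^esub> x) = c \<odot>\<^bsub>B\<^esub> f x"
  using assms unfolding alg_hom_def ring_hom_def by auto

lemma alg_hom_comp:
  assumes "f \<in> alg_hom K A B" "g \<in> alg_hom K B C"
  shows "g \<circ> f \<in> alg_hom K A C"
  by (rule alg_homI) (simp_all add: alg_homD[OF assms(1)] alg_homD[OF assms(2)])

lemma alg_hom_id: "(\<lambda>x. x) \<in> alg_hom K A A"
  by (rule alg_homI) simp_all

lemma commutingD:
  assumes "commuting K A B T x y"
  shows "assoc_algebra K A" "assoc_algebra K B" "assoc_algebra K T"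
    "x \<in> alg_hom K A T" "y \<in> alg_hom K B T"
    "\<And>a b. a \<in> carrier A \<Longrightarrow> b \<in> carrier B \<Longrightarrow> x a \<otimes>\<^bsub>T\<^esub> y b = y b \<otimes>\<^bsub>T\<^esub> x a"
  using assms unfolding commuting_def by auto

lemma commuting_sym: "commuting K A B T x y \<Longrightarrow> commuting K B A T y x"
  unfolding commuting_def by auto

locale commuting_pair =
  fixes K :: "('k, 'm) ring_scheme" and A :: "('k, 'a, 'n) module_scheme"
    and B :: "('k, 'b, 'p) module_scheme" and T :: "('k, 't, 'q) module_scheme" and x y
  assumes xy: "commuting K A B T x y"
begin

sublocale A: assoc_algebra K A using xy by (rule commutingD)
sublocale B: assoc_algebra K B using xy by (rule commutingD)
sublocale T: assoc_algebra K T using xy by (rule commutingD)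
sublocale AB: algebra_pair K A B ..

lemmas x = alg_homD[OF commutingD(4)[OF xy]]
lemmas y = alg_homD[OF commutingD(5)[OF xy]]
lemmas comm = commutingD(6)[OF xy]

sublocale bilinear_map K A B T "\<lambda>a b. x a \<otimes>\<^bsub>T\<^esub> y b"
proof
  show "bilinear K A B T (\<lambda>a b. x a \<otimes>\<^bsub>T\<^esub> y b)"
    by (rule bilinearI)
      (simp_all add: x y T.l_distr T.r_distr T.smult_mult_left T.smult_mult_right)
qed

lemma copair_pure: "a \<in> carrier A \<Longrightarrow> b \<in> carrier B \<Longrightarrow> copair K T x y (pure_tensor K A B a b) = x a
    \<otimes>\<^bsub>T\<^esub> y b"
  unfolding copair_def by (rule lift_pure)

lemma copair_mult:
  assumes X: "X \<in> carrier (tensor K A B)" and Y: "Y \<in> carrier (tensor K A B)"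
  shows "copair K T x y (X \<otimes>\<^bsub>tensor K A B\<^esub> Y) = copair K T x y X \<otimes>\<^bsub>T\<^esub> copair K T x y Y"
  using X
proof (rule AB.tensor_induct)
  fix a b assume ab: "a \<in> carrier A" "b \<in> carrier B"
  from Y show "copair K T x y (pure_tensor K A B a b \<otimes>\<^bsub>tensor K A B\<^esub> Y)
      = copair K T x y (pure_tensor K A B a b) \<otimes>\<^bsub>T\<^esub> copair K T x y Y"
  proof (rule AB.tensor_induct)
    fix a' b' assume ab': "a' \<in> carrier A" "b' \<in> carrier B"
    have "(x a \<otimes>\<^bsub>T\<^esub> x a') \<otimes>\<^bsub>T\<^esub> (y b \<otimes>\<^bsub>T\<^esub> y b') = x a \<otimes>\<^bsub>T\<^esub> (x a' \<otimes>\<^bsub>T\<^esub> y b) \<otimes>\<^bsub>T\<^esub> y b'"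
      using ab ab' x y by (simp add: T.m_assoc)
    also have "\<dots> = (x a \<otimes>\<^bsub>T\<^esub> y b) \<otimes>\<^bsub>T\<^esub> (x a' \<otimes>\<^bsub>T\<^esub> y b')"
      unfolding comm[OF ab'(1) ab(2)] using ab ab' x y by (simp add: T.m_assoc)
    finally show "copair K T x y (pure_tensor K A B a b \<otimes>\<^bsub>tensor K A B\<^esub> pure_tensor K A B a' b')
      = copair K T x y (pure_tensor K A B a b) \<otimes>\<^bsub>T\<^esub> copair K T x y (pure_tensor K A B a' b')"
      using ab ab' x y by (simp add: AB.mult_pure copair_pure)
  qed (use ab in \<open>simp add: AB.mult_add_right AB.mult_closed copair_def tensor_lift_add
      tensor_lift_closed T.r_distr\<close>)
qed (use Y in \<open>simp add: AB.mult_add_left AB.mult_closed copair_def tensor_lift_add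
    tensor_lift_closed T.l_distr\<close>)

lemma copair_hom: "copair K T x y \<in> alg_hom K (tensor K A B) T"
proof (rule alg_homI)
  show "copair K T x y \<one>\<^bsub>tensor K A B\<^esub> = \<one>\<^bsub>T\<^esub>"
    by (simp add: tensor_simps(5) copair_pure x(4) y(4))
qed (simp_all add: copair_mult, simp_all add: copair_def tensor_lift_add tensor_lift_closed
    tensor_lift_smult)

end

lemma commutingI:
  assumes "assoc_algebra K A" "assoc_algebra K B" "assoc_algebra K T"
    "x \<in> alg_hom K A T" "y \<in> alg_hom K B T"
    "\<And>a b. a \<in> carrier A \<Longrightarrow> b \<in> carrier B \<Longrightarrow> x a \<otimes>\<^bsub>T\<^esub> y b = y b \<otimes>\<^bsub>T\<^esub> x a"
  shows "commuting K A B T x y"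
  using assms unfolding commuting_def by auto

lemma copair_pure:
  "commuting K A B T x y \<Longrightarrow> a \<in> carrier A \<Longrightarrow> b \<in> carrier B
    \<Longrightarrow> copair K T x y (pure_tensor K A B a b) = x a \<otimes>\<^bsub>T\<^esub> y b"
  by (rule commuting_pair.copair_pure[OF commuting_pair.intro])

lemma copair_hom: "commuting K A B T x y \<Longrightarrow> copair K T x y \<in> alg_hom K (tensor K A B) T"
  by (rule commuting_pair.copair_hom[OF commuting_pair.intro])

lemma copair_closed:
  "commuting K A B T x y \<Longrightarrow> X \<in> carrier (tensor K A B) \<Longrightarrow> copair K T x y X \<in> carrier T"
  by (rule alg_homD(1)[OF copair_hom])

lemma tensor_lift_eq_copair:
  assumes xy: "commuting K A B T x y" and X: "X \<in> carrier (tensor K A B)"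
    and \<beta>: "\<And>a b. a \<in> carrier A \<Longrightarrow> b \<in> carrier B \<Longrightarrow> \<beta> a b = x a \<otimes>\<^bsub>T\<^esub> y b"
  shows "tensor_lift K T \<beta> X = copair K T x y X"
proof -
  interpret xy: commuting_pair K A B T x y using xy by (rule commuting_pair.intro)
  note mods = commutingD(1-3)[OF xy, THEN assoc_algebra_module]
  show ?thesis unfolding copair_def
    by (rule tensor_lift_cong[OF mods xy.bilin _ X, symmetric]) (simp add: \<beta>)
qed

lemma copair_cong:
  assumes xy: "commuting K A B T x y" and X: "X \<in> carrier (tensor K A B)"
    and "\<And>a. a \<in> carrier A \<Longrightarrow> x a = x' a" "\<And>b. b \<in> carrier B \<Longrightarrow> y b = y' b"
  shows "copair K T x y X = copair K T x' y' X"
  unfolding copair_def[of K T x' y'] using assms(3,4)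
  by (intro tensor_lift_eq_copair[OF xy X, symmetric]) simp

lemma alg_hom_cong:
  assumes "f \<in> alg_hom K A B" "assoc_algebra K A" "\<And>a. a \<in> carrier A \<Longrightarrow> f a = g a"
  shows "g \<in> alg_hom K A B"
proof -
  interpret A: assoc_algebra K A by fact
  show ?thesis
    by (rule alg_homI) (simp_all add: alg_homD[OF assms(1)] assms(3)[symmetric])
qed

lemma commuting_comp:
  assumes "commuting K A B T x y" "f \<in> alg_hom K A' A" "assoc_algebra K A'"
  shows "commuting K A' B T (x \<circ> f) y"
  using commutingD[OF assms(1)] assms(2,3)
  by (intro commutingI alg_hom_comp[OF assms(2)]) (auto simp: alg_homD)

lemma commuting_comp2:
  assumes "commuting K A B T x y" "f \<in> alg_hom K A' A" "assoc_algebra K A'"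
    "g \<in> alg_hom K B' B" "assoc_algebra K B'"
  shows "commuting K A' B' T (x \<circ> f) (y \<circ> g)"
  by (rule commuting_sym[OF commuting_comp[OF commuting_sym[OF commuting_comp[OF assms(1-3)]]
      assms(4,5)]])

lemma commuting_hom:
  assumes "commuting K A B T x y" "h \<in> alg_hom K T T'" "assoc_algebra K T'"
  shows "commuting K A B T' (h \<circ> x) (h \<circ> y)"
proof (rule commutingI)
  note xy = commutingD[OF assms(1)]
  show "h \<circ> x \<in> alg_hom K A T'" "h \<circ> y \<in> alg_hom K B T'"
    by (rule alg_hom_comp[OF _ assms(2)], rule xy)+
  fix a b assume ab: "a \<in> carrier A" "b \<in> carrier B"
  then have "h (x a \<otimes>\<^bsub>T\<^esub> y b) = h (y b \<otimes>\<^bsub>T\<^esub> x a)" by (simp add: xy(6))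
  with ab show "(h \<circ> x) a \<otimes>\<^bsub>T'\<^esub> (h \<circ> y) b = (h \<circ> y) b \<otimes>\<^bsub>T'\<^esub> (h \<circ> x) a"
    by (simp add: alg_homD(2)[OF assms(2)] alg_homD(1)[OF xy(4)] alg_homD(1)[OF xy(5)])
qed (rule commutingD[OF assms(1)] assms(3))+

lemma alg_hom_tensor_eqI:
  assumes alg: "assoc_algebra K A" "assoc_algebra K B"
    and f: "f \<in> alg_hom K (tensor K A B) T" and g: "g \<in> alg_hom K (tensor K A B) T"
    and eq: "\<And>a. a \<in> carrier A \<Longrightarrow> f (incl1 K A B a) = g (incl1 K A B a)"
      "\<And>b. b \<in> carrier B \<Longrightarrow> f (incl2 K A B b) = g (incl2 K A B b)"
    and X: "X \<in> carrier (tensor K A B)"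
  shows "f X = g X"
proof -
  interpret algebra_pair K A B using alg by (rule algebra_pair.intro)
  show ?thesis
    using X
  proof (rule tensor_additive_eqI)
    fix a b assume "a \<in> carrier A" "b \<in> carrier B"
    moreover from this have "pure_tensor K A B a b = incl1 K A B a \<otimes>\<^bsub>tensor K A B\<^esub> incl2 K A B b"
      by (simp add: mult_pure incl1_def incl2_def)
    ultimately show "f (pure_tensor K A B a b) = g (pure_tensor K A B a b)"
      using eq by (simp add: alg_homD(2)[OF f] alg_homD(2)[OF g] incl1_def incl2_def)
  qed (simp_all add: alg_homD(3)[OF f] alg_homD(3)[OF g])
qed

lemma hom_copair:
  assumes "commuting K A B T x y" "h \<in> alg_hom K T T'" "assoc_algebra K T'"
    and X: "X \<in> carrier (tensor K A B)"
  shows "h (copair K T x y X) = copair K T' (h \<circ> x) (h \<circ> y) X"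
proof -
  interpret xy: commuting_pair K A B T x y using assms(1) by (rule commuting_pair.intro)
  interpret T': assoc_algebra K T' by fact
  have hxy: "commuting K A B T' (h \<circ> x) (h \<circ> y)" using assms(1-3) by (rule commuting_hom)
  have "(h \<circ> copair K T x y) X = copair K T' (h \<circ> x) (h \<circ> y) X"
    by (rule alg_hom_tensor_eqI[OF xy.A.assoc_algebra_axioms xy.B.assoc_algebra_axioms
          alg_hom_comp[OF xy.copair_hom assms(2)] copair_hom[OF hxy] _ _ X])
      (simp_all add: incl1_def incl2_def copair_pure[OF hxy] xy.copair_pure xy.x xy.y
          alg_homD[OF assms(2)])
  then show ?thesis by simp
qed

lemma copair_incl:
  assumes "commuting K A B T x y"
  shows "a \<in> carrier A \<Longrightarrow> copair K T x y (incl1 K A B a) = x a"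
    and "b \<in> carrier B \<Longrightarrow> copair K T x y (incl2 K A B b) = y b"
proof -
  interpret xy: commuting_pair K A B T x y using assms by (rule commuting_pair.intro)
  show "a \<in> carrier A \<Longrightarrow> copair K T x y (incl1 K A B a) = x a"
    and "b \<in> carrier B \<Longrightarrow> copair K T x y (incl2 K A B b) = y b"
    by (simp_all add: incl1_def incl2_def xy.copair_pure xy.x xy.y)
qed

lemma incl_hom:
  assumes "assoc_algebra K A" "assoc_algebra K B"
  shows "incl1 K A B \<in> alg_hom K A (tensor K A B)" "incl2 K A B \<in> alg_hom K B (tensor K A B)"
proof -
  interpret algebra_pair K A B using assms by (rule algebra_pair.intro)
  show "incl1 K A B \<in> alg_hom K A (tensor K A B)" "incl2 K A B \<in> alg_hom K B (tensor K A B)"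
    by (rule alg_homI; simp add: incl1_def incl2_def mult_pure pure_bil; simp add: tensor_simps)+
qed

lemma commuting_incl:
  assumes "assoc_algebra K A" "assoc_algebra K B"
  shows "commuting K A B (tensor K A B) (incl1 K A B) (incl2 K A B)"
proof -
  interpret algebra_pair K A B using assms by (rule algebra_pair.intro)
  show ?thesis
    by (rule commutingI[OF assms tensor_algebra incl_hom[OF assms]])
      (simp add: incl1_def incl2_def mult_pure)
qed

lemma copair_incl_id:
  assumes "assoc_algebra K A" "assoc_algebra K B" "X \<in> carrier (tensor K A B)"
  shows "copair K (tensor K A B) (incl1 K A B) (incl2 K A B) X = X"
  using alg_hom_tensor_eqI[OF assms(1,2) copair_hom[OF commuting_incl[OF assms(1,2)]] alg_hom_id _ _
      assms(3)]
    copair_incl[OF commuting_incl[OF assms(1,2)]] by blast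

lemma copair_comp_incl:
  assumes alg: "assoc_algebra K A" "assoc_algebra K B" "assoc_algebra K T"
    and p: "p \<in> alg_hom K (tensor K A B) T" and X: "X \<in> carrier (tensor K A B)"
  shows "copair K T (p \<circ> incl1 K A B) (p \<circ> incl2 K A B) X = p X"
  using hom_copair[OF commuting_incl[OF alg(1,2)] p alg(3) X] copair_incl_id[OF alg(1,2) X] by simp

text \<open>An element commuting with the images of \<open>x\<close> and \<open>y\<close> commutes with the image of \<open>copair K T x
  y\<close>.\<close>

lemma copair_commute_elem:
  assumes xy: "commuting K A B T x y" and X: "X \<in> carrier (tensor K A B)" and t: "t \<in> carrier T"
    and xt: "\<And>a. a \<in> carrier A \<Longrightarrow> x a \<otimes>\<^bsub>T\<^esub> t = t \<otimes>\<^bsub>T\<^esub> x a"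
    and yt: "\<And>b. b \<in> carrier B \<Longrightarrow> y b \<otimes>\<^bsub>T\<^esub> t = t \<otimes>\<^bsub>T\<^esub> y b"
  shows "copair K T x y X \<otimes>\<^bsub>T\<^esub> t = t \<otimes>\<^bsub>T\<^esub> copair K T x y X"
proof -
  interpret xy: commuting_pair K A B T x y using xy by (rule commuting_pair.intro)
  note jh = alg_homD[OF xy.copair_hom]
  show ?thesis
    using X
  proof (rule xy.AB.tensor_induct)
    fix a b assume ab: "a \<in> carrier A" "b \<in> carrier B"
    have "x a \<otimes>\<^bsub>T\<^esub> y b \<otimes>\<^bsub>T\<^esub> t = x a \<otimes>\<^bsub>T\<^esub> t \<otimes>\<^bsub>T\<^esub> y b"
      using ab t yt by (simp add: xy.T.m_assoc xy.x xy.y)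
    also have "\<dots> = t \<otimes>\<^bsub>T\<^esub> (x a \<otimes>\<^bsub>T\<^esub> y b)"
      using ab t xt by (simp add: xy.T.m_assoc xy.x xy.y)
    finally show "copair K T x y (pure_tensor K A B a b) \<otimes>\<^bsub>T\<^esub> t = t \<otimes>\<^bsub>T\<^esub> copair K T x y
        (pure_tensor K A B a b)"
      using ab by (simp add: xy.copair_pure)
  qed (simp add: jh t xy.T.l_distr xy.T.r_distr)
qed

lemma commuting_copair:
  assumes xy: "commuting K A B T x y" and xz: "commuting K A C T x z" and yz: "commuting K B C T y z"
  shows "commuting K (tensor K A B) C T (copair K T x y) z"
  using commutingD[OF xy] commutingD[OF xz] commutingD[OF yz]
  by (intro commutingI tensor_algebra copair_hom[OF xy] copair_commute_elem[OF xy])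
    (auto dest: alg_homD)

lemma tensor_map_eq_copair:
  assumes alg: "assoc_algebra K A" "assoc_algebra K B" "assoc_algebra K C" "assoc_algebra K D"
    and f: "f \<in> alg_hom K A C" and g: "g \<in> alg_hom K B D" and X: "X \<in> carrier (tensor K A B)"
  shows "tensor_map K C D f g X = copair K (tensor K C D) (incl1 K C D \<circ> f) (incl2 K C D \<circ> g) X"
proof -
  interpret CD: algebra_pair K C D using alg(3,4) by (rule algebra_pair.intro)
  have c: "commuting K A B (tensor K C D) (incl1 K C D \<circ> f) (incl2 K C D \<circ> g)"
    by (intro commuting_comp2[OF commuting_incl] alg f g)
  show ?thesis unfolding tensor_map_def
    by (rule tensor_lift_eq_copair[OF c X]) (simp add: incl1_def incl2_def CD.mult_pure
        alg_homD[OF f] alg_homD[OF g])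
qed

lemma copair_tensor_map:
  assumes xy: "commuting K C D T x y" and alg: "assoc_algebra K A" "assoc_algebra K B"
    and f: "f \<in> alg_hom K A C" and g: "g \<in> alg_hom K B D" and X: "X \<in> carrier (tensor K A B)"
  shows "copair K T x y (tensor_map K C D f g X) = copair K T (x \<circ> f) (y \<circ> g) X"
proof -
  note CD = commutingD(1-3)[OF xy]
  note incl = commuting_comp2[OF commuting_incl[OF CD(1,2)] f alg(1) g alg(2)]
  have c: "commuting K A B T (copair K T x y \<circ> (incl1 K C D \<circ> f)) (copair K T x y \<circ> (incl2 K C D \<circ> g))"
    by (rule commuting_hom[OF incl copair_hom[OF xy] CD(3)])
  have "copair K T x y (tensor_map K C D f g X)
      = copair K T (copair K T x y \<circ> (incl1 K C D \<circ> f)) (copair K T x y \<circ> (incl2 K C D \<circ> g)) X"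
    unfolding tensor_map_eq_copair[OF alg CD(1,2) f g X]
    by (rule hom_copair[OF incl copair_hom[OF xy] CD(3) X])
  also have "\<dots> = copair K T (x \<circ> f) (y \<circ> g) X"
    by (rule copair_cong[OF c X]) (simp_all add: copair_incl[OF xy] alg_homD[OF f] alg_homD[OF g])
  finally show ?thesis .
qed

lemma tensor_map_hom:
  assumes alg: "assoc_algebra K A" "assoc_algebra K B" "assoc_algebra K C" "assoc_algebra K D"
    and f: "f \<in> alg_hom K A C" and g: "g \<in> alg_hom K B D"
  shows "tensor_map K C D f g \<in> alg_hom K (tensor K A B) (tensor K C D)"
  by (rule alg_hom_cong[OF copair_hom[OF commuting_comp2[OF commuting_incl[OF alg(3,4)] f alg(1) g
      alg(2)]]])
    (simp_all add: tensor_map_eq_copair[OF alg f g] tensor_algebra alg)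

lemma tensor_flip_eq_copair:
  assumes alg: "assoc_algebra K A" "assoc_algebra K B" and X: "X \<in> carrier (tensor K A B)"
  shows "tensor_flip K A B X = copair K (tensor K B A) (incl2 K B A) (incl1 K B A) X"
proof -
  interpret BA: algebra_pair K B A using alg(2,1) by (rule algebra_pair.intro)
  show ?thesis unfolding tensor_flip_def
    by (rule tensor_lift_eq_copair[OF commuting_sym[OF commuting_incl[OF alg(2,1)]] X])
        (simp add: incl1_def incl2_def BA.mult_pure)
qed

lemma tensor_flip_hom:
  assumes alg: "assoc_algebra K A" "assoc_algebra K B"
  shows "tensor_flip K A B \<in> alg_hom K (tensor K A B) (tensor K B A)"
  by (rule alg_hom_cong[OF copair_hom[OF commuting_sym[OF commuting_incl[OF alg(2,1)]]]])
    (simp_all add: tensor_flip_eq_copair[OF alg] tensor_algebra alg)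

lemma copair_flip:
  assumes xy: "commuting K B A T x y" and X: "X \<in> carrier (tensor K A B)"
  shows "copair K T x y (tensor_flip K A B X) = copair K T y x X"
proof -
  note BA = commutingD(1-3)[OF xy]
  note incl = commuting_sym[OF commuting_incl[OF BA(1,2)]]
  have "copair K T x y (tensor_flip K A B X)
      = copair K T (copair K T x y \<circ> incl2 K B A) (copair K T x y \<circ> incl1 K B A) X"
    unfolding tensor_flip_eq_copair[OF BA(2,1) X]
        by (rule hom_copair[OF incl copair_hom[OF xy] BA(3) X])
  also have "\<dots> = copair K T y x X"
    by (rule copair_cong[OF commuting_hom[OF incl copair_hom[OF xy] BA(3)] X])
        (simp_all add: copair_incl[OF xy])
  finally show ?thesis .
qed

lemma tensor_flip_closed:
  assumes "assoc_algebra K A" "assoc_algebra K B" "X \<in> carrier (tensor K A B)"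
  shows "tensor_flip K A B X \<in> carrier (tensor K B A)"
  using alg_homD(1)[OF tensor_flip_hom] assms by blast

lemma (in commuting_pair) lift_mult_right:
  assumes t: "t \<in> carrier T" and X: "X \<in> carrier (tensor K A B)"
    and \<beta>: "\<And>a b. a \<in> carrier A \<Longrightarrow> b \<in> carrier B \<Longrightarrow> \<beta> a b = (x a \<otimes>\<^bsub>T\<^esub> y b) \<otimes>\<^bsub>T\<^esub> t"
  shows "tensor_lift K T \<beta> X = copair K T x y X \<otimes>\<^bsub>T\<^esub> t"
proof -
  interpret b: bilinear_map K A B T \<beta>
  proof
    show "bilinear K A B T \<beta>"
      by (rule bilinearI) (use t in \<open>simp_all add: \<beta> T.l_distr T.r_distr T.smult_mult_left
          T.smult_mult_right x y\<close>)
  qed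
  show ?thesis
    by (rule b.lift_unique[OF X])
      (use t in \<open>simp_all add: \<beta> copair_pure T.l_distr alg_homD[OF copair_hom]\<close>)
qed

lemma (in commuting_pair) lift_mult_left:
  assumes t: "t \<in> carrier T" and X: "X \<in> carrier (tensor K A B)"
    and \<beta>: "\<And>a b. a \<in> carrier A \<Longrightarrow> b \<in> carrier B \<Longrightarrow> \<beta> a b = t \<otimes>\<^bsub>T\<^esub> (x a \<otimes>\<^bsub>T\<^esub> y b)"
  shows "tensor_lift K T \<beta> X = t \<otimes>\<^bsub>T\<^esub> copair K T x y X"
proof -
  interpret b: bilinear_map K A B T \<beta>
  proof
    show "bilinear K A B T \<beta>"
      by (rule bilinearI) (use t in \<open>simp_all add: \<beta> T.l_distr T.r_distr T.smult_mult_left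
          T.smult_mult_right x y\<close>)
  qed
  show ?thesis
    by (rule b.lift_unique[OF X])
      (use t in \<open>simp_all add: \<beta> copair_pure T.r_distr alg_homD[OF copair_hom]\<close>)
qed

section \<open>Associativity, middle flip and leg notation\<close>

text \<open>The three inclusions into \<open>A \<otimes> (B \<otimes> C)\<close>.\<close>

definition "triple1 K A B C = incl1 K A (tensor K B C)"
definition "triple2 K A B C = incl2 K A (tensor K B C) \<circ> incl1 K B C"
definition "triple3 K A B C = incl2 K A (tensor K B C) \<circ> incl2 K B C"

lemma triple_commuting:
  assumes "assoc_algebra K A" "assoc_algebra K B" "assoc_algebra K C"
  defines "T \<equiv> tensor K A (tensor K B C)"
  shows "commuting K A B T (triple1 K A B C) (triple2 K A B C)"
    "commuting K A C T (triple1 K A B C) (triple3 K A B C)"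
    "commuting K B C T (triple2 K A B C) (triple3 K A B C)"
proof -
  note BC = tensor_algebra[OF assms(2,3)]
  note i = commuting_incl[OF assms(1) BC]
  show "commuting K A B T (triple1 K A B C) (triple2 K A B C)"
    "commuting K A C T (triple1 K A B C) (triple3 K A B C)"
    unfolding T_def triple1_def triple2_def triple3_def
    by (intro commuting_sym[OF commuting_comp[OF commuting_sym[OF i]]] incl_hom assms)+
  show "commuting K B C T (triple2 K A B C) (triple3 K A B C)"
    unfolding T_def triple2_def triple3_def
    by (intro commuting_hom[OF commuting_incl] incl_hom BC tensor_algebra assms)
qed

lemma copair_triple:
  assumes xy: "commuting K A B T x y" and xz: "commuting K A C T x z" and yz: "commuting K B C T y z"
  shows "a \<in> carrier A \<Longrightarrow> copair K T x (copair K T y z) (triple1 K A B C a) = x a"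
    "b \<in> carrier B \<Longrightarrow> copair K T x (copair K T y z) (triple2 K A B C b) = y b"
    "c \<in> carrier C \<Longrightarrow> copair K T x (copair K T y z) (triple3 K A B C c) = z c"
proof -
  have c: "commuting K A (tensor K B C) T x (copair K T y z)"
    by (intro commuting_sym[OF commuting_copair] commuting_sym[OF xy] commuting_sym[OF xz] yz)
  note alg = commutingD(1,2)[OF yz]
  show "a \<in> carrier A \<Longrightarrow> copair K T x (copair K T y z) (triple1 K A B C a) = x a"
    "b \<in> carrier B \<Longrightarrow> copair K T x (copair K T y z) (triple2 K A B C b) = y b"
    "c \<in> carrier C \<Longrightarrow> copair K T x (copair K T y z) (triple3 K A B C c) = z c"
    by (simp_all add: triple1_def triple2_def triple3_def copair_incl[OF c] copair_incl[OF yz]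
        alg_homD(1)[OF incl_hom(1)[OF alg]] alg_homD(1)[OF incl_hom(2)[OF alg]])
qed

lemma tensor_assoc_eq_copair:
  assumes alg: "assoc_algebra K A" "assoc_algebra K B" "assoc_algebra K C"
    and X: "X \<in> carrier (tensor K (tensor K A B) C)"
  defines "T \<equiv> tensor K A (tensor K B C)"
  shows "tensor_assoc K A B C X
    = copair K T (copair K T (triple1 K A B C) (triple2 K A B C)) (triple3 K A B C) X"
proof -
  note tr = triple_commuting[OF alg, folded T_def]
  interpret T: algebra_pair K A "tensor K B C" using alg by (intro algebra_pair.intro tensor_algebra)
  interpret BC: algebra_pair K B C using alg by (intro algebra_pair.intro)
  interpret c12: commuting_pair K A B T "triple1 K A B C" "triple2 K A B C"
    using tr(1) by (rule commuting_pair.intro)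
  have c3: "commuting K (tensor K A B) C T (copair K T (triple1 K A B C) (triple2 K A B C))
      (triple3 K A B C)"
    by (intro commuting_copair tr)
  have *: "tensor_lift K T (\<lambda>a b. pure_tensor K A (tensor K B C) a (pure_tensor K B C b c)) X
      = copair K T (triple1 K A B C) (triple2 K A B C) X \<otimes>\<^bsub>T\<^esub> triple3 K A B C c"
    if "X \<in> carrier (tensor K A B)" "c \<in> carrier C" for X c
    using that
    by (intro c12.lift_mult_right alg_homD(1)[OF commutingD(5)[OF c3]])
      (simp_all add: T_def triple1_def triple2_def triple3_def incl1_def incl2_def T.mult_pure
          BC.mult_pure
        tensor_simps(5)[symmetric] BC.mult_closed)
  show ?thesis unfolding tensor_assoc_def T_def[symmetric]
    by (rule tensor_lift_eq_copair[OF c3 X]) (simp add: *)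
qed

lemma tensor_assoc_hom:
  assumes alg: "assoc_algebra K A" "assoc_algebra K B" "assoc_algebra K C"
  shows "tensor_assoc K A B C \<in> alg_hom K (tensor K (tensor K A B) C) (tensor K A (tensor K B C))"
  by (rule alg_hom_cong[OF copair_hom[OF commuting_copair[OF triple_commuting[OF alg]]]])
    (simp_all add: tensor_assoc_eq_copair[OF alg] tensor_algebra alg)

text \<open>In terms of commuting maps, the associativity isomorphism, the middle flip and the leg
  embeddings only rearrange the entries.\<close>

lemma copair_assoc:
  assumes xy: "commuting K A B T x y" and xz: "commuting K A C T x z" and yz: "commuting K B C T y z"
    and X: "X \<in> carrier (tensor K (tensor K A B) C)"
  shows "copair K T x (copair K T y z) (tensor_assoc K A B C X) = copair K T (copair K T x y) z X"
proof -
  note alg = commutingD(1,2)[OF xy] commutingD(2,3)[OF xz]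
  let ?T3 = "tensor K A (tensor K B C)" and ?h = "copair K T x (copair K T y z)"
  let ?u = "triple1 K A B C" and ?v = "triple2 K A B C" and ?w = "triple3 K A B C"
  note tr = triple_commuting[OF alg(1-3)]
  note tr' = commuting_copair[OF tr]
  note h = copair_hom[OF commuting_sym[OF commuting_copair[OF yz commuting_sym[OF xy]
      commuting_sym[OF xz]]]]
  have "?h (tensor_assoc K A B C X) = copair K T (?h \<circ> copair K ?T3 ?u ?v) (?h \<circ> ?w) X"
    unfolding tensor_assoc_eq_copair[OF alg(1-3) X] by (rule hom_copair[OF tr' h alg(4) X])
  also have "\<dots> = copair K T (copair K T x y) z X"
  proof (rule copair_cong[OF commuting_hom[OF tr' h alg(4)] X])
    fix Y assume Y: "Y \<in> carrier (tensor K A B)"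
    have "(?h \<circ> copair K ?T3 ?u ?v) Y = copair K T (?h \<circ> ?u) (?h \<circ> ?v) Y"
      using hom_copair[OF tr(1) h alg(4) Y] by simp
    also have "\<dots> = copair K T x y Y"
      by (rule copair_cong[OF commuting_hom[OF tr(1) h alg(4)] Y])
          (simp_all add: copair_triple[OF xy xz yz])
    finally show "(?h \<circ> copair K ?T3 ?u ?v) Y = copair K T x y Y" .
  qed (simp add: copair_triple[OF xy xz yz])
  finally show ?thesis .
qed

text \<open>The four inclusions into \<open>(A \<otimes> C) \<otimes> (B \<otimes> D)\<close>; the indices give the position of the pair and
  the position in the pair.\<close>

definition "quad11 K A B C D = incl1 K (tensor K A C) (tensor K B D) \<circ> incl1 K A C"
definition "quad12 K A B C D = incl1 K (tensor K A C) (tensor K B D) \<circ> incl2 K A C"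
definition "quad21 K A B C D = incl2 K (tensor K A C) (tensor K B D) \<circ> incl1 K B D"
definition "quad22 K A B C D = incl2 K (tensor K A C) (tensor K B D) \<circ> incl2 K B D"

lemma commuting_copair4:
  assumes "commuting K A B T a b" "commuting K A C T a c" "commuting K A D T a d"
    "commuting K B C T b c" "commuting K B D T b d" "commuting K C D T c d"
  shows "commuting K (tensor K A B) (tensor K C D) T (copair K T a b) (copair K T c d)"
  by (intro commuting_copair commuting_sym[OF commuting_copair] assms assms[THEN commuting_sym])

lemma quad_commuting:
  assumes "assoc_algebra K A" "assoc_algebra K B" "assoc_algebra K C" "assoc_algebra K D"
  defines "T \<equiv> tensor K (tensor K A C) (tensor K B D)"
  shows "commuting K A B T (quad11 K A B C D) (quad21 K A B C D)"
    "commuting K A C T (quad11 K A B C D) (quad12 K A B C D)"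
    "commuting K A D T (quad11 K A B C D) (quad22 K A B C D)"
    "commuting K B C T (quad21 K A B C D) (quad12 K A B C D)"
    "commuting K B D T (quad21 K A B C D) (quad22 K A B C D)"
    "commuting K C D T (quad12 K A B C D) (quad22 K A B C D)"
proof -
  note AC = tensor_algebra[OF assms(1,3)] and BD = tensor_algebra[OF assms(2,4)]
  note T = tensor_algebra[OF AC BD]
  note i = commuting_incl[OF AC BD]
  show "commuting K A B T (quad11 K A B C D) (quad21 K A B C D)"
    "commuting K A D T (quad11 K A B C D) (quad22 K A B C D)"
    "commuting K C D T (quad12 K A B C D) (quad22 K A B C D)"
    unfolding T_def quad11_def quad12_def quad21_def quad22_def
    by (intro commuting_comp2[OF i] incl_hom assms)+
  show "commuting K B C T (quad21 K A B C D) (quad12 K A B C D)"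
    unfolding T_def quad12_def quad21_def
    by (intro commuting_comp2[OF commuting_sym[OF i]] incl_hom assms)+
  show "commuting K A C T (quad11 K A B C D) (quad12 K A B C D)"
    "commuting K B D T (quad21 K A B C D) (quad22 K A B C D)"
    unfolding T_def quad11_def quad12_def quad21_def quad22_def
    by (intro commuting_hom[OF commuting_incl] incl_hom AC BD T assms)+
qed

lemma middle_flip_eq_copair:
  assumes alg: "assoc_algebra K A" "assoc_algebra K B" "assoc_algebra K C" "assoc_algebra K D"
    and X: "X \<in> carrier (tensor K (tensor K A B) (tensor K C D))"
  defines "T \<equiv> tensor K (tensor K A C) (tensor K B D)"
  shows "middle_flip K A B C D X
    = copair K T (copair K T (quad11 K A B C D) (quad21 K A B C D))
        (copair K T (quad12 K A B C D) (quad22 K A B C D)) X"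
proof -
  let ?a = "quad11 K A B C D" and ?b = "quad21 K A B C D"
    and ?c = "quad12 K A B C D" and ?d = "quad22 K A B C D"
  note qu = quad_commuting[OF alg, folded T_def]
  interpret ab: commuting_pair K A B T ?a ?b using qu(1) by (rule commuting_pair.intro)
  interpret cd: commuting_pair K C D T ?c ?d using qu(6) by (rule commuting_pair.intro)
  interpret AC: algebra_pair K A C using alg by (intro algebra_pair.intro)
  interpret BD: algebra_pair K B D using alg by (intro algebra_pair.intro)
  interpret T: algebra_pair K "tensor K A C" "tensor K B D"
    using alg by (intro algebra_pair.intro tensor_algebra)
  have four: "pure_tensor K (tensor K A C) (tensor K B D) (pure_tensor K A C a c)
      (pure_tensor K B D b d)
      = (?a a \<otimes>\<^bsub>T\<^esub> ?b b) \<otimes>\<^bsub>T\<^esub> (?c c \<otimes>\<^bsub>T\<^esub> ?d d)"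
    if "a \<in> carrier A" "b \<in> carrier B" "c \<in> carrier C" "d \<in> carrier D" for a b c d
    using that
    by (simp add: T_def quad11_def quad12_def quad21_def quad22_def incl1_def incl2_def
        T.mult_pure AC.mult_pure BD.mult_pure tensor_simps(5)[symmetric] AC.mult_one BD.mult_one)
  have inner: "tensor_lift K T (\<lambda>c d. pure_tensor K (tensor K A C) (tensor K B D)
        (pure_tensor K A C a c) (pure_tensor K B D b d)) Y
      = (?a a \<otimes>\<^bsub>T\<^esub> ?b b) \<otimes>\<^bsub>T\<^esub> copair K T ?c ?d Y"
    if "a \<in> carrier A" "b \<in> carrier B" "Y \<in> carrier (tensor K C D)" for a b Y
    using that by (intro cd.lift_mult_left four) (simp_all add: ab.bil)
  have outer: "tensor_lift K T (\<lambda>a b. tensor_lift K T (\<lambda>c d. pure_tensor K (tensor K A C) (tensor K B D)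
        (pure_tensor K A C a c) (pure_tensor K B D b d)) Y) X
      = copair K T ?a ?b X \<otimes>\<^bsub>T\<^esub> copair K T ?c ?d Y"
    if "X \<in> carrier (tensor K A B)" "Y \<in> carrier (tensor K C D)" for X Y
    using that by (intro ab.lift_mult_right inner copair_closed[OF qu(6)])
  show ?thesis unfolding middle_flip_def Let_def T_def[symmetric]
    by (rule tensor_lift_eq_copair[OF commuting_copair4[OF qu] X outer])
qed

lemma middle_flip_hom:
  assumes alg: "assoc_algebra K A" "assoc_algebra K B" "assoc_algebra K C" "assoc_algebra K D"
  shows "middle_flip K A B C D \<in> alg_hom K (tensor K (tensor K A B) (tensor K C D))
    (tensor K (tensor K A C) (tensor K B D))"
  by (rule alg_hom_cong[OF copair_hom[OF commuting_copair4[OF quad_commuting[OF alg]]]])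
    (simp_all add: middle_flip_eq_copair[OF alg] tensor_algebra alg)

lemma copair_middle_flip:
  assumes ab: "commuting K A B T a b" and ac: "commuting K A C T a c" and ad: "commuting K A D T a d"
    and bc: "commuting K B C T b c" and bd: "commuting K B D T b d" and cd: "commuting K C D T c d"
    and X: "X \<in> carrier (tensor K (tensor K A B) (tensor K C D))"
  shows "copair K T (copair K T a c) (copair K T b d) (middle_flip K A B C D X)
    = copair K T (copair K T a b) (copair K T c d) X"
proof -
  note alg = commutingD(1,2)[OF ab] commutingD(1,2,3)[OF cd]
  let ?Q = "tensor K (tensor K A C) (tensor K B D)" and ?h =
      "copair K T (copair K T a c) (copair K T b d)"
  let ?a = "quad11 K A B C D" and ?b = "quad21 K A B C D"
    and ?c = "quad12 K A B C D" and ?d = "quad22 K A B C D"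
  note qu = quad_commuting[OF alg(1-4)]
  note qu' = commuting_copair4[OF qu]
  note acbd = commuting_copair4[OF ac ab ad commuting_sym[OF bc] cd bd]
  note h = copair_hom[OF acbd]
  note AC = alg_homD(1)[OF incl_hom(1)[OF alg(1,3)]] alg_homD(1)[OF incl_hom(2)[OF alg(1,3)]]
  note BD = alg_homD(1)[OF incl_hom(1)[OF alg(2,4)]] alg_homD(1)[OF incl_hom(2)[OF alg(2,4)]]
  note js = quad11_def quad12_def quad21_def quad22_def copair_incl[OF acbd] copair_incl[OF ac]
      copair_incl[OF bd] AC BD
  have "?h (middle_flip K A B C D X) = copair K T (?h \<circ> copair K ?Q ?a ?b) (?h \<circ> copair K ?Q ?c ?d) X"
    unfolding middle_flip_eq_copair[OF alg(1-4) X] by (rule hom_copair[OF qu' h alg(5) X])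
  also have "\<dots> = copair K T (copair K T a b) (copair K T c d) X"
  proof (rule copair_cong[OF commuting_hom[OF qu' h alg(5)] X])
    fix Y assume Y: "Y \<in> carrier (tensor K A B)"
    have "(?h \<circ> copair K ?Q ?a ?b) Y = copair K T (?h \<circ> ?a) (?h \<circ> ?b) Y"
      using hom_copair[OF qu(1) h alg(5) Y] by simp
    also have "\<dots> = copair K T a b Y"
      by (rule copair_cong[OF commuting_hom[OF qu(1) h alg(5)] Y]) (simp_all add: js)
    finally show "(?h \<circ> copair K ?Q ?a ?b) Y = copair K T a b Y" .
  next
    fix Y assume Y: "Y \<in> carrier (tensor K C D)"
    have "(?h \<circ> copair K ?Q ?c ?d) Y = copair K T (?h \<circ> ?c) (?h \<circ> ?d) Y"
      using hom_copair[OF qu(6) h alg(5) Y] by simp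
    also have "\<dots> = copair K T c d Y"
      by (rule copair_cong[OF commuting_hom[OF qu(6) h alg(5)] Y]) (simp_all add: js)
    finally show "(?h \<circ> copair K ?Q ?c ?d) Y = copair K T c d Y" .
  qed
  finally show ?thesis .
qed

lemma leg_eqs:
  assumes alg: "assoc_algebra K H" and X: "X \<in> carrier (tensor K H H)"
  defines "T \<equiv> tensor K H (tensor K H H)"
  shows "leg12 K H X = copair K T (triple1 K H H H) (triple2 K H H H) X"
    and "leg13 K H X = copair K T (triple1 K H H H) (triple3 K H H H) X"
    and "leg23 K H X = copair K T (triple2 K H H H) (triple3 K H H H) X"
proof -
  note HH = tensor_algebra[OF alg alg]
  have incl: "(\<lambda>y. pure_tensor K H H y \<one>\<^bsub>H\<^esub>) = incl1 K H H" "pure_tensor K H H \<one>\<^bsub>H\<^esub> = incl2 K H H"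
    by (simp_all add: fun_eq_iff incl1_def incl2_def)
  note map = tensor_map_eq_copair[OF alg alg alg HH alg_hom_id]
  show "leg12 K H X = copair K T (triple1 K H H H) (triple2 K H H H) X"
    unfolding leg12_def T_def incl map[OF incl_hom(1)[OF alg alg] X] triple1_def triple2_def
    by (simp add: comp_def)
  show "leg13 K H X = copair K T (triple1 K H H H) (triple3 K H H H) X"
    unfolding leg13_def T_def incl map[OF incl_hom(2)[OF alg alg] X] triple1_def triple3_def
    by (simp add: comp_def)
  show "leg23 K H X = copair K T (triple2 K H H H) (triple3 K H H H) X"
    using hom_copair[OF commuting_incl[OF alg alg] incl_hom(2)[OF alg HH] tensor_algebra[OF alg HH] X]
    by (simp add: copair_incl_id[OF alg alg X] leg23_def T_def triple2_def triple3_def incl2_def)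
qed

section \<open>Bialgebras in terms of points\<close>

text \<open>The convolution product \<open>x * y = [x, y] \<circ> \<Delta>\<close> of two commuting points of \<open>H\<close> in \<open>T\<close>.\<close>

definition conv ::
  "('k, 'm) ring_scheme \<Rightarrow> ('k, 'h, 'n) bialgebra_scheme \<Rightarrow> ('k, 't, 'q) module_scheme
    \<Rightarrow> ('h \<Rightarrow> 't) \<Rightarrow> ('h \<Rightarrow> 't) \<Rightarrow> 'h \<Rightarrow> 't" where
  "conv K H T x y h = copair K T x y (comult H h)"

text \<open>The unit for convolution: the composite of the counit with the unit map \<open>\<bbbk> \<rightarrow> T\<close>.\<close>

definition counit_pt ::
  "('k, 'm) ring_scheme \<Rightarrow> ('k, 'h, 'n) bialgebra_scheme \<Rightarrow> ('k, 't, 'q) module_scheme \<Rightarrow> 'h \<Rightarrow> 't" where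
  "counit_pt K H T h = counit H h \<odot>\<^bsub>T\<^esub> \<one>\<^bsub>T\<^esub>"

text \<open>The three inclusions are the universal commuting triple of points.\<close>

lemma copair_triple_id:
  assumes alg: "assoc_algebra K A" "assoc_algebra K B" "assoc_algebra K C"
    and X: "X \<in> carrier (tensor K A (tensor K B C))"
  defines "T \<equiv> tensor K A (tensor K B C)"
  shows "copair K T (triple1 K A B C) (copair K T (triple2 K A B C) (triple3 K A B C)) X = X"
proof -
  note BC = tensor_algebra[OF alg(2,3)]
  note tr = triple_commuting[OF alg, folded T_def]
  have c: "commuting K A (tensor K B C) T (triple1 K A B C)
      (copair K T (triple2 K A B C) (triple3 K A B C))"
    by (intro commuting_sym[OF commuting_copair] tr tr[THEN commuting_sym])
  have "copair K T (triple1 K A B C) (copair K T (triple2 K A B C) (triple3 K A B C)) X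
      = copair K T (incl1 K A (tensor K B C)) (incl2 K A (tensor K B C)) X"
  proof (rule copair_cong[OF c X])
    fix Y assume Y: "Y \<in> carrier (tensor K B C)"
    have "incl2 K A (tensor K B C) (copair K (tensor K B C) (incl1 K B C) (incl2 K B C) Y)
      = copair K T (triple2 K A B C) (triple3 K A B C) Y"
      using hom_copair[OF commuting_incl[OF alg(2,3)] incl_hom(2)[OF alg(1) BC]
          commutingD(3)[OF c[unfolded T_def]] Y]
      by (simp add: T_def triple2_def triple3_def)
    then show "copair K T (triple2 K A B C) (triple3 K A B C) Y = incl2 K A (tensor K B C) Y"
      by (simp add: copair_incl_id[OF alg(2,3) Y])
  qed (simp add: triple1_def)
  also have "\<dots> = X" unfolding T_def by (rule copair_incl_id[OF alg(1) BC X])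
  finally show ?thesis .
qed

lemma copair_copair_triple:
  assumes xy: "commuting K A B T x y" and xz: "commuting K A C T x z" and yz: "commuting K B C T y z"
  defines "T3 \<equiv> tensor K A (tensor K B C)"
  shows "X \<in> carrier (tensor K A B) \<Longrightarrow>
      copair K T x (copair K T y z) (copair K T3 (triple1 K A B C) (triple2 K A B C) X) = copair K T
          x y X"
    and "X' \<in> carrier (tensor K A C) \<Longrightarrow>
      copair K T x (copair K T y z) (copair K T3 (triple1 K A B C) (triple3 K A B C) X') = copair K
          T x z X'"
    and "X'' \<in> carrier (tensor K B C) \<Longrightarrow>
      copair K T x (copair K T y z) (copair K T3 (triple2 K A B C) (triple3 K A B C) X'') = copair K
          T y z X''"
proof -
  note alg = commutingD(1,2)[OF xy] commutingD(2,3)[OF xz]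
  note tr = triple_commuting[OF alg(1-3), folded T3_def]
  note h = copair_hom[OF commuting_sym[OF commuting_copair[OF yz commuting_sym[OF xy]
      commuting_sym[OF xz]]], folded T3_def]
  show "X \<in> carrier (tensor K A B) \<Longrightarrow>
      copair K T x (copair K T y z) (copair K T3 (triple1 K A B C) (triple2 K A B C) X) = copair K T
          x y X"
    unfolding hom_copair[OF tr(1) h alg(4)]
    by (rule copair_cong[OF commuting_hom[OF tr(1) h alg(4)]])
        (simp_all add: copair_triple[OF xy xz yz])
  show "X' \<in> carrier (tensor K A C) \<Longrightarrow>
      copair K T x (copair K T y z) (copair K T3 (triple1 K A B C) (triple3 K A B C) X') = copair K
          T x z X'"
    unfolding hom_copair[OF tr(2) h alg(4)]
    by (rule copair_cong[OF commuting_hom[OF tr(2) h alg(4)]])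
        (simp_all add: copair_triple[OF xy xz yz])
  show "X'' \<in> carrier (tensor K B C) \<Longrightarrow>
      copair K T x (copair K T y z) (copair K T3 (triple2 K A B C) (triple3 K A B C) X'') = copair K
          T y z X''"
    unfolding hom_copair[OF tr(3) h alg(4)]
    by (rule copair_cong[OF commuting_hom[OF tr(3) h alg(4)]])
        (simp_all add: copair_triple[OF xy xz yz])
qed

lemma ground_algebra: "field K \<Longrightarrow> assoc_algebra K (ground K)"
proof -
  assume "field K"
  then interpret field K .
  have "abelian_group (ground K)"
    by (rule abelian_groupI) (use l_neg in \<open>auto simp: ground_def a_ac\<close>)
  moreover from this have "ring (ground K)"
    by (intro ringI monoidI) (auto simp: ground_def m_assoc l_distr r_distr)
  ultimately show ?thesis
    by (intro assoc_algebraI moduleI is_cring field_axioms)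
      (auto simp: ground_def m_assoc l_distr r_distr m_lcomm)
qed

text \<open>A bialgebra without coassociativity and counit axioms. This is the setting in which these
  axioms are compared with their versions for points.\<close>

locale comult_algebra = assoc_algebra K H for K (structure) and H (structure) +
  assumes comult_alg_hom: "comult H \<in> alg_hom K H (tensor K H H)"
    and counit_alg_hom: "counit H \<in> alg_hom K H (ground K)"
begin

lemmas comult_closed = alg_homD(1)[OF comult_alg_hom]

lemma counit_closed: "h \<in> carrier H \<Longrightarrow> counit H h \<in> carrier K"
  using alg_homD(1)[OF counit_alg_hom] by (simp add: ground_def)

lemma HH: "assoc_algebra K (tensor K H H)"
  by (intro tensor_algebra assoc_algebra_axioms)

lemma conv_comp: "conv K H T x y = copair K T x y \<circ> comult H"
  by (simp add: fun_eq_iff conv_def)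

lemma conv_hom: "commuting K H H T x y \<Longrightarrow> conv K H T x y \<in> alg_hom K H T"
  unfolding conv_comp by (rule alg_hom_comp[OF comult_alg_hom copair_hom])

lemma conv_commuting:
  assumes "commuting K H H T x y" "commuting K H B T x z" "commuting K H B T y z"
  shows "commuting K H B T (conv K H T x y) z"
  unfolding conv_comp
  by (rule commuting_comp[OF commuting_copair[OF assms] comult_alg_hom assoc_algebra_axioms])

lemma conv_cong:
  assumes "commuting K H H T x y" "h \<in> carrier H"
    and "\<And>h. h \<in> carrier H \<Longrightarrow> x h = x' h" "\<And>h. h \<in> carrier H \<Longrightarrow> y h = y' h"
  shows "conv K H T x y h = conv K H T x' y' h"
  unfolding conv_def by (rule copair_cong[OF assms(1) comult_closed[OF assms(2)] assms(3,4)])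

lemma counit_pt_hom:
  assumes "assoc_algebra K T"
  shows "counit_pt K H T \<in> alg_hom K H T"
proof -
  interpret T: assoc_algebra K T by fact
  note e = alg_homD[OF counit_alg_hom, unfolded ground_def, simplified]
  show ?thesis
    by (rule alg_homI)
      (simp_all add: counit_pt_def e T.smult_l_distr T.smult_assoc1 T.smult_mult_left)
qed

lemma counit_pt_commuting:
  assumes T: "assoc_algebra K T" and B: "assoc_algebra K B" and y: "y \<in> alg_hom K B T"
  shows "commuting K H B T (counit_pt K H T) y"
proof -
  interpret T: assoc_algebra K T by fact
  show ?thesis
    by (rule commutingI[OF assoc_algebra_axioms B T counit_pt_hom[OF T] y])
      (simp add: counit_pt_def T.smult_mult_left T.smult_mult_right counit_closed alg_homD(1)[OF y])
qed

lemma hom_counit_pt: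
  assumes "f \<in> alg_hom K T T'" "assoc_algebra K T" "h \<in> carrier H"
  shows "f (counit_pt K H T h) = counit_pt K H T' h"
proof -
  interpret T: assoc_algebra K T by fact
  show ?thesis using assms(3) by (simp add: counit_pt_def alg_homD[OF assms(1)] counit_closed)
qed

lemma copair_counit_left:
  assumes T: "assoc_algebra K T" and y: "y \<in> alg_hom K H T" and X: "X \<in> carrier (tensor K H H)"
  shows "copair K T (counit_pt K H T) y X = y (counit_left K H X)"
proof -
  note id = counit_pt_commuting[OF assoc_algebra_axioms assoc_algebra_axioms alg_hom_id]
  have "counit_left K H X = copair K H (counit_pt K H H) (\<lambda>x. x) X"
    unfolding counit_left_def
    by (rule tensor_lift_eq_copair[OF id X]) (simp add: counit_pt_def smult_mult_left counit_closed)
  then have "y (counit_left K H X) = copair K T (y \<circ> counit_pt K H H) (y \<circ> (\<lambda>x. x)) X"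
    using hom_copair[OF id y T X] by simp
  also have "\<dots> = copair K T (counit_pt K H T) y X"
    by (rule copair_cong[OF commuting_hom[OF id y T] X])
        (simp_all add: hom_counit_pt[OF y assoc_algebra_axioms])
  finally show ?thesis by simp
qed

lemma copair_counit_right:
  assumes T: "assoc_algebra K T" and y: "y \<in> alg_hom K H T" and X: "X \<in> carrier (tensor K H H)"
  shows "copair K T y (counit_pt K H T) X = y (counit_right K H X)"
proof -
  note id = commuting_sym[OF counit_pt_commuting[OF assoc_algebra_axioms assoc_algebra_axioms
      alg_hom_id]]
  have "counit_right K H X = copair K H (\<lambda>x. x) (counit_pt K H H) X"
    unfolding counit_right_def
    by (rule tensor_lift_eq_copair[OF id X]) (simp add: counit_pt_def smult_mult_right counit_closed)
  then have "y (counit_right K H X) = copair K T (y \<circ> (\<lambda>x. x)) (y \<circ> counit_pt K H H) X"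
    using hom_copair[OF id y T X] by simp
  also have "\<dots> = copair K T y (counit_pt K H T) X"
    by (rule copair_cong[OF commuting_hom[OF id y T] X])
        (simp_all add: hom_counit_pt[OF y assoc_algebra_axioms])
  finally show ?thesis by simp
qed

lemma comult_left_closed: "X \<in> carrier (tensor K H H) \<Longrightarrow> comult_left K H X \<in> carrier
    (tensor K (tensor K H H) H)"
  unfolding comult_left_def
  by (rule alg_homD(1)[OF tensor_map_hom[OF assoc_algebra_axioms assoc_algebra_axioms HH
      assoc_algebra_axioms
    comult_alg_hom alg_hom_id]])

lemma comult_right_closed: "X \<in> carrier (tensor K H H) \<Longrightarrow> comult_right K H X \<in> carrier
    (tensor K H (tensor K H H))"
  unfolding comult_right_def
  by (rule alg_homD(1)[OF tensor_map_hom[OF assoc_algebra_axioms assoc_algebra_axioms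
      assoc_algebra_axioms HH
    alg_hom_id comult_alg_hom]])

lemma copair_comult_left:
  assumes xy: "commuting K H H T x y" and xz: "commuting K H H T x z" and yz: "commuting K H H T y z"
    and X: "X \<in> carrier (tensor K H H)"
  shows "copair K T x (copair K T y z) (tensor_assoc K H H H (comult_left K H X)) = copair K T
      (conv K H T x y) z X"
  unfolding copair_assoc[OF xy xz yz comult_left_closed[OF X]]
  unfolding comult_left_def conv_comp
  using copair_tensor_map[OF commuting_copair[OF xy xz yz] assoc_algebra_axioms assoc_algebra_axioms
      comult_alg_hom alg_hom_id X]
  by (simp add: comp_def)

lemma copair_comult_right:
  assumes xy: "commuting K H H T x y" and xz: "commuting K H H T x z" and yz: "commuting K H H T y z"
    and X: "X \<in> carrier (tensor K H H)"
  shows "copair K T x (copair K T y z) (comult_right K H X) = copair K T x (conv K H T y z) X"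
  unfolding comult_right_def conv_comp
  using copair_tensor_map[OF commuting_sym[OF
      commuting_copair[OF yz commuting_sym[OF xy] commuting_sym[OF xz]]]
      assoc_algebra_axioms assoc_algebra_axioms alg_hom_id comult_alg_hom X]
  by (simp add: comp_def)

lemmas triples = triple_commuting[OF assoc_algebra_axioms assoc_algebra_axioms assoc_algebra_axioms]

lemma comult_left_triple:
  assumes X: "X \<in> carrier (tensor K H H)"
  defines "T \<equiv> tensor K H (tensor K H H)"
  shows "tensor_assoc K H H H (comult_left K H X)
    = copair K T (conv K H T (triple1 K H H H) (triple2 K H H H)) (triple3 K H H H) X"
  using copair_comult_left[OF triples X] copair_triple_id[OF assoc_algebra_axioms
      assoc_algebra_axioms assoc_algebra_axioms
      alg_homD(1)[OF tensor_assoc_hom[OF assoc_algebra_axioms assoc_algebra_axioms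
          assoc_algebra_axioms] comult_left_closed[OF X]]]
  by (simp add: T_def)

lemma comult_right_triple:
  assumes X: "X \<in> carrier (tensor K H H)"
  defines "T \<equiv> tensor K H (tensor K H H)"
  shows "comult_right K H X = copair K T (triple1 K H H H)
      (conv K H T (triple2 K H H H) (triple3 K H H H)) X"
  using copair_comult_right[OF triples X] copair_triple_id[OF assoc_algebra_axioms
      assoc_algebra_axioms assoc_algebra_axioms
      comult_right_closed[OF X]]
  by (simp add: T_def)

text \<open>The converse passage from points to axioms: it suffices to consider points in \<open>H \<otimes> (H \<otimes> H)\<close>
  and \<open>H\<close>.\<close>

lemma bialgebra_pointsI:
  assumes assoc: "\<And>x y z h. commuting K H H (tensor K H (tensor K H H)) x y
      \<Longrightarrow> commuting K H H (tensor K H (tensor K H H)) x z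
      \<Longrightarrow> commuting K H H (tensor K H (tensor K H H)) y z \<Longrightarrow> h \<in> carrier H
      \<Longrightarrow> conv K H (tensor K H (tensor K H H)) (conv K H (tensor K H (tensor K H H)) x y) z h
        = conv K H (tensor K H (tensor K H H)) x (conv K H (tensor K H (tensor K H H)) y z) h"
    and unit: "\<And>h. h \<in> carrier H \<Longrightarrow> conv K H H (counit_pt K H H) (\<lambda>x. x) h = h"
      "\<And>h. h \<in> carrier H \<Longrightarrow> conv K H H (\<lambda>x. x) (counit_pt K H H) h = h"
  shows "bialgebra K H"
proof
  fix h assume h: "h \<in> carrier H"
  note X = comult_closed[OF h]
  show "tensor_assoc K H H H (comult_left K H (comult H h)) = comult_right K H (comult H h)"
    using assoc[OF triples h] unfolding comult_left_triple[OF X] comult_right_triple[OF X]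
    by (simp add: conv_def)
  show "counit_left K H (comult H h) = h"
    using unit(1)[OF h] copair_counit_left[OF assoc_algebra_axioms alg_hom_id X] by (simp add: conv_def)
  show "counit_right K H (comult H h) = h"
    using unit(2)[OF h] copair_counit_right[OF assoc_algebra_axioms alg_hom_id X]
        by (simp add: conv_def)
qed (rule comult_alg_hom counit_alg_hom)+

end

sublocale bialgebra \<subseteq> comult_algebra
  by unfold_locales (rule comult_hom counit_hom)+

context bialgebra
begin

lemma conv_assoc:
  assumes xy: "commuting K H H T x y" and xz: "commuting K H H T x z" and yz: "commuting K H H T y z"
    and h: "h \<in> carrier H"
  shows "conv K H T (conv K H T x y) z h = conv K H T x (conv K H T y z) h"
  using copair_comult_left[OF xy xz yz comult_closed[OF h]]
      copair_comult_right[OF xy xz yz comult_closed[OF h]]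
  unfolding coassoc[OF h] conv_def[of K H T _ _ h] by simp

lemma conv_counit:
  assumes "assoc_algebra K T" "y \<in> alg_hom K H T" "h \<in> carrier H"
  shows "conv K H T (counit_pt K H T) y h = y h" "conv K H T y (counit_pt K H T) h = y h"
  using copair_counit_left[OF assms(1,2) comult_closed[OF assms(3)]]
    copair_counit_right[OF assms(1,2) comult_closed[OF assms(3)]]
  unfolding conv_def by (simp_all add: counit_left counit_right assms(3))

end

lemma (in monoid) Units_inv_mult:
  assumes u: "u \<in> Units G" and v: "v \<in> Units G"
  shows "inv (u \<otimes> v) = inv v \<otimes> inv u"
proof (rule inv_char)
  note c = Units_closed[OF u] Units_closed[OF v] Units_inv_closed[OF u] Units_inv_closed[OF v]
  have "u \<otimes> v \<otimes> (inv v \<otimes> inv u) = u \<otimes> (v \<otimes> inv v) \<otimes> inv u"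
    using c by (simp add: m_assoc)
  then show "u \<otimes> v \<otimes> (inv v \<otimes> inv u) = \<one>" using u v c by simp
  have "inv v \<otimes> inv u \<otimes> (u \<otimes> v) = inv v \<otimes> (inv u \<otimes> u) \<otimes> v"
    using c by (simp add: m_assoc)
  then show "inv v \<otimes> inv u \<otimes> (u \<otimes> v) = \<one>" using u v c by simp
qed (use u v in auto)

lemma alg_hom_Units:
  assumes f: "f \<in> alg_hom K A B" and A: "assoc_algebra K A" and B: "assoc_algebra K B"
      and u: "u \<in> Units A"
  shows "f u \<in> Units B" and "f (inv\<^bsub>A\<^esub> u) = inv\<^bsub>B\<^esub> (f u)"
proof -
  interpret A: assoc_algebra K A by fact
  interpret B: assoc_algebra K B by fact
  note f' = alg_homD[OF f]
  have c: "f u \<in> carrier B" "f (inv\<^bsub>A\<^esub> u) \<in> carrier B" using u f' by auto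
  have i: "f u \<otimes>\<^bsub>B\<^esub> f (inv\<^bsub>A\<^esub> u) = \<one>\<^bsub>B\<^esub>" "f (inv\<^bsub>A\<^esub> u) \<otimes>\<^bsub>B\<^esub> f u = \<one>\<^bsub>B\<^esub>"
    using u by (simp_all flip: f' add: A.Units_closed)
  show "f u \<in> Units B" using c i by (auto simp: Units_def)
  show "f (inv\<^bsub>A\<^esub> u) = inv\<^bsub>B\<^esub> (f u)" using B.inv_char[OF c i] by simp
qed

lemma copair_Units:
  assumes xy: "commuting K A B T x y" and u: "u \<in> Units (tensor K A B)"
  shows "copair K T x y u \<in> Units T"
    and "copair K T x y (inv\<^bsub>tensor K A B\<^esub> u) = inv\<^bsub>T\<^esub> (copair K T x y u)"
  using alg_hom_Units[OF copair_hom[OF xy] tensor_algebra commutingD(3)[OF xy] u] commutingD[OF xy]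
      by auto

lemma commuting_copair_right:
  assumes xy: "commuting K A B T x y" and xz: "commuting K A C T x z" and yz: "commuting K B C T y z"
  shows "commuting K A (tensor K B C) T x (copair K T y z)"
  by (intro commuting_sym[OF commuting_copair] commuting_sym[OF xy] commuting_sym[OF xz] yz)

section \<open>Universal R-matrices in terms of points\<close>

context quasitriangular_bialgebra
begin

lemma R_closed: "R \<in> carrier (tensor K H H)"
  using R_unit by (auto simp: Units_def)

lemma R_conv_right:
  assumes xy: "commuting K H H T x y" and xz: "commuting K H H T x z" and yz: "commuting K H H T y z"
  shows "copair K T x (conv K H T y z) R = copair K T x z R \<otimes>\<^bsub>T\<^esub> copair K T x y R"
proof -
  note alg = assoc_algebra_axioms assoc_algebra_axioms assoc_algebra_axioms
  note h = copair_hom[OF commuting_copair_right[OF xy xz yz]]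
  show ?thesis
    unfolding copair_comult_right[OF xy xz yz R_closed, symmetric] R_comult_right
      leg_eqs[OF alg(1) R_closed]
    using copair_closed[OF triples(1) R_closed] copair_closed[OF triples(2) R_closed]
    by (simp add: alg_homD(2)[OF h] copair_copair_triple[OF xy xz yz] R_closed)
qed

lemma R_conv_left:
  assumes xy: "commuting K H H T x y" and xz: "commuting K H H T x z" and yz: "commuting K H H T y z"
  shows "copair K T (conv K H T x y) z R = copair K T x z R \<otimes>\<^bsub>T\<^esub> copair K T y z R"
proof -
  note alg = assoc_algebra_axioms assoc_algebra_axioms assoc_algebra_axioms
  note h = copair_hom[OF commuting_copair_right[OF xy xz yz]]
  show ?thesis
    unfolding copair_comult_left[OF xy xz yz R_closed, symmetric] R_comult_left
      leg_eqs[OF alg(1) R_closed]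
    using copair_closed[OF triples(3) R_closed] copair_closed[OF triples(2) R_closed]
    by (simp add: alg_homD(2)[OF h] copair_copair_triple[OF xy xz yz] R_closed)
qed

lemma R_swap:
  assumes xy: "commuting K H H T x y" and h: "h \<in> carrier H"
  shows "copair K T x y R \<otimes>\<^bsub>T\<^esub> conv K H T x y h = conv K H T y x h \<otimes>\<^bsub>T\<^esub> copair K T x y R"
proof -
  interpret HH: assoc_algebra K "tensor K H H" by (rule HH)
  note j = alg_homD[OF copair_hom[OF xy]]
  have "tensor_flip K H H (comult H h) \<otimes>\<^bsub>tensor K H H\<^esub> R = R \<otimes>\<^bsub>tensor K H H\<^esub> comult H h"
    unfolding R_comult[OF h] using R_unit R_closed comult_closed[OF h] by (simp add: HH.m_assoc)
  then have "copair K T x y (R \<otimes>\<^bsub>tensor K H H\<^esub> comult H h)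
      = copair K T x y (tensor_flip K H H (comult H h) \<otimes>\<^bsub>tensor K H H\<^esub> R)" by simp
  then show ?thesis
    using comult_closed[OF h] R_closed
    by (simp add: j tensor_flip_closed[OF assoc_algebra_axioms assoc_algebra_axioms]
        copair_flip[OF xy] conv_def)
qed

text \<open>\<open>R[\<epsilon>, y]\<close> is invertible and idempotent by the hexagon identities and \<open>\<epsilon> * \<epsilon> = \<epsilon>\<close>, hence is
  \<open>1\<close>.\<close>

lemma R_counit:
  assumes T: "assoc_algebra K T" and y: "y \<in> alg_hom K H T"
  shows "copair K T (counit_pt K H T) y R = \<one>\<^bsub>T\<^esub>" "copair K T y (counit_pt K H T) R = \<one>\<^bsub>T\<^esub>"
proof -
  interpret T: assoc_algebra K T by fact
  let ?e = "counit_pt K H T"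
  note e = counit_pt_hom[OF T]
  note ey = counit_pt_commuting[OF T assoc_algebra_axioms y]
  note ee = counit_pt_commuting[OF T assoc_algebra_axioms e]
  note ye = commuting_sym[OF ey]
  have idem: "a = \<one>\<^bsub>T\<^esub>" if "a \<in> Units T" "a = a \<otimes>\<^bsub>T\<^esub> a" for a
    using that by (metis T.Units_closed T.Units_l_cancel T.one_closed T.r_one)
  have "copair K T ?e y R = copair K T (conv K H T ?e ?e) y R"
    by (rule copair_cong[OF ey R_closed]) (simp_all add: conv_counit[OF T e])
  then show "copair K T ?e y R = \<one>\<^bsub>T\<^esub>"
    using R_conv_left[OF ee ey ey] by (intro idem copair_Units[OF ey R_unit]) simp
  have "copair K T y ?e R = copair K T y (conv K H T ?e ?e) R"
    by (rule copair_cong[OF ye R_closed]) (simp_all add: conv_counit[OF T e])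
  then show "copair K T y ?e R = \<one>\<^bsub>T\<^esub>"
    using R_conv_right[OF ye ye ee] by (intro idem copair_Units[OF ye R_unit]) simp
qed

end

context triangular_bialgebra
begin

lemma R_inv:
  assumes xy: "commuting K H H T x y"
  shows "copair K T x y (inv\<^bsub>tensor K H H\<^esub> R) = copair K T y x R"
    "copair K T y x R \<otimes>\<^bsub>T\<^esub> copair K T x y R = \<one>\<^bsub>T\<^esub>"
proof -
  interpret T: assoc_algebra K T using xy by (rule commutingD)
  show 1: "copair K T x y (inv\<^bsub>tensor K H H\<^esub> R) = copair K T y x R"
    unfolding R_inverse by (rule copair_flip[OF xy R_closed])
  show "copair K T y x R \<otimes>\<^bsub>T\<^esub> copair K T x y R = \<one>\<^bsub>T\<^esub>"
    using copair_Units[OF xy R_unit] 1 by simp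
qed

end

text \<open>By triangularity one of the two hexagon identities implies the other one, because passing to
  inverses exchanges the two arguments of \<open>R\<close>.\<close>

lemma (in bialgebra) triangular_pointsI:
  assumes R: "R \<in> carrier (tensor K H H)"
    and inv: "\<And>x y. commuting K H H (tensor K H H) x y
      \<Longrightarrow> copair K (tensor K H H) y x R \<otimes>\<^bsub>tensor K H H\<^esub> copair K (tensor K H H) x y R = \<one>\<^bsub>tensor K H H\<^esub>"
    and swap: "\<And>x y h. commuting K H H (tensor K H H) x y \<Longrightarrow> h \<in> carrier H
      \<Longrightarrow> copair K (tensor K H H) x y R \<otimes>\<^bsub>tensor K H H\<^esub> conv K H (tensor K H H) x y h
        = conv K H (tensor K H H) y x h \<otimes>\<^bsub>tensor K H H\<^esub> copair K (tensor K H H) x y R"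
    and right: "\<And>x y z. commuting K H H (tensor K H (tensor K H H)) x y
      \<Longrightarrow> commuting K H H (tensor K H (tensor K H H)) x z
      \<Longrightarrow> commuting K H H (tensor K H (tensor K H H)) y z
      \<Longrightarrow> copair K (tensor K H (tensor K H H)) x (conv K H (tensor K H (tensor K H H)) y z) R
        = copair K (tensor K H (tensor K H H)) x z R \<otimes>\<^bsub>tensor K H (tensor K H H)\<^esub>
          copair K (tensor K H (tensor K H H)) x y R"
  shows "triangular_bialgebra K H R"
proof -
  let ?T2 = "tensor K H H" and ?T3 = "tensor K H (tensor K H H)"
  let ?i1 = "incl1 K H H" and ?i2 = "incl2 K H H"
  let ?x = "triple1 K H H H" and ?y = "triple2 K H H H" and ?z = "triple3 K H H H"
  note alg = assoc_algebra_axioms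
  note i = commuting_incl[OF alg alg]
  interpret T2: assoc_algebra K ?T2 by (rule HH)
  interpret T3: assoc_algebra K ?T3 by (intro tensor_algebra alg)
  have flip: "tensor_flip K H H X = copair K ?T2 ?i2 ?i1 X" if "X \<in> carrier ?T2" for X
    by (rule tensor_flip_eq_copair[OF alg alg that])
  have fl: "tensor_flip K H H R \<in> carrier ?T2" by (rule tensor_flip_closed[OF alg alg R])
  have i12: "tensor_flip K H H R \<otimes>\<^bsub>?T2\<^esub> R = \<one>\<^bsub>?T2\<^esub>" "R \<otimes>\<^bsub>?T2\<^esub> tensor_flip K H H R = \<one>\<^bsub>?T2\<^esub>"
    using inv[OF i] inv[OF commuting_sym[OF i]] by (simp_all add: flip R copair_incl_id[OF alg alg R])
  have unit: "R \<in> Units ?T2" using i12 R fl by (auto simp: Units_def)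
  have Rinv: "inv\<^bsub>?T2\<^esub> R = tensor_flip K H H R"
    using T2.inv_char[OF R fl] i12 by simp
  have Rpt: "copair K ?T3 y x R = inv\<^bsub>?T3\<^esub> (copair K ?T3 x y R)" if "commuting K H H ?T3 x y" for x y
    using copair_Units(2)[OF that unit] copair_flip[OF that R] by (simp add: Rinv)
  have comult: "tensor_flip K H H (comult H h) = R \<otimes>\<^bsub>?T2\<^esub> comult H h \<otimes>\<^bsub>?T2\<^esub> inv\<^bsub>?T2\<^esub> R"
      if h: "h \<in> carrier H" for h
  proof -
    note c = comult_closed[OF h]
    note fc = tensor_flip_closed[OF alg alg c]
    have "R \<otimes>\<^bsub>?T2\<^esub> comult H h = tensor_flip K H H (comult H h) \<otimes>\<^bsub>?T2\<^esub> R"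
      using swap[OF i h] by (simp add: conv_def copair_incl_id[OF alg alg] R c flip)
    then show ?thesis using c fc R unit by (simp add: T2.m_assoc)
  qed
  have right': "comult_right K H R = leg13 K H R \<otimes>\<^bsub>?T3\<^esub> leg12 K H R"
    unfolding comult_right_triple[OF R] leg_eqs[OF alg R] by (rule right[OF triples])
  have "copair K ?T3 (conv K H ?T3 ?x ?y) ?z R = inv\<^bsub>?T3\<^esub> (copair K ?T3 ?z (conv K H ?T3 ?x ?y) R)"
    by (rule Rpt) (intro conv_commuting commuting_sym[OF conv_commuting] triples
        triples[THEN commuting_sym])
  also have "\<dots> = inv\<^bsub>?T3\<^esub> (copair K ?T3 ?z ?y R \<otimes>\<^bsub>?T3\<^esub> copair K ?T3 ?z ?x R)"
    by (subst right) (auto intro: triples triples[THEN commuting_sym])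
  also have "\<dots> = inv\<^bsub>?T3\<^esub> (copair K ?T3 ?z ?x R) \<otimes>\<^bsub>?T3\<^esub> inv\<^bsub>?T3\<^esub> (copair K ?T3 ?z ?y R)"
    by (intro T3.Units_inv_mult copair_Units(1)[OF _ unit] triples triples[THEN commuting_sym])
  also have "\<dots> = copair K ?T3 ?x ?z R \<otimes>\<^bsub>?T3\<^esub> copair K ?T3 ?y ?z R"
    using Rpt[OF commuting_sym[OF triples(2)]] Rpt[OF commuting_sym[OF triples(3)]] by simp
  finally have left': "tensor_assoc K H H H (comult_left K H R) = leg13 K H R \<otimes>\<^bsub>?T3\<^esub> leg23 K H R"
    unfolding comult_left_triple[OF R] leg_eqs[OF alg R] .
  show ?thesis
    by (intro triangular_bialgebra.intro quasitriangular_bialgebra.intro bialgebra_axioms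
        quasitriangular_bialgebra_axioms.intro triangular_bialgebra_axioms.intro unit comult right'
            left' Rinv)
qed

section \<open>Twists in terms of points\<close>

context comult_algebra
begin

lemma twist_unit: "is_twist K H F \<Longrightarrow> F \<in> Units (tensor K H H)"
  by (simp add: is_twist_def)

lemma twist_closed: "is_twist K H F \<Longrightarrow> F \<in> carrier (tensor K H H)"
  by (auto simp: is_twist_def Units_def)

lemma copair_twist_lhs:
  assumes xy: "commuting K H H T x y" and xz: "commuting K H H T x z" and yz: "commuting K H H T y z"
    and F: "F \<in> carrier (tensor K H H)"
  shows "copair K T x (copair K T y z) (tensor_assoc K H H H
       (pure_tensor K (tensor K H H) H F \<one>\<^bsub>H\<^esub> \<otimes>\<^bsub>tensor K (tensor K H H) H\<^esub> comult_left K H F))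
    = copair K T x y F \<otimes>\<^bsub>T\<^esub> copair K T (conv K H T x y) z F"
proof -
  note alg = assoc_algebra_axioms
  note c = commuting_copair[OF xy xz yz]
  note L = comult_left_closed[OF F]
  have I: "incl1 K (tensor K H H) H F \<in> carrier (tensor K (tensor K H H) H)"
    by (rule alg_homD(1)[OF incl_hom(1)[OF HH alg] F])
  interpret HHH: assoc_algebra K "tensor K (tensor K H H) H" by (intro tensor_algebra alg)
  show ?thesis
    unfolding incl1_def[symmetric] copair_assoc[OF xy xz yz HHH.m_closed[OF I L]]
        alg_homD(2)[OF copair_hom[OF c] I L]
      copair_incl(1)[OF c F] copair_assoc[OF xy xz yz L, symmetric] copair_comult_left[OF xy xz yz F] ..
qed

lemma copair_twist_rhs:
  assumes xy: "commuting K H H T x y" and xz: "commuting K H H T x z" and yz: "commuting K H H T y z"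
    and F: "F \<in> carrier (tensor K H H)"
  shows "copair K T x (copair K T y z)
       (pure_tensor K H (tensor K H H) \<one>\<^bsub>H\<^esub> F \<otimes>\<^bsub>tensor K H (tensor K H H)\<^esub> comult_right K H F)
    = copair K T y z F \<otimes>\<^bsub>T\<^esub> copair K T x (conv K H T y z) F"
proof -
  note alg = assoc_algebra_axioms
  note c = commuting_copair_right[OF xy xz yz]
  note L = comult_right_closed[OF F]
  have I: "incl2 K H (tensor K H H) F \<in> carrier (tensor K H (tensor K H H))"
    by (rule alg_homD(1)[OF incl_hom(2)[OF alg HH] F])
  show ?thesis
    unfolding incl2_def[symmetric] alg_homD(2)[OF copair_hom[OF c] I L]
      copair_incl(2)[OF c F] copair_comult_right[OF xy xz yz F] ..
qed

lemma twist_cocycle: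
  assumes F: "is_twist K H F"
    and xy: "commuting K H H T x y" and xz: "commuting K H H T x z" and yz: "commuting K H H T y z"
  shows "copair K T x y F \<otimes>\<^bsub>T\<^esub> copair K T (conv K H T x y) z F
    = copair K T y z F \<otimes>\<^bsub>T\<^esub> copair K T x (conv K H T y z) F"
  using F copair_twist_lhs[OF xy xz yz twist_closed[OF F]]
      copair_twist_rhs[OF xy xz yz twist_closed[OF F]]
  unfolding is_twist_def by metis

lemma twist_counit:
  assumes F: "is_twist K H F" and T: "assoc_algebra K T" and y: "y \<in> alg_hom K H T"
  shows "copair K T (counit_pt K H T) y F = \<one>\<^bsub>T\<^esub>" "copair K T y (counit_pt K H T) F = \<one>\<^bsub>T\<^esub>"
  using F copair_counit_left[OF T y twist_closed[OF F]] copair_counit_right[OF T y twist_closed[OF F]]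
  by (simp_all add: is_twist_def alg_homD(4)[OF y])

lemma is_twist_pointsI:
  assumes unit: "F \<in> Units (tensor K H H)"
    and cocycle: "\<And>x y z. commuting K H H (tensor K H (tensor K H H)) x y
      \<Longrightarrow> commuting K H H (tensor K H (tensor K H H)) x z
      \<Longrightarrow> commuting K H H (tensor K H (tensor K H H)) y z
      \<Longrightarrow> copair K (tensor K H (tensor K H H)) x y F \<otimes>\<^bsub>tensor K H (tensor K H H)\<^esub>
          copair K (tensor K H (tensor K H H)) (conv K H (tensor K H (tensor K H H)) x y) z F
        = copair K (tensor K H (tensor K H H)) y z F \<otimes>\<^bsub>tensor K H (tensor K H H)\<^esub>
          copair K (tensor K H (tensor K H H)) x (conv K H (tensor K H (tensor K H H)) y z) F"
    and counit: "copair K H (counit_pt K H H) (\<lambda>x. x) F = \<one>\<^bsub>H\<^esub>"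
        "copair K H (\<lambda>x. x) (counit_pt K H H) F = \<one>\<^bsub>H\<^esub>"
  shows "is_twist K H F"
proof -
  note alg = assoc_algebra_axioms
  let ?T3 = "tensor K H (tensor K H H)"
  interpret T3: assoc_algebra K ?T3 by (intro tensor_algebra alg)
  interpret HHH: assoc_algebra K "tensor K (tensor K H H) H" by (intro tensor_algebra alg)
  have F: "F \<in> carrier (tensor K H H)" using unit by (auto simp: Units_def)
  note cl = alg_homD(1)[OF incl_hom(1)[OF HH alg] F] alg_homD(1)[OF incl_hom(2)[OF alg HH] F]
  note LR = HHH.m_closed[OF cl(1) comult_left_closed[OF F]]
      T3.m_closed[OF cl(2) comult_right_closed[OF F]]
  note L = alg_homD(1)[OF tensor_assoc_hom[OF alg alg alg] LR(1), unfolded incl1_def]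
  have "tensor_assoc K H H H
       (pure_tensor K (tensor K H H) H F \<one>\<^bsub>H\<^esub> \<otimes>\<^bsub>tensor K (tensor K H H) H\<^esub> comult_left K H F)
     = pure_tensor K H (tensor K H H) \<one>\<^bsub>H\<^esub> F \<otimes>\<^bsub>?T3\<^esub> comult_right K H F"
    using cocycle[OF triples] copair_twist_lhs[OF triples F] copair_twist_rhs[OF triples F]
      copair_triple_id[OF alg alg alg L] copair_triple_id[OF alg alg alg LR(2)[unfolded incl2_def]]
    by simp
  then show ?thesis
    unfolding is_twist_def
    using unit counit copair_counit_left[OF alg alg_hom_id F]
        copair_counit_right[OF alg alg_hom_id F] by simp
qed

end

section \<open>Change of record representation\<close>

text \<open>The tensor product constructions only see the algebra fields of a record, hence cannot tell
  apart a bialgebra from its twists, or the tensor product bialgebra from the underlying algebra.\<close>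

definition same_alg :: "('k, 'a, 'n) module_scheme \<Rightarrow> ('k, 'a, 'p) module_scheme \<Rightarrow> bool" where
  "same_alg A B \<longleftrightarrow> carrier A = carrier B \<and> monoid.mult A = monoid.mult B \<and> one A = one B \<and>
     zero A = zero B \<and> add A = add B \<and> smult A = smult B"

lemma same_algD:
  assumes "same_alg A B"
  shows "carrier A = carrier B" "monoid.mult A = monoid.mult B" "one A = one B"
     "zero A = zero B" "add A = add B" "smult A = smult B"
  using assms by (simp_all add: same_alg_def)

lemma same_alg_refl: "same_alg A A"
  by (simp add: same_alg_def)

lemma same_alg_sym: "same_alg A B \<Longrightarrow> same_alg B A"
  by (simp add: same_alg_def)

lemma same_alg_tensor:
  assumes "same_alg A A'" "same_alg B B'"
  shows "tensor_null K A B = tensor_null K A' B'" "pure_tensor K A B = pure_tensor K A' B'"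
    "tensor_module K A B = tensor_module K A' B'" "tensor K A B = tensor K A' B'"
proof -
  show 1: "tensor_null K A B = tensor_null K A' B'"
    unfolding tensor_null_def bilinear_rels_def
        by (simp add: same_algD[OF assms(1)] same_algD[OF assms(2)])
  show 2: "pure_tensor K A B = pure_tensor K A' B'"
    unfolding pure_tensor_def[abs_def] 1 by (simp add: same_algD[OF assms(1)] same_algD[OF assms(2)])
  show 3: "tensor_module K A B = tensor_module K A' B'"
    unfolding tensor_module_def 1 by (simp add: same_algD[OF assms(1)] same_algD[OF assms(2)])
  show "tensor K A B = tensor K A' B'"
    unfolding tensor_def 2 3 by (simp add: same_algD[OF assms(1)] same_algD[OF assms(2)])
qed

lemma same_alg_lift:
  assumes "same_alg T T'"
  shows "tensor_lift K T \<beta> = tensor_lift K T' \<beta>"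
  unfolding tensor_lift_def[abs_def] finsum_def finprod_def by (simp add: same_algD[OF assms])

lemma same_alg_copair: "same_alg T T' \<Longrightarrow> copair K T = copair K T'"
  by (simp add: fun_eq_iff copair_def same_alg_lift same_algD)

lemma same_alg_maps:
  assumes "same_alg A A'" "same_alg B B'"
  shows "tensor_map K A B = tensor_map K A' B'" "tensor_flip K A B = tensor_flip K A' B'"
    "alg_hom K A B = alg_hom K A' B'"
  by (simp_all add: fun_eq_iff tensor_map_def tensor_flip_def same_alg_tensor[OF assms]
      same_alg_tensor[OF assms(2,1)] alg_hom_def ring_hom_def same_algD[OF assms(1)]
          same_algD[OF assms(2)])

lemma same_alg_assoc_algebra:
  assumes "same_alg A B" "assoc_algebra K A"
  shows "assoc_algebra K B"
proof -
  interpret A: assoc_algebra K A by fact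
  have m: "module K B"
    by (rule module_cong[OF A.module_axioms]) (simp_all add: same_algD[OF assms(1)])
  have "ring B"
    by (intro ringI monoidI module.axioms(2)[OF m])
      (simp_all flip: same_algD[OF assms(1)] add: A.m_assoc A.l_distr A.r_distr)
  then show ?thesis
    by (intro assoc_algebraI m A.field_axioms)
      (simp_all flip: same_algD[OF assms(1)] add: A.smult_mult_left A.smult_mult_right)
qed

section \<open>Maps into twisted bialgebras in terms of points\<close>

lemma twisted_same: "same_alg (twisted K H F) H"
  by (simp add: same_alg_def twisted_def)

lemma twisted_simps:
  "carrier (twisted K H F) = carrier H"
  "counit (twisted K H F) = counit H"
  "comult (twisted K H F) h
    = F \<otimes>\<^bsub>tensor K H H\<^esub> comult H h \<otimes>\<^bsub>tensor K H H\<^esub> inv\<^bsub>tensor K H H\<^esub> F"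
  by (simp_all add: twisted_def)

lemma (in assoc_algebra) conj_eq_iff:
  assumes "u \<in> Units A" "a \<in> carrier A" "b \<in> carrier A"
  shows "u \<otimes>\<^bsub>A\<^esub> a \<otimes>\<^bsub>A\<^esub> inv\<^bsub>A\<^esub> u = b \<longleftrightarrow> u \<otimes>\<^bsub>A\<^esub> a = b \<otimes>\<^bsub>A\<^esub> u"
proof
  assume "u \<otimes>\<^bsub>A\<^esub> a \<otimes>\<^bsub>A\<^esub> inv\<^bsub>A\<^esub> u = b"
  then have "b \<otimes>\<^bsub>A\<^esub> u = u \<otimes>\<^bsub>A\<^esub> a \<otimes>\<^bsub>A\<^esub> inv\<^bsub>A\<^esub> u \<otimes>\<^bsub>A\<^esub> u" by simp
  then show "u \<otimes>\<^bsub>A\<^esub> a = b \<otimes>\<^bsub>A\<^esub> u" using assms by (simp add: m_assoc Units_closed)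
qed (use assms in \<open>simp add: m_assoc Units_closed\<close>)

text \<open>A bialgebra map \<open>f : H \<rightarrow> H'\<^sub>F\<close> satisfies \<open>F[x, y] (x * y)(f h) = (x f * y f)(h) F[x, y]\<close>. No
  inverse of \<open>F\<close> is needed to state this, and \<open>twisted_homI\<close> is the converse.\<close>

lemma twisted_homD:
  assumes H: "comult_algebra K H" and H': "comult_algebra K H'"
    and F: "F \<in> Units (tensor K H' H')"
    and f: "f \<in> bialgebra_hom K H (twisted K H' F)"
  shows "f \<in> alg_hom K H H'"
    and "\<And>h. h \<in> carrier H \<Longrightarrow> counit H' (f h) = counit H h"
    and "commuting K H' H' T x y \<Longrightarrow> h \<in> carrier H \<Longrightarrow>
      copair K T x y F \<otimes>\<^bsub>T\<^esub> conv K H' T x y (f h) = conv K H T (x \<circ> f) (y \<circ> f) h \<otimes>\<^bsub>T\<^esub> copair K T x y F"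
proof -
  interpret H: comult_algebra K H by fact
  interpret H': comult_algebra K H' by fact
  interpret HH': assoc_algebra K "tensor K H' H'" by (rule H'.HH)
  note same = twisted_same[of K H' F] same_alg_refl[of H]
  show hom: "f \<in> alg_hom K H H'"
    using f by (simp add: bialgebra_hom_def same_alg_maps(3)[OF same(2,1)])
  show "counit H' (f h) = counit H h" if "h \<in> carrier H" for h
    using f that by (simp add: bialgebra_hom_def twisted_simps)
  assume xy: "commuting K H' H' T x y" and h: "h \<in> carrier H"
  have Fc: "F \<in> carrier (tensor K H' H')" using F by auto
  note c = H'.comult_closed[OF alg_homD(1)[OF hom h]]
  note t = alg_homD(1)[OF tensor_map_hom[OF H.assoc_algebra_axioms H.assoc_algebra_axioms
      H'.assoc_algebra_axioms H'.assoc_algebra_axioms hom hom] H.comult_closed[OF h]]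
  have "F \<otimes>\<^bsub>tensor K H' H'\<^esub> comult H' (f h) \<otimes>\<^bsub>tensor K H' H'\<^esub> inv\<^bsub>tensor K H' H'\<^esub> F
      = tensor_map K H' H' f f (comult H h)"
    using f h by (simp add: bialgebra_hom_def twisted_simps same_alg_maps(1)[OF same(1) same(1)])
  then have "F \<otimes>\<^bsub>tensor K H' H'\<^esub> comult H' (f h)
      = tensor_map K H' H' f f (comult H h) \<otimes>\<^bsub>tensor K H' H'\<^esub> F"
    using HH'.conj_eq_iff[OF F c t] by simp
  then have "copair K T x y (F \<otimes>\<^bsub>tensor K H' H'\<^esub> comult H' (f h))
      = copair K T x y (tensor_map K H' H' f f (comult H h) \<otimes>\<^bsub>tensor K H' H'\<^esub> F)" by simp
  then show "copair K T x y F \<otimes>\<^bsub>T\<^esub> conv K H' T x y (f h) = conv K H T (x \<circ> f) (y \<circ> f) h \<otimes>\<^bsub>T\<^esub> copair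
      K T x y F"
    by (simp add: alg_homD(2)[OF copair_hom[OF xy]] Fc c t conv_def
        copair_tensor_map[OF xy H.assoc_algebra_axioms H.assoc_algebra_axioms hom hom
            H.comult_closed[OF h]])
qed

lemma twisted_homI:
  assumes H: "comult_algebra K H" and H': "comult_algebra K H'"
    and F: "F \<in> Units (tensor K H' H')"
    and hom: "f \<in> alg_hom K H H'"
    and counit: "\<And>h. h \<in> carrier H \<Longrightarrow> counit H' (f h) = counit H h"
    and comult: "\<And>x y h. commuting K H' H' (tensor K H' H') x y \<Longrightarrow> h \<in> carrier H \<Longrightarrow>
      copair K (tensor K H' H') x y F \<otimes>\<^bsub>tensor K H' H'\<^esub> conv K H' (tensor K H' H') x y (f h)
        = conv K H (tensor K H' H') (x \<circ> f) (y \<circ> f) h \<otimes>\<^bsub>tensor K H' H'\<^esub> copair K (tensor K H' H') x y F"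
  shows "f \<in> bialgebra_hom K H (twisted K H' F)"
proof -
  interpret H: comult_algebra K H by fact
  interpret H': comult_algebra K H' by fact
  interpret HH': assoc_algebra K "tensor K H' H'" by (rule H'.HH)
  note same = twisted_same[of K H' F] same_alg_refl[of H]
  note alg = H'.assoc_algebra_axioms H.assoc_algebra_axioms
  have Fc: "F \<in> carrier (tensor K H' H')" using F by auto
  have "F \<otimes>\<^bsub>tensor K H' H'\<^esub> comult H' (f h) \<otimes>\<^bsub>tensor K H' H'\<^esub> inv\<^bsub>tensor K H' H'\<^esub> F
      = tensor_map K H' H' f f (comult H h)" if h: "h \<in> carrier H" for h
  proof -
    note c = H'.comult_closed[OF alg_homD(1)[OF hom h]]
    note t = alg_homD(1)[OF tensor_map_hom[OF alg(2,2,1,1) hom hom] H.comult_closed[OF h]]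
    have "F \<otimes>\<^bsub>tensor K H' H'\<^esub> comult H' (f h)
      = tensor_map K H' H' f f (comult H h) \<otimes>\<^bsub>tensor K H' H'\<^esub> F"
      using comult[OF commuting_incl[OF alg(1,1)] h]
      unfolding conv_def tensor_map_eq_copair[OF alg(2,2,1,1) hom hom H.comult_closed[OF h], symmetric]
        copair_incl_id[OF alg(1,1) Fc] copair_incl_id[OF alg(1,1) c] .
    then show ?thesis using HH'.conj_eq_iff[OF F c t] by simp
  qed
  then show ?thesis
    using hom counit by (simp add: bialgebra_hom_def twisted_simps same_alg_maps(3)[OF same(2,1)]
        same_alg_maps(1)[OF same(1) same(1)])
qed

lemma twisted_R_iff:
  assumes H: "assoc_algebra K H" and H': "assoc_algebra K H'"
    and F: "F \<in> Units (tensor K H' H')" and R: "R \<in> carrier (tensor K H H)"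
        and R': "R' \<in> carrier (tensor K H' H')"
    and hom: "f \<in> alg_hom K H H'"
  shows "tensor_map K H' H' f f R = twisted_R K H' F R' \<longleftrightarrow>
    tensor_map K H' H' f f R \<otimes>\<^bsub>tensor K H' H'\<^esub> F = tensor_flip K H' H' F \<otimes>\<^bsub>tensor K H' H'\<^esub> R'"
proof -
  interpret HH': assoc_algebra K "tensor K H' H'" by (intro tensor_algebra H')
  have Fc: "F \<in> carrier (tensor K H' H')" using F by auto
  note fl = tensor_flip_closed[OF H' H' Fc]
  note t = alg_homD(1)[OF tensor_map_hom[OF H H H' H' hom hom] R]
  show ?thesis unfolding twisted_R_def
  proof
    assume *: "tensor_map K H' H' f f R = tensor_flip K H' H' F \<otimes>\<^bsub>tensor K H' H'\<^esub> R' \<otimes>\<^bsub>tensor K H'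
        H'\<^esub> inv\<^bsub>tensor K H' H'\<^esub> F"
    show "tensor_map K H' H' f f R \<otimes>\<^bsub>tensor K H' H'\<^esub> F = tensor_flip K H' H' F \<otimes>\<^bsub>tensor K H' H'\<^esub> R'"
      unfolding * using F Fc fl R' by (simp add: HH'.m_assoc)
  next
    assume "tensor_map K H' H' f f R \<otimes>\<^bsub>tensor K H' H'\<^esub> F = tensor_flip K H' H' F \<otimes>\<^bsub>tensor K H' H'\<^esub> R'"
    from this[symmetric] show "tensor_map K H' H' f f R = tensor_flip K H' H' F \<otimes>\<^bsub>tensor K H' H'\<^esub> R'
        \<otimes>\<^bsub>tensor K H' H'\<^esub> inv\<^bsub>tensor K H' H'\<^esub> F"
      using F Fc t by (simp add: HH'.m_assoc)
  qed
qed

text \<open>Likewise, preservation of R-matrices means \<open>R[x f, y f] F[x, y] = F[y, x] R'[x, y]\<close>.\<close>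

lemma triangular_hom_twistedD:
  assumes H: "comult_algebra K H" and H': "comult_algebra K H'"
    and F: "F \<in> Units (tensor K H' H')" and R: "R \<in> carrier (tensor K H H)"
        and R': "R' \<in> carrier (tensor K H' H')"
    and f: "f \<in> triangular_hom K H R (twisted K H' F) (twisted_R K H' F R')"
    and xy: "commuting K H' H' T x y"
  shows "copair K T (x \<circ> f) (y \<circ> f) R \<otimes>\<^bsub>T\<^esub> copair K T x y F = copair K T y x F \<otimes>\<^bsub>T\<^esub> copair K T x y R'"
proof -
  note same = twisted_same[of K H' F]
  note alg = commutingD(1)[OF xy] comult_algebra.axioms(1)[OF H]
  have bf: "f \<in> bialgebra_hom K H (twisted K H' F)" using f by (simp add: triangular_hom_def)
  note hom = twisted_homD(1)[OF H H' F bf]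
  have Fc: "F \<in> carrier (tensor K H' H')" using F by (auto simp: Units_def)
  have "tensor_map K H' H' f f R = twisted_R K H' F R'"
    using f by (simp add: triangular_hom_def same_alg_maps(1)[OF same same])
  then have "tensor_map K H' H' f f R \<otimes>\<^bsub>tensor K H' H'\<^esub> F = tensor_flip K H' H' F \<otimes>\<^bsub>tensor K H' H'\<^esub> R'"
    using twisted_R_iff[OF alg(2,1) F R R' hom] by simp
  then have "copair K T x y (tensor_map K H' H' f f R \<otimes>\<^bsub>tensor K H' H'\<^esub> F)
      = copair K T x y (tensor_flip K H' H' F \<otimes>\<^bsub>tensor K H' H'\<^esub> R')" by simp
  then show ?thesis
    by (simp add: alg_homD(2)[OF copair_hom[OF xy]] Fc R' copair_flip[OF xy]
        tensor_flip_closed[OF alg(1,1)]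
      alg_homD(1)[OF tensor_map_hom[OF alg(2,2,1,1) hom hom] R]
          copair_tensor_map[OF xy alg(2,2) hom hom R])
qed

lemma triangular_hom_twistedI:
  assumes H: "comult_algebra K H" and H': "comult_algebra K H'"
    and F: "F \<in> Units (tensor K H' H')" and R: "R \<in> carrier (tensor K H H)"
        and R': "R' \<in> carrier (tensor K H' H')"
    and f: "f \<in> bialgebra_hom K H (twisted K H' F)"
    and eq: "\<And>x y. commuting K H' H' (tensor K H' H') x y \<Longrightarrow>
      copair K (tensor K H' H') (x \<circ> f) (y \<circ> f) R \<otimes>\<^bsub>tensor K H' H'\<^esub> copair K (tensor K H' H') x y F
        = copair K (tensor K H' H') y x F \<otimes>\<^bsub>tensor K H' H'\<^esub> copair K (tensor K H' H') x y R'"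
  shows "f \<in> triangular_hom K H R (twisted K H' F) (twisted_R K H' F R')"
proof -
  note same = twisted_same[of K H' F]
  note alg = comult_algebra.axioms(1)[OF H'] comult_algebra.axioms(1)[OF H]
  note hom = twisted_homD(1)[OF H H' F f]
  have Fc: "F \<in> carrier (tensor K H' H')" using F by (auto simp: Units_def)
  have "tensor_map K H' H' f f R \<otimes>\<^bsub>tensor K H' H'\<^esub> F = tensor_flip K H' H' F \<otimes>\<^bsub>tensor K H' H'\<^esub> R'"
    using eq[OF commuting_incl[OF alg(1,1)]]
    unfolding tensor_map_eq_copair[OF alg(2,2,1,1) hom hom R] tensor_flip_eq_copair[OF alg(1,1) Fc]
      copair_incl_id[OF alg(1,1) Fc] copair_incl_id[OF alg(1,1) R'] .
  then have "tensor_map K H' H' f f R = twisted_R K H' F R'"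
    using twisted_R_iff[OF alg(2,1) F R R' hom] by simp
  with f show ?thesis by (simp add: triangular_hom_def same_alg_maps(1)[OF same same])
qed

section \<open>Tensor products of bialgebras\<close>

text \<open>\<open>B\<close> is the tensor product bialgebra. A point \<open>p\<close> of \<open>B\<close> is the same as the commuting pair of
  its components \<open>p1 p\<close> and \<open>p2 p\<close>.\<close>

locale bialgebra_pair = H1: bialgebra K H1 + H2: bialgebra K H2 for K (structure) and H1 and H2
begin

abbreviation "B \<equiv> tensor_bialgebra K H1 H2"
abbreviation "p1 p \<equiv> p \<circ> incl1 K H1 H2"
abbreviation "p2 p \<equiv> p \<circ> incl2 K H1 H2"

lemmas alg1 = H1.assoc_algebra_axioms
lemmas alg2 = H2.assoc_algebra_axioms

sublocale H12: algebra_pair K H1 H2 ..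

lemma same: "same_alg B (tensor K H1 H2)"
  by (simp add: same_alg_def tensor_bialgebra_def Let_def)

lemma B_algebra: "assoc_algebra K B"
  by (rule same_alg_assoc_algebra[OF same_alg_sym[OF same] H12.tensor_algebra])

lemma B_carrier: "carrier B = carrier (tensor K H1 H2)"
  by (rule same_algD(1)[OF same])

lemma BB: "tensor K B B = tensor K (tensor K H1 H2) (tensor K H1 H2)"
  by (rule same_alg_tensor[OF same same])

lemma B_hom: "alg_hom K B T = alg_hom K (tensor K H1 H2) T"
  by (rule same_alg_maps(3)[OF same same_alg_refl])

lemma incl_B: "incl1 K H1 H2 \<in> alg_hom K H1 B" "incl2 K H1 H2 \<in> alg_hom K H2 B"
  using incl_hom[OF alg1 alg2] by (simp_all add: same_alg_maps(3)[OF same_alg_refl same])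

lemma B_comult: "comult B X = middle_flip K H1 H1 H2 H2
    (tensor_map K (tensor K H1 H1) (tensor K H2 H2) (comult H1) (comult H2) X)"
  by (simp add: tensor_bialgebra_def Let_def)

lemma counit_commuting: "commuting K H1 H2 (ground K) (counit H1) (counit H2)"
  by (rule commutingI[OF alg1 alg2 ground_algebra[OF H12.field] H1.counit_alg_hom H2.counit_alg_hom])
    (simp add: ground_def H1.R.m_comm H1.counit_closed H2.counit_closed)

lemma B_counit: "X \<in> carrier B \<Longrightarrow> counit B X = copair K (ground K) (counit H1) (counit H2) X"
  using tensor_lift_eq_copair[OF counit_commuting]
      by (simp add: B_carrier tensor_bialgebra_def Let_def ground_def)

sublocale B: comult_algebra K B
proof (intro comult_algebra.intro comult_algebra_axioms.intro B_algebra)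
  have "comult B = middle_flip K H1 H1 H2 H2 \<circ>
      tensor_map K (tensor K H1 H1) (tensor K H2 H2) (comult H1) (comult H2)"
    by (simp add: fun_eq_iff B_comult)
  then show "comult B \<in> alg_hom K B (tensor K B B)"
    unfolding B_hom BB
    by (simp add: alg_hom_comp[OF tensor_map_hom[OF alg1 alg2 H1.HH H2.HH H1.comult_alg_hom
        H2.comult_alg_hom]
          middle_flip_hom[OF alg1 alg1 alg2 alg2]])
  show "counit B \<in> alg_hom K B (ground K)"
    by (rule alg_hom_cong[OF copair_hom[OF counit_commuting, folded B_hom] B_algebra])
        (simp add: B_counit)
qed

lemma points:
  assumes "commuting K B B T p q"
  shows "commuting K H1 H1 T (p1 p) (p1 q)" "commuting K H1 H2 T (p1 p) (p2 q)"
    "commuting K H2 H1 T (p2 p) (p1 q)" "commuting K H2 H2 T (p2 p) (p2 q)"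
  using commuting_comp2[OF assms incl_B(1) alg1 incl_B(1) alg1]
      commuting_comp2[OF assms incl_B(1) alg1 incl_B(2) alg2]
    commuting_comp2[OF assms incl_B(2) alg2 incl_B(1) alg1]
        commuting_comp2[OF assms incl_B(2) alg2 incl_B(2) alg2]
  by auto

lemma point12:
  assumes "p \<in> alg_hom K B T" "assoc_algebra K T"
  shows "commuting K H1 H2 T (p1 p) (p2 p)"
  using commuting_hom[OF commuting_incl[OF alg1 alg2] assms(1)[unfolded B_hom] assms(2)] .

lemma copair_p12:
  assumes "p \<in> alg_hom K B T" "assoc_algebra K T" "X \<in> carrier B"
  shows "copair K T (p1 p) (p2 p) X = p X"
  using copair_comp_incl[OF alg1 alg2 assms(2) assms(1)[unfolded B_hom]] assms(3)
      by (simp add: B_carrier)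

lemma copair_B_middle_flip:
  assumes pq: "commuting K B B T p q"
    and X: "X \<in> carrier (tensor K (tensor K H1 H1) (tensor K H2 H2))"
  shows "copair K T p q (middle_flip K H1 H1 H2 H2 X) = copair K T (copair K T (p1 p) (p1 q))
      (copair K T (p2 p) (p2 q)) X"
proof -
  note c = points[OF pq] point12[OF commutingD(4)[OF pq] commutingD(3)[OF pq]]
    point12[OF commutingD(5)[OF pq] commutingD(3)[OF pq]]
  have m: "middle_flip K H1 H1 H2 H2 X \<in> carrier (tensor K B B)"
    unfolding BB by (rule alg_homD(1)[OF middle_flip_hom[OF alg1 alg1 alg2 alg2] X])
  have "copair K T p q (middle_flip K H1 H1 H2 H2 X)
      = copair K T (copair K T (p1 p) (p2 p)) (copair K T (p1 q) (p2 q)) (middle_flip K H1 H1 H2 H2 X)"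
    by (rule copair_cong[OF pq m]) (simp_all add: copair_p12 commutingD[OF pq])
  also have "\<dots> = copair K T (copair K T (p1 p) (p1 q)) (copair K T (p2 p) (p2 q)) X"
    by (rule copair_middle_flip[OF c(1,5,2) commuting_sym[OF c(3)] c(6) c(4) X])
  finally show ?thesis .
qed

text \<open>Convolution of points of the tensor product is componentwise.\<close>

lemma conv_B:
  assumes pq: "commuting K B B T p q" and X: "X \<in> carrier B"
  shows "conv K B T p q X = copair K T (conv K H1 T (p1 p) (p1 q)) (conv K H2 T (p2 p) (p2 q)) X"
proof -
  note c = points[OF pq] point12[OF commutingD(4)[OF pq] commutingD(3)[OF pq]]
    point12[OF commutingD(5)[OF pq] commutingD(3)[OF pq]]
  note X' = X[unfolded B_carrier]
  note t = alg_homD(1)[OF tensor_map_hom[OF alg1 alg2 H1.HH H2.HH H1.comult_alg_hom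
      H2.comult_alg_hom] X']
  show ?thesis
    unfolding conv_def B_comult copair_B_middle_flip[OF pq t]
    unfolding copair_tensor_map[OF commuting_copair4[OF c(1,5,2) commuting_sym[OF c(3)] c(6) c(4)]
        alg1 alg2 H1.comult_alg_hom H2.comult_alg_hom X'] H1.conv_comp H2.conv_comp
    by (simp add: comp_def conv_def)
qed

lemma conv_B_commuting:
  assumes pq: "commuting K B B T p q"
  shows "commuting K H1 H2 T (conv K H1 T (p1 p) (p1 q)) (conv K H2 T (p2 p) (p2 q))"
proof -
  note c = points[OF pq] point12[OF commutingD(4)[OF pq] commutingD(3)[OF pq]]
    point12[OF commutingD(5)[OF pq] commutingD(3)[OF pq]]
  show ?thesis
    by (intro H1.conv_commuting commuting_sym[OF H2.conv_commuting] c c[THEN commuting_sym])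
qed

lemma conv_B_incl:
  assumes pq: "commuting K B B T p q"
  shows "h \<in> carrier H1 \<Longrightarrow> p1 (conv K B T p q) h = conv K H1 T (p1 p) (p1 q) h"
    "h' \<in> carrier H2 \<Longrightarrow> p2 (conv K B T p q) h' = conv K H2 T (p2 p) (p2 q) h'"
  using alg_homD(1)[OF incl_B(1)] alg_homD(1)[OF incl_B(2)]
  by (simp_all add: conv_B[OF pq] copair_incl[OF conv_B_commuting[OF pq]])

lemma counit_pt_B:
  assumes T: "assoc_algebra K T"
  shows "h \<in> carrier H1 \<Longrightarrow> p1 (counit_pt K B T) h = counit_pt K H1 T h"
    "h' \<in> carrier H2 \<Longrightarrow> p2 (counit_pt K B T) h' = counit_pt K H2 T h'"
  using alg_homD(1)[OF incl_B(1)] alg_homD(1)[OF incl_B(2)]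
  by (simp_all add: counit_pt_def B_counit copair_incl[OF counit_commuting])

lemma copair_interleave:
  assumes pq: "commuting K B B T p q"
    and X: "X1 \<in> carrier (tensor K H1 H1)" "X2 \<in> carrier (tensor K H2 H2)"
  shows "copair K T p q (interleave K H1 H2 X1 X2) = copair K T (p1 p) (p1 q) X1 \<otimes>\<^bsub>T\<^esub> copair K T
      (p2 p) (p2 q) X2"
proof -
  interpret HH: algebra_pair K "tensor K H1 H1" "tensor K H2 H2"
      by (intro algebra_pair.intro H1.HH H2.HH)
  note c = points[OF pq] point12[OF commutingD(4)[OF pq] commutingD(3)[OF pq]]
    point12[OF commutingD(5)[OF pq] commutingD(3)[OF pq]]
  show ?thesis
    unfolding interleave_def copair_B_middle_flip[OF pq HH.pure_tensor_closed[OF X]]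
    by (rule copair_pure[OF commuting_copair4[OF c(1,5,2) commuting_sym[OF c(3)] c(6) c(4)] X])
qed

lemma interleave_closed:
  assumes "X1 \<in> carrier (tensor K H1 H1)" "X2 \<in> carrier (tensor K H2 H2)"
  shows "interleave K H1 H2 X1 X2 \<in> carrier (tensor K B B)"
proof -
  interpret HH: algebra_pair K "tensor K H1 H1" "tensor K H2 H2"
      by (intro algebra_pair.intro H1.HH H2.HH)
  show ?thesis unfolding interleave_def BB
    by (rule alg_homD(1)[OF middle_flip_hom[OF alg1 alg1 alg2 alg2] HH.pure_tensor_closed[OF assms]])
qed

sublocale B: bialgebra K B
proof (rule B.bialgebra_pointsI)
  fix p q r X
  let ?T = "tensor K B (tensor K B B)"
  assume pq: "commuting K B B ?T p q" and pr: "commuting K B B ?T p r" and qr: "commuting K B B ?T q r"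
    and X: "X \<in> carrier B"
  note pq_r = B.conv_commuting[OF pq pr qr]
  note p_qr = commuting_sym[OF B.conv_commuting[OF qr commuting_sym[OF pq] commuting_sym[OF pr]]]
  note c = points[OF pq] points[OF pr] points[OF qr]
  have 1: "conv K H1 ?T (p1 (conv K B ?T p q)) (p1 r) h = conv K H1 ?T (p1 p) (p1 (conv K B ?T q r)) h"
    if h: "h \<in> carrier H1" for h
  proof -
    have "conv K H1 ?T (p1 (conv K B ?T p q)) (p1 r) h = conv K H1 ?T (conv K H1 ?T (p1 p) (p1 q))
        (p1 r) h"
      by (rule H1.conv_cong[OF points(1)[OF pq_r] h conv_B_incl(1)[OF pq] refl])
    also have "\<dots> = conv K H1 ?T (p1 p) (conv K H1 ?T (p1 q) (p1 r)) h"
      by (rule H1.conv_assoc[OF c(1,5,9) h])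
    also have "\<dots> = conv K H1 ?T (p1 p) (p1 (conv K B ?T q r)) h"
      by (rule H1.conv_cong[OF points(1)[OF p_qr] h refl conv_B_incl(1)[OF qr], symmetric])
    finally show ?thesis .
  qed
  have 2: "conv K H2 ?T (p2 (conv K B ?T p q)) (p2 r) h = conv K H2 ?T (p2 p) (p2 (conv K B ?T q r)) h"
    if h: "h \<in> carrier H2" for h
  proof -
    have "conv K H2 ?T (p2 (conv K B ?T p q)) (p2 r) h = conv K H2 ?T (conv K H2 ?T (p2 p) (p2 q))
        (p2 r) h"
      by (rule H2.conv_cong[OF points(4)[OF pq_r] h conv_B_incl(2)[OF pq] refl])
    also have "\<dots> = conv K H2 ?T (p2 p) (conv K H2 ?T (p2 q) (p2 r)) h"
      by (rule H2.conv_assoc[OF c(4,8,12) h])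
    also have "\<dots> = conv K H2 ?T (p2 p) (p2 (conv K B ?T q r)) h"
      by (rule H2.conv_cong[OF points(4)[OF p_qr] h refl conv_B_incl(2)[OF qr], symmetric])
    finally show ?thesis .
  qed
  show "conv K B ?T (conv K B ?T p q) r X = conv K B ?T p (conv K B ?T q r) X"
    unfolding conv_B[OF pq_r X] conv_B[OF p_qr X]
    by (rule copair_cong[OF conv_B_commuting[OF pq_r] X[unfolded B_carrier] 1 2])
next
  fix X assume X: "X \<in> carrier B"
  note ci = B.counit_pt_commuting[OF B_algebra B_algebra alg_hom_id]
  note cpt = counit_pt_B[OF B_algebra]
  have id: "copair K B (p1 (\<lambda>x. x)) (p2 (\<lambda>x. x)) X = X"
    by (rule copair_p12[OF alg_hom_id B_algebra X])
  have i: "p1 (\<lambda>x. x) \<in> alg_hom K H1 B" "p2 (\<lambda>x. x) \<in> alg_hom K H2 B"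
    using incl_B by (simp_all add: comp_def)
  have "conv K B B (counit_pt K B B) (\<lambda>x. x) X = copair K B (p1 (\<lambda>x. x)) (p2 (\<lambda>x. x)) X"
    unfolding conv_B[OF ci X]
  proof (rule copair_cong[OF conv_B_commuting[OF ci] X[unfolded B_carrier]])
    fix h assume h: "h \<in> carrier H1"
    show "conv K H1 B (p1 (counit_pt K B B)) (p1 (\<lambda>x. x)) h = p1 (\<lambda>x. x) h"
      by (rule trans[OF H1.conv_cong[OF points(1)[OF ci] h cpt(1) refl]
          H1.conv_counit(1)[OF B_algebra i(1) h]])
  next
    fix h assume h: "h \<in> carrier H2"
    show "conv K H2 B (p2 (counit_pt K B B)) (p2 (\<lambda>x. x)) h = p2 (\<lambda>x. x) h"
      by (rule trans[OF H2.conv_cong[OF points(4)[OF ci] h cpt(2) refl]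
          H2.conv_counit(1)[OF B_algebra i(2) h]])
  qed
  with id show "conv K B B (counit_pt K B B) (\<lambda>x. x) X = X" by simp
  note ic = commuting_sym[OF ci]
  have "conv K B B (\<lambda>x. x) (counit_pt K B B) X = copair K B (p1 (\<lambda>x. x)) (p2 (\<lambda>x. x)) X"
    unfolding conv_B[OF ic X]
  proof (rule copair_cong[OF conv_B_commuting[OF ic] X[unfolded B_carrier]])
    fix h assume h: "h \<in> carrier H1"
    show "conv K H1 B (p1 (\<lambda>x. x)) (p1 (counit_pt K B B)) h = p1 (\<lambda>x. x) h"
      by (rule trans[OF H1.conv_cong[OF points(1)[OF ic] h refl cpt(1)]
          H1.conv_counit(2)[OF B_algebra i(1) h]])
  next
    fix h assume h: "h \<in> carrier H2"
    show "conv K H2 B (p2 (\<lambda>x. x)) (p2 (counit_pt K B B)) h = p2 (\<lambda>x. x) h"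
      by (rule trans[OF H2.conv_cong[OF points(4)[OF ic] h refl cpt(2)]
          H2.conv_counit(2)[OF B_algebra i(2) h]])
  qed
  with id show "conv K B B (\<lambda>x. x) (counit_pt K B B) X = X" by simp
qed

end

section \<open>The R-matrix of a tensor product\<close>

lemma (in monoid) mult4_swap:
  assumes "a \<in> carrier G" "b \<in> carrier G" "c \<in> carrier G" "d \<in> carrier G" "b \<otimes> c = c \<otimes> b"
  shows "(a \<otimes> b) \<otimes> (c \<otimes> d) = (a \<otimes> c) \<otimes> (b \<otimes> d)"
proof -
  have "(a \<otimes> b) \<otimes> (c \<otimes> d) = a \<otimes> (b \<otimes> c) \<otimes> d" using assms(1-4) by (simp add: m_assoc)
  also have "\<dots> = a \<otimes> (c \<otimes> b) \<otimes> d" using assms(5) by simp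
  also have "\<dots> = (a \<otimes> c) \<otimes> (b \<otimes> d)" using assms(1-4) by (simp add: m_assoc)
  finally show ?thesis .
qed

lemmas copair_commute = commutingD(6)[OF commuting_copair4]

text \<open>To intertwine two algebra maps on a tensor product, an element only has to do so on both
  factors. This moves a twist or an R-matrix past the value of another one.\<close>

lemma intertwine_tensor:
  assumes alg: "assoc_algebra K A" "assoc_algebra K B" "assoc_algebra K T"
    and f: "f \<in> alg_hom K (tensor K A B) T" and g: "g \<in> alg_hom K (tensor K A B) T"
        and u: "u \<in> carrier T"
    and 1: "\<And>a. a \<in> carrier A \<Longrightarrow> u \<otimes>\<^bsub>T\<^esub> f (incl1 K A B a) = g (incl1 K A B a) \<otimes>\<^bsub>T\<^esub> u"
    and 2: "\<And>b. b \<in> carrier B \<Longrightarrow> u \<otimes>\<^bsub>T\<^esub> f (incl2 K A B b) = g (incl2 K A B b) \<otimes>\<^bsub>T\<^esub> u"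
    and X: "X \<in> carrier (tensor K A B)"
  shows "u \<otimes>\<^bsub>T\<^esub> f X = g X \<otimes>\<^bsub>T\<^esub> u"
proof -
  interpret algebra_pair K A B using alg(1,2) by (rule algebra_pair.intro)
  interpret T': assoc_algebra K T by fact
  note f' = alg_homD[OF f] and g' = alg_homD[OF g]
  note i = alg_homD(1)[OF incl_hom(1)[OF alg(1,2)]] alg_homD(1)[OF incl_hom(2)[OF alg(1,2)]]
  show ?thesis
    using X
  proof (rule tensor_induct)
    fix a b assume ab: "a \<in> carrier A" "b \<in> carrier B"
    have p: "pure_tensor K A B a b = incl1 K A B a \<otimes>\<^bsub>tensor K A B\<^esub> incl2 K A B b"
      using ab by (simp add: mult_pure incl1_def incl2_def)
    have "u \<otimes>\<^bsub>T\<^esub> f (pure_tensor K A B a b) = u \<otimes>\<^bsub>T\<^esub> f (incl1 K A B a) \<otimes>\<^bsub>T\<^esub> f (incl2 K A B b)"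
      using ab u by (simp add: p f' i T'.m_assoc)
    also have "\<dots> = g (incl1 K A B a) \<otimes>\<^bsub>T\<^esub> (u \<otimes>\<^bsub>T\<^esub> f (incl2 K A B b))"
      using ab u by (simp add: 1 f' g' i T'.m_assoc)
    also have "\<dots> = g (pure_tensor K A B a b) \<otimes>\<^bsub>T\<^esub> u"
      using ab u by (simp add: 2 p f' g' i T'.m_assoc)
    finally show "u \<otimes>\<^bsub>T\<^esub> f (pure_tensor K A B a b) = g (pure_tensor K A B a b) \<otimes>\<^bsub>T\<^esub> u" .
  qed (use u in \<open>simp add: f' g' T'.l_distr T'.r_distr\<close>)
qed

lemma intertwine_copair:
  assumes xy: "commuting K A B T x y" and xy': "commuting K A B T x' y'" and u: "u \<in> carrier T"
    and 1: "\<And>a. a \<in> carrier A \<Longrightarrow> u \<otimes>\<^bsub>T\<^esub> x a = x' a \<otimes>\<^bsub>T\<^esub> u"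
    and 2: "\<And>b. b \<in> carrier B \<Longrightarrow> u \<otimes>\<^bsub>T\<^esub> y b = y' b \<otimes>\<^bsub>T\<^esub> u"
    and X: "X \<in> carrier (tensor K A B)"
  shows "u \<otimes>\<^bsub>T\<^esub> copair K T x y X = copair K T x' y' X \<otimes>\<^bsub>T\<^esub> u"
  by (rule intertwine_tensor[OF commutingD(1-3)[OF xy] copair_hom[OF xy] copair_hom[OF xy'] u _ _ X])
    (simp_all add: copair_incl[OF xy] copair_incl[OF xy'] 1 2)

lemma (in comult_algebra) intertwine_conv:
  assumes xy: "commuting K H H T x y" and xy': "commuting K H H T x' y'" and u: "u \<in> carrier T"
    and 1: "\<And>a. a \<in> carrier H \<Longrightarrow> u \<otimes>\<^bsub>T\<^esub> x a = x' a \<otimes>\<^bsub>T\<^esub> u"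
    and 2: "\<And>b. b \<in> carrier H \<Longrightarrow> u \<otimes>\<^bsub>T\<^esub> y b = y' b \<otimes>\<^bsub>T\<^esub> u"
    and h: "h \<in> carrier H"
  shows "u \<otimes>\<^bsub>T\<^esub> conv K H T x y h = conv K H T x' y' h \<otimes>\<^bsub>T\<^esub> u"
  unfolding conv_def by (rule intertwine_copair[OF xy xy' u 1 2 comult_closed[OF h]])

context bialgebra_pair
begin

text \<open>Values of \<open>X[_, _]\<close> on components of a convolution. A separate statement is needed because
  \<open>conv_B_incl\<close> gives equality of functions only on the carrier.\<close>

lemma conv_B_copair:
  assumes pq: "commuting K B B T p q" and r: "r \<in> alg_hom K B T"
    and pr: "commuting K B B T p r" and qr: "commuting K B B T q r"
  shows "X \<in> carrier (tensor K H1 H1) \<Longrightarrow>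
      copair K T (p1 (conv K B T p q)) (p1 r) X = copair K T (conv K H1 T (p1 p) (p1 q)) (p1 r) X"
    "X \<in> carrier (tensor K H1 H1) \<Longrightarrow>
      copair K T (p1 r) (p1 (conv K B T p q)) X = copair K T (p1 r) (conv K H1 T (p1 p) (p1 q)) X"
    "X' \<in> carrier (tensor K H2 H2) \<Longrightarrow>
      copair K T (p2 (conv K B T p q)) (p2 r) X' = copair K T (conv K H2 T (p2 p) (p2 q)) (p2 r) X'"
    "X' \<in> carrier (tensor K H2 H2) \<Longrightarrow>
      copair K T (p2 r) (p2 (conv K B T p q)) X' = copair K T (p2 r) (conv K H2 T (p2 p) (p2 q)) X'"
proof -
  note c = B.conv_commuting[OF pq pr qr]
  note i = conv_B_incl[OF pq]
  show "X \<in> carrier (tensor K H1 H1) \<Longrightarrow>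
      copair K T (p1 (conv K B T p q)) (p1 r) X = copair K T (conv K H1 T (p1 p) (p1 q)) (p1 r) X"
    by (rule copair_cong[OF points(1)[OF c] _ i(1) refl])
  show "X \<in> carrier (tensor K H1 H1) \<Longrightarrow>
      copair K T (p1 r) (p1 (conv K B T p q)) X = copair K T (p1 r) (conv K H1 T (p1 p) (p1 q)) X"
    by (rule copair_cong[OF commuting_sym[OF points(1)[OF c]] _ refl i(1)])
  show "X' \<in> carrier (tensor K H2 H2) \<Longrightarrow>
      copair K T (p2 (conv K B T p q)) (p2 r) X' = copair K T (conv K H2 T (p2 p) (p2 q)) (p2 r) X'"
    by (rule copair_cong[OF points(4)[OF c] _ i(2) refl])
  show "X' \<in> carrier (tensor K H2 H2) \<Longrightarrow>
      copair K T (p2 r) (p2 (conv K B T p q)) X' = copair K T (p2 r) (conv K H2 T (p2 p) (p2 q)) X'"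
    by (rule copair_cong[OF commuting_sym[OF points(4)[OF c]] _ refl i(2)])
qed

lemma tensor_triangular:
  assumes "triangular_bialgebra K H1 R1" "triangular_bialgebra K H2 R2"
  shows "triangular_bialgebra K B (interleave K H1 H2 R1 R2)"
proof (rule B.triangular_pointsI)
  interpret R1: triangular_bialgebra K H1 R1 by fact
  interpret R2: triangular_bialgebra K H2 R2 by fact
  let ?R = "interleave K H1 H2 R1 R2"
  note Rc = R1.R_closed R2.R_closed
  show "?R \<in> carrier (tensor K B B)" by (rule interleave_closed[OF Rc])
  { fix p q assume pq: "commuting K B B (tensor K B B) p q"
    let ?T = "tensor K B B"
    interpret T: assoc_algebra K ?T by (rule B.HH)
    note qp = commuting_sym[OF pq]
    note P = point12[OF commutingD(4)[OF pq] commutingD(3)[OF pq]]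
      point12[OF commutingD(5)[OF pq] commutingD(3)[OF pq]]
    note c = points[OF pq] points[OF qp] P P[THEN commuting_sym]
    have cl: "copair K ?T (p1 p) (p1 q) R1 \<in> carrier ?T" "copair K ?T (p2 p) (p2 q) R2 \<in> carrier ?T"
      "copair K ?T (p1 q) (p1 p) R1 \<in> carrier ?T" "copair K ?T (p2 q) (p2 p) R2 \<in> carrier ?T"
      by (rule copair_closed, rule c, rule Rc)+
    have comm: "copair K ?T (p2 q) (p2 p) R2 \<otimes>\<^bsub>?T\<^esub> copair K ?T (p1 p) (p1 q) R1
        = copair K ?T (p1 p) (p1 q) R1 \<otimes>\<^bsub>?T\<^esub> copair K ?T (p2 q) (p2 p) R2"
      by (rule copair_commute; (rule c | rule Rc))
    show "copair K ?T q p ?R \<otimes>\<^bsub>?T\<^esub> copair K ?T p q ?R = \<one>\<^bsub>?T\<^esub>"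
      unfolding copair_interleave[OF pq Rc] copair_interleave[OF qp Rc]
          T.mult4_swap[OF cl(3,4,1,2) comm]
        R1.R_inv(2)[OF c(1)] R2.R_inv(2)[OF c(4)] by simp
    fix X assume X: "X \<in> carrier B"
    let ?R1 = "copair K ?T (p1 p) (p1 q) R1" and ?R2 = "copair K ?T (p2 p) (p2 q) R2"
    have comm1: "?R1 \<otimes>\<^bsub>?T\<^esub> conv K H2 ?T (p2 p) (p2 q) h = conv K H2 ?T (p2 p) (p2 q) h \<otimes>\<^bsub>?T\<^esub> ?R1"
      if "h \<in> carrier H2" for h
      unfolding conv_def by (rule copair_commute; (rule c | rule Rc H2.comult_closed that)+)
    have comm2: "?R2 \<otimes>\<^bsub>?T\<^esub> conv K H1 ?T (p1 p) (p1 q) h = conv K H1 ?T (p1 p) (p1 q) h \<otimes>\<^bsub>?T\<^esub> ?R2"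
      if "h \<in> carrier H1" for h
      unfolding conv_def by (rule copair_commute; (rule c | rule Rc H1.comult_closed that)+)
    have comm3: "?R1 \<otimes>\<^bsub>?T\<^esub> ?R2 = ?R2 \<otimes>\<^bsub>?T\<^esub> ?R1"
      by (rule copair_commute; (rule c | rule Rc))
    note ccl = alg_homD(1)[OF H1.conv_hom[OF c(1)]] alg_homD(1)[OF H2.conv_hom[OF c(4)]]
      alg_homD(1)[OF H1.conv_hom[OF c(5)]] alg_homD(1)[OF H2.conv_hom[OF c(8)]]
    show "copair K ?T p q ?R \<otimes>\<^bsub>?T\<^esub> conv K B ?T p q X = conv K B ?T q p X \<otimes>\<^bsub>?T\<^esub> copair K ?T p q ?R"
      unfolding copair_interleave[OF pq Rc] conv_B[OF pq X] conv_B[OF qp X]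
    proof (rule intertwine_copair[OF conv_B_commuting[OF pq] conv_B_commuting[OF qp]
        T.m_closed[OF cl(1,2)]
            _ _ X[unfolded B_carrier]])
      fix h assume h: "h \<in> carrier H1"
      have "?R1 \<otimes>\<^bsub>?T\<^esub> ?R2 \<otimes>\<^bsub>?T\<^esub> conv K H1 ?T (p1 p) (p1 q) h
          = ?R1 \<otimes>\<^bsub>?T\<^esub> conv K H1 ?T (p1 p) (p1 q) h \<otimes>\<^bsub>?T\<^esub> ?R2"
        using h cl ccl comm2[of h] by (simp add: T.m_assoc)
      also have "\<dots> = conv K H1 ?T (p1 q) (p1 p) h \<otimes>\<^bsub>?T\<^esub> ?R1 \<otimes>\<^bsub>?T\<^esub> ?R2"
        using R1.R_swap[OF c(1) h] by simp
      finally show "?R1 \<otimes>\<^bsub>?T\<^esub> ?R2 \<otimes>\<^bsub>?T\<^esub> conv K H1 ?T (p1 p) (p1 q) h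
        = conv K H1 ?T (p1 q) (p1 p) h \<otimes>\<^bsub>?T\<^esub> (?R1 \<otimes>\<^bsub>?T\<^esub> ?R2)"
        using h cl ccl by (simp add: T.m_assoc)
    next
      fix h assume h: "h \<in> carrier H2"
      have "?R1 \<otimes>\<^bsub>?T\<^esub> ?R2 \<otimes>\<^bsub>?T\<^esub> conv K H2 ?T (p2 p) (p2 q) h
          = ?R2 \<otimes>\<^bsub>?T\<^esub> (?R1 \<otimes>\<^bsub>?T\<^esub> conv K H2 ?T (p2 p) (p2 q) h)"
        using h cl ccl by (simp add: T.m_assoc comm3)
      also have "\<dots> = ?R2 \<otimes>\<^bsub>?T\<^esub> conv K H2 ?T (p2 p) (p2 q) h \<otimes>\<^bsub>?T\<^esub> ?R1"
        using h cl ccl comm1[of h] by (simp add: T.m_assoc)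
      also have "\<dots> = conv K H2 ?T (p2 q) (p2 p) h \<otimes>\<^bsub>?T\<^esub> (?R1 \<otimes>\<^bsub>?T\<^esub> ?R2)"
        using h cl ccl R2.R_swap[OF c(4) h] by (simp add: T.m_assoc comm3)
      finally show "?R1 \<otimes>\<^bsub>?T\<^esub> ?R2 \<otimes>\<^bsub>?T\<^esub> conv K H2 ?T (p2 p) (p2 q) h
        = conv K H2 ?T (p2 q) (p2 p) h \<otimes>\<^bsub>?T\<^esub> (?R1 \<otimes>\<^bsub>?T\<^esub> ?R2)" .
    qed }
  fix p q r
  let ?T = "tensor K B (tensor K B B)"
  assume pq: "commuting K B B ?T p q" and pr: "commuting K B B ?T p r" and qr: "commuting K B B ?T q r"
  interpret T: assoc_algebra K ?T using pq by (rule commutingD)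
  note qp = commuting_sym[OF pq] and rp = commuting_sym[OF pr] and rq = commuting_sym[OF qr]
  note P = point12[OF commutingD(4)[OF pq] commutingD(3)[OF pq]]
      point12[OF commutingD(5)[OF pq] commutingD(3)[OF pq]]
      point12[OF commutingD(5)[OF pr] commutingD(3)[OF pr]]
  note c = points[OF pq] points[OF pr] points[OF qr] points[OF qp] points[OF rp] points[OF rq] P
      P[THEN commuting_sym]
  note p_qr = commuting_sym[OF B.conv_commuting[OF qr qp rp]]
  have cl: "copair K ?T (p1 p) (p1 q) R1 \<in> carrier ?T" "copair K ?T (p2 p) (p2 q) R2 \<in> carrier ?T"
    "copair K ?T (p1 p) (p1 r) R1 \<in> carrier ?T" "copair K ?T (p2 p) (p2 r) R2 \<in> carrier ?T"
    by (rule copair_closed, rule c, rule Rc)+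
  have comm: "copair K ?T (p2 p) (p2 r) R2 \<otimes>\<^bsub>?T\<^esub> copair K ?T (p1 p) (p1 q) R1
        = copair K ?T (p1 p) (p1 q) R1 \<otimes>\<^bsub>?T\<^esub> copair K ?T (p2 p) (p2 r) R2"
    by (rule copair_commute; (rule c | rule Rc))
  show "copair K ?T p (conv K B ?T q r) ?R = copair K ?T p r ?R \<otimes>\<^bsub>?T\<^esub> copair K ?T p q ?R"
    unfolding copair_interleave[OF pq Rc] copair_interleave[OF pr Rc] copair_interleave[OF p_qr Rc]
      conv_B_copair(2)[OF qr commutingD(4)[OF pq] qp rp Rc(1)]
          conv_B_copair(4)[OF qr commutingD(4)[OF pq] qp rp Rc(2)]
      R1.R_conv_right[OF c(1,5,9)] R2.R_conv_right[OF c(4,8,12)] T.mult4_swap[OF cl(3,4,1,2) comm] ..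
qed

end

section \<open>The diagonal morphism\<close>

text \<open>The word problem behind the cocycle identity of the diagonal twist. The letters stand for \<open>A
  = R[y\<^sub>1 f\<^sub>1, x\<^sub>2 f\<^sub>2]\<close>, \<open>ry = R[z\<^sub>1 f\<^sub>1, y\<^sub>2 f\<^sub>2]\<close>, \<open>rx = R[z\<^sub>1 f\<^sub>1, x\<^sub>2 f\<^sub>2]\<close>, \<open>r' = R[z\<^sub>1 f\<^sub>1,
  (x * y)\<^sub>2 f\<^sub>2]\<close>, \<open>r'' = R[(y * z)\<^sub>1 f\<^sub>1, x\<^sub>2 f\<^sub>2]\<close>, and for the values of the two twists that
  occur on the left (\<open>f1\<close>, \<open>f2\<close>, \<open>G1\<close>, \<open>G2\<close>) and on the right (\<open>g1\<close>, \<open>g2\<close>, \<open>E1\<close>, \<open>E2\<close>) of their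
  cocycle identities.\<close>

lemma (in monoid) cocycle_word:
  assumes cl: "A \<in> carrier G" "ry \<in> carrier G" "rx \<in> carrier G" "r' \<in> carrier G" "r'' \<in> carrier G"
    "f1 \<in> carrier G" "f2 \<in> carrier G" "g1 \<in> carrier G" "g2 \<in> carrier G"
    "G1 \<in> carrier G" "G2 \<in> carrier G" "E1 \<in> carrier G" "E2 \<in> carrier G"
    and r': "f2 \<otimes> r' = ry \<otimes> rx \<otimes> f2" and r'': "g1 \<otimes> r'' = A \<otimes> rx \<otimes> g1"
    and comm: "f1 \<otimes> ry = ry \<otimes> f1" "f1 \<otimes> rx = rx \<otimes> f1" "f2 \<otimes> G1 = G1 \<otimes> f2" "A \<otimes> ry = ry \<otimes> A"
      "g2 \<otimes> A = A \<otimes> g2" "g2 \<otimes> rx = rx \<otimes> g2" "g2 \<otimes> g1 = g1 \<otimes> g2" "g2 \<otimes> E1 = E1 \<otimes> g2"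
    and coc: "f1 \<otimes> G1 = g1 \<otimes> E1" "f2 \<otimes> G2 = g2 \<otimes> E2"
  shows "(A \<otimes> (f1 \<otimes> f2)) \<otimes> (r' \<otimes> (G1 \<otimes> G2)) = (ry \<otimes> (g1 \<otimes> g2)) \<otimes> (r'' \<otimes> (E1 \<otimes> E2))"
proof -
  have "(A \<otimes> (f1 \<otimes> f2)) \<otimes> (r' \<otimes> (G1 \<otimes> G2)) = A \<otimes> f1 \<otimes> (f2 \<otimes> r') \<otimes> G1 \<otimes> G2"
    using cl by (simp add: m_assoc)
  also have "\<dots> = A \<otimes> (f1 \<otimes> ry) \<otimes> rx \<otimes> (f2 \<otimes> G1) \<otimes> G2"
    unfolding r' using cl by (simp add: m_assoc)
  also have "\<dots> = (A \<otimes> ry) \<otimes> (f1 \<otimes> rx) \<otimes> G1 \<otimes> (f2 \<otimes> G2)"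
    unfolding comm(1,3) using cl by (simp add: m_assoc)
  also have "\<dots> = ry \<otimes> A \<otimes> rx \<otimes> (f1 \<otimes> G1) \<otimes> (f2 \<otimes> G2)"
    unfolding comm(2,4) using cl by (simp add: m_assoc)
  also have "\<dots> = ry \<otimes> A \<otimes> rx \<otimes> g1 \<otimes> (E1 \<otimes> g2) \<otimes> E2"
    unfolding coc using cl by (simp add: m_assoc)
  also have "\<dots> = ry \<otimes> A \<otimes> rx \<otimes> (g1 \<otimes> g2) \<otimes> E1 \<otimes> E2"
    unfolding comm(8)[symmetric] using cl by (simp add: m_assoc)
  also have "\<dots> = ry \<otimes> A \<otimes> (rx \<otimes> g2) \<otimes> g1 \<otimes> E1 \<otimes> E2"
    unfolding comm(7)[symmetric] using cl by (simp add: m_assoc)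
  also have "\<dots> = ry \<otimes> (A \<otimes> g2) \<otimes> rx \<otimes> g1 \<otimes> E1 \<otimes> E2"
    unfolding comm(6)[symmetric] using cl by (simp add: m_assoc)
  also have "\<dots> = ry \<otimes> g2 \<otimes> (A \<otimes> rx \<otimes> g1) \<otimes> E1 \<otimes> E2"
    unfolding comm(5)[symmetric] using cl by (simp add: m_assoc)
  also have "\<dots> = ry \<otimes> (g2 \<otimes> g1) \<otimes> r'' \<otimes> E1 \<otimes> E2"
    unfolding r''[symmetric] using cl by (simp add: m_assoc)
  also have "\<dots> = (ry \<otimes> (g1 \<otimes> g2)) \<otimes> (r'' \<otimes> (E1 \<otimes> E2))"
    unfolding comm(7) using cl by (simp add: m_assoc)
  finally show ?thesis .
qed

lemma (in bialgebra) conv_assoc4: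
  assumes c: "commuting K H H T w x" "commuting K H H T w y" "commuting K H H T w z"
    "commuting K H H T x y" "commuting K H H T x z" "commuting K H H T y z" and h: "h \<in> carrier H"
  shows "conv K H T (conv K H T w x) (conv K H T y z) h = conv K H T w
      (conv K H T (conv K H T x y) z) h"
proof -
  note yz = conv_commuting[OF c(6)]
  note xyz = commuting_sym[OF conv_commuting[OF c(6) commuting_sym[OF c(4)] commuting_sym[OF c(5)]]]
  note wyz = commuting_sym[OF conv_commuting[OF c(6) commuting_sym[OF c(2)] commuting_sym[OF c(3)]]]
  have "conv K H T (conv K H T w x) (conv K H T y z) h = conv K H T w (conv K H T x (conv K H T y z)) h"
    by (rule conv_assoc[OF c(1) wyz xyz h])
  also have "\<dots> = conv K H T w (conv K H T (conv K H T x y) z) h"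
    by (rule conv_cong[OF commuting_sym[OF conv_commuting[OF xyz commuting_sym[OF c(1)]
        commuting_sym[OF wyz]]] h refl])
      (rule conv_assoc[OF c(4,5,6), symmetric])
  finally show ?thesis .
qed

text \<open>A triangular bialgebra \<open>H\<close> with bialgebra maps to twists of \<open>H1\<close> and \<open>H2\<close>. The diagonal
  morphism is \<open>(D, FF)\<close>, and \<open>a p\<close>, \<open>b p\<close> are the points of \<open>H\<close> obtained from the components of a
  point \<open>p\<close> of \<open>B\<close>.\<close>

locale twisted_span = bialgebra_pair K H1 H2 + H: triangular_bialgebra K H R
  for K (structure) and H1 and H2 and H and R +
  fixes F1 F2 f1 f2
  assumes F1: "is_twist K H1 F1" and F2: "is_twist K H2 F2"
    and f1: "f1 \<in> bialgebra_hom K H (twisted K H1 F1)"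
    and f2: "f2 \<in> bialgebra_hom K H (twisted K H2 F2)"
begin

lemmas alg = H.assoc_algebra_axioms
lemmas comalg = H.comult_algebra_axioms H1.comult_algebra_axioms H2.comult_algebra_axioms
lemmas f1_hom = twisted_homD(1)[OF comalg(1,2) H1.twist_unit[OF F1] f1]
lemmas f2_hom = twisted_homD(1)[OF comalg(1,3) H2.twist_unit[OF F2] f2]
lemmas f1_counit = twisted_homD(2)[OF comalg(1,2) H1.twist_unit[OF F1] f1]
lemmas f2_counit = twisted_homD(2)[OF comalg(1,3) H2.twist_unit[OF F2] f2]
lemmas f1_conv = twisted_homD(3)[OF comalg(1,2) H1.twist_unit[OF F1] f1]
lemmas f2_conv = twisted_homD(3)[OF comalg(1,3) H2.twist_unit[OF F2] f2]
lemmas Fc = H1.twist_closed[OF F1] H2.twist_closed[OF F2]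

abbreviation "a p \<equiv> p1 p \<circ> f1"
abbreviation "b p \<equiv> p2 p \<circ> f2"
abbreviation "D \<equiv> diagonal_map K H H1 H2 f1 f2"
abbreviation "FF \<equiv> diagonal_twist K H R H1 H2 (f1, F1) (f2, F2)"

text \<open>A component of a point of \<open>B\<close>, composed with \<open>f1\<close> or \<open>f2\<close> or not, commutes with the other
  component of that point and with both components of any point commuting with it.\<close>

lemma component_commuting:
  assumes "p \<in> alg_hom K B T" "assoc_algebra K T"
  shows "commuting K H1 H2 T (p1 p) (p2 p)" "commuting K H1 H T (p1 p) (b p)"
    "commuting K H H2 T (a p) (p2 p)" "commuting K H H T (a p) (b p)"
  using point12[OF assms] commuting_comp[OF point12[OF assms] f1_hom alg]
    commuting_sym[OF commuting_comp[OF commuting_sym[OF point12[OF assms]] f2_hom alg]]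
    commuting_comp2[OF point12[OF assms] f1_hom alg f2_hom alg] by auto

lemma components_commuting:
  assumes "commuting K B B T p q"
  shows "commuting K H1 H1 T (p1 p) (p1 q)" "commuting K H1 H2 T (p1 p) (p2 q)"
    "commuting K H2 H1 T (p2 p) (p1 q)" "commuting K H2 H2 T (p2 p) (p2 q)"
    "commuting K H H1 T (a p) (p1 q)" "commuting K H H2 T (a p) (p2 q)"
    "commuting K H H1 T (b p) (p1 q)" "commuting K H H2 T (b p) (p2 q)"
    "commuting K H1 H T (p1 p) (a q)" "commuting K H1 H T (p1 p) (b q)"
    "commuting K H2 H T (p2 p) (a q)" "commuting K H2 H T (p2 p) (b q)"
    "commuting K H H T (a p) (a q)" "commuting K H H T (a p) (b q)"
    "commuting K H H T (b p) (a q)" "commuting K H H T (b p) (b q)"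
proof -
  note c = points[OF assms] and c' = points[OF commuting_sym[OF assms]]
  show "commuting K H1 H1 T (p1 p) (p1 q)" "commuting K H1 H2 T (p1 p) (p2 q)"
    "commuting K H2 H1 T (p2 p) (p1 q)" "commuting K H2 H2 T (p2 p) (p2 q)" by (rule c)+
  show "commuting K H H1 T (a p) (p1 q)" "commuting K H H2 T (a p) (p2 q)"
    "commuting K H H1 T (b p) (p1 q)" "commuting K H H2 T (b p) (p2 q)"
    by (rule commuting_comp[OF c(1) f1_hom alg] commuting_comp[OF c(2) f1_hom alg]
      commuting_comp[OF c(3) f2_hom alg] commuting_comp[OF c(4) f2_hom alg])+
  show "commuting K H1 H T (p1 p) (a q)" "commuting K H1 H T (p1 p) (b q)"
    "commuting K H2 H T (p2 p) (a q)" "commuting K H2 H T (p2 p) (b q)"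
    by (rule commuting_sym, rule commuting_comp[OF c'(1) f1_hom alg] commuting_comp[OF c'(2) f1_hom alg]
      commuting_comp[OF c'(3) f2_hom alg] commuting_comp[OF c'(4) f2_hom alg])+
  show "commuting K H H T (a p) (a q)" "commuting K H H T (a p) (b q)"
    "commuting K H H T (b p) (a q)" "commuting K H H T (b p) (b q)"
    by (rule commuting_comp2[OF c(1) f1_hom alg f1_hom alg]
        commuting_comp2[OF c(2) f1_hom alg f2_hom alg]
      commuting_comp2[OF c(3) f2_hom alg f1_hom alg] commuting_comp2[OF c(4) f2_hom alg f2_hom alg])+
qed

lemma copair_middle_embed:
  assumes pq: "commuting K B B T p q" and Y: "Y \<in> carrier (tensor K H2 H1)"
  shows "copair K T p q (middle_embed K H1 H2 Y) = copair K T (p2 p) (p1 q) Y"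
proof -
  have "middle_embed K H1 H2 = tensor_map K B B (incl2 K H1 H2) (incl1 K H1 H2)"
    unfolding middle_embed_def same_alg_maps(1)[OF same same]
    by (simp add: incl1_def[abs_def] incl2_def[abs_def])
  then show ?thesis using copair_tensor_map[OF pq alg2 alg1 incl_B(2,1) Y] by simp
qed

lemma middle_embed_closed:
  assumes Y: "Y \<in> carrier (tensor K H2 H1)"
  shows "middle_embed K H1 H2 Y \<in> carrier (tensor K B B)"
proof -
  have "middle_embed K H1 H2 = tensor_map K B B (incl2 K H1 H2) (incl1 K H1 H2)"
    unfolding middle_embed_def same_alg_maps(1)[OF same same]
    by (simp add: incl1_def[abs_def] incl2_def[abs_def])
  then show ?thesis using alg_homD(1)[OF tensor_map_hom[OF alg2 alg1 B_algebra B_algebra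
      incl_B(2,1)] Y] by simp
qed

lemma Rinv_closed: "inv\<^bsub>tensor K H H\<^esub> R \<in> carrier (tensor K H H)"
  unfolding H.R_inverse by (rule tensor_flip_closed[OF alg alg H.R_closed])

lemma
  shows FF_closed: "FF \<in> carrier (tensor K B B)"
    and copair_FF: "commuting K B B T p q \<Longrightarrow> copair K T p q FF
      = copair K T (a q) (b p) R \<otimes>\<^bsub>T\<^esub> (copair K T (p1 p) (p1 q) F1 \<otimes>\<^bsub>T\<^esub> copair K T (p2 p) (p2 q) F2)"
proof -
  interpret BB: assoc_algebra K "tensor K B B" by (rule B.HH)
  note t = alg_homD(1)[OF tensor_map_hom[OF alg alg alg2 alg1 f2_hom f1_hom] Rinv_closed]
  have FF: "FF = middle_embed K H1 H2 (tensor_map K H2 H1 f2 f1 (inv\<^bsub>tensor K H H\<^esub> R))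
    \<otimes>\<^bsub>tensor K B B\<^esub> interleave K H1 H2 F1 F2"
    by (simp add: diagonal_twist_def BB)
  note c = middle_embed_closed[OF t] interleave_closed[OF Fc]
  show "FF \<in> carrier (tensor K B B)" unfolding FF using c by simp
  assume pq: "commuting K B B T p q"
  show "copair K T p q FF
      = copair K T (a q) (b p) R \<otimes>\<^bsub>T\<^esub> (copair K T (p1 p) (p1 q) F1 \<otimes>\<^bsub>T\<^esub> copair K T (p2 p) (p2 q) F2)"
    unfolding FF alg_homD(2)[OF copair_hom[OF pq] c] copair_middle_embed[OF pq t]
        copair_interleave[OF pq Fc]
      copair_tensor_map[OF points(3)[OF pq] alg alg f2_hom f1_hom Rinv_closed]
          H.R_inv(1)[OF components_commuting(15)[OF pq]] ..
qed

lemma FF_unit: "FF \<in> Units (tensor K B B)"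
proof -
  let ?T = "tensor K B B"
  interpret BB: assoc_algebra K ?T by (rule B.HH)
  note i = commuting_incl[OF B_algebra B_algebra]
  have "copair K ?T (incl1 K B B) (incl2 K B B) FF \<in> Units ?T"
    unfolding copair_FF[OF i]
    by (intro BB.Units_m_closed copair_Units(1)[OF commuting_sym[OF components_commuting(15)[OF i]]
        H.R_unit]
        copair_Units(1)[OF points(1)[OF i] H1.twist_unit[OF F1]]
        copair_Units(1)[OF points(4)[OF i] H2.twist_unit[OF F2]])
  then show ?thesis using copair_incl_id[OF B_algebra B_algebra FF_closed] by simp
qed

lemma FF_cocycle:
  assumes xy: "commuting K B B T x y" and xz: "commuting K B B T x z" and yz: "commuting K B B T y z"
  shows "copair K T x y FF \<otimes>\<^bsub>T\<^esub> copair K T (conv K B T x y) z FF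
    = copair K T y z FF \<otimes>\<^bsub>T\<^esub> copair K T x (conv K B T y z) FF"
proof -
  interpret T: assoc_algebra K T using xy by (rule commutingD)
  note yx = commuting_sym[OF xy] and zx = commuting_sym[OF xz] and zy = commuting_sym[OF yz]
  note P = component_commuting[OF commutingD(4)[OF xy] commutingD(3)[OF xy]]
      component_commuting[OF commutingD(5)[OF xy] commutingD(3)[OF xy]]
      component_commuting[OF commutingD(5)[OF xz] commutingD(3)[OF xz]]
  note c = components_commuting[OF xy] components_commuting[OF xz] components_commuting[OF yz]
      components_commuting[OF yx] components_commuting[OF zx] components_commuting[OF zy] P
      P[THEN commuting_sym]
  note xy_z = B.conv_commuting[OF xy xz yz] and x_yz = commuting_sym[OF B.conv_commuting[OF yz yx zx]]
  let ?R = "\<lambda>u v. copair K T u v R" and ?F1 = "\<lambda>u v. copair K T u v F1" and ?F2 =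
      "\<lambda>u v. copair K T u v F2"
  note closed = Fc H.R_closed
  have cl: "?R (a y) (b x) \<in> carrier T" "?R (a z) (b x) \<in> carrier T" "?R (a z) (b y) \<in> carrier T"
    "?F1 (p1 x) (p1 y) \<in> carrier T" "?F2 (p2 x) (p2 y) \<in> carrier T"
    "?F1 (p1 y) (p1 z) \<in> carrier T" "?F2 (p2 y) (p2 z) \<in> carrier T"
    by (rule copair_closed, rule c, rule closed)+
  let ?G1 = "?F1 (conv K H1 T (p1 x) (p1 y)) (p1 z)" and ?G2 = "?F2 (conv K H2 T (p2 x) (p2 y)) (p2 z)"
  let ?E1 = "?F1 (p1 x) (conv K H1 T (p1 y) (p1 z))" and ?E2 = "?F2 (p2 x) (conv K H2 T (p2 y) (p2 z))"
  have cc1: "commuting K H1 H1 T (conv K H1 T (p1 x) (p1 y)) (p1 z)"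
    "commuting K H1 H1 T (p1 x) (conv K H1 T (p1 y) (p1 z))"
    by (rule H1.conv_commuting commuting_sym[OF H1.conv_commuting]; rule c)+
  have cc2: "commuting K H2 H2 T (conv K H2 T (p2 x) (p2 y)) (p2 z)"
    "commuting K H2 H2 T (p2 x) (conv K H2 T (p2 y) (p2 z))"
    by (rule H2.conv_commuting commuting_sym[OF H2.conv_commuting]; rule c)+
  have cl': "?G1 \<in> carrier T" "?G2 \<in> carrier T" "?E1 \<in> carrier T" "?E2 \<in> carrier T"
    by (rule copair_closed, rule cc1 cc2, rule closed)+
  \<comment> \<open>\<open>F2\<close> turns the coproduct of \<open>H2\<close>, applied to values of \<open>f2\<close>, into the coproduct of \<open>H\<close>; then a
    hexagon identity applies. In the same way \<open>F1\<close> is used for the other side.\<close>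
  have L: "?F2 (p2 x) (p2 y) \<otimes>\<^bsub>T\<^esub> ?R (a z) (b (conv K B T x y))
      = ?R (a z) (b y) \<otimes>\<^bsub>T\<^esub> ?R (a z) (b x) \<otimes>\<^bsub>T\<^esub> ?F2 (p2 x) (p2 y)"
  proof -
    have "?F2 (p2 x) (p2 y) \<otimes>\<^bsub>T\<^esub> ?R (a z) (b (conv K B T x y))
        = ?R (a z) (conv K H T (b x) (b y)) \<otimes>\<^bsub>T\<^esub> ?F2 (p2 x) (p2 y)"
    proof (rule intertwine_copair[OF _ _ cl(5) _ _ H.R_closed])
      show "commuting K H H T (a z) (b (conv K B T x y))"
          by (rule components_commuting(14)[OF commuting_sym[OF xy_z]])
      show "commuting K H H T (a z) (conv K H T (b x) (b y))"
        by (rule commuting_sym[OF H.conv_commuting]; rule c)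
      show "?F2 (p2 x) (p2 y) \<otimes>\<^bsub>T\<^esub> a z h = a z h \<otimes>\<^bsub>T\<^esub> ?F2 (p2 x) (p2 y)" if "h \<in> carrier H" for h
        by (rule commutingD(6)[OF commuting_copair _ that]; (rule c Fc)+)
      show "?F2 (p2 x) (p2 y) \<otimes>\<^bsub>T\<^esub> b (conv K B T x y) h = conv K H T (b x) (b y) h \<otimes>\<^bsub>T\<^esub> ?F2 (p2 x)
          (p2 y)"
        if h: "h \<in> carrier H" for h
        using f2_conv[OF points(4)[OF xy] h] conv_B_incl(2)[OF xy alg_homD(1)[OF f2_hom h]] by simp
    qed
    then show ?thesis
      by (subst (asm) H.R_conv_right) (rule c | assumption)+
  qed
  have M: "?F1 (p1 y) (p1 z) \<otimes>\<^bsub>T\<^esub> ?R (a (conv K B T y z)) (b x)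
      = ?R (a y) (b x) \<otimes>\<^bsub>T\<^esub> ?R (a z) (b x) \<otimes>\<^bsub>T\<^esub> ?F1 (p1 y) (p1 z)"
  proof -
    have "?F1 (p1 y) (p1 z) \<otimes>\<^bsub>T\<^esub> ?R (a (conv K B T y z)) (b x)
        = ?R (conv K H T (a y) (a z)) (b x) \<otimes>\<^bsub>T\<^esub> ?F1 (p1 y) (p1 z)"
    proof (rule intertwine_copair[OF _ _ cl(6) _ _ H.R_closed])
      show "commuting K H H T (a (conv K B T y z)) (b x)"
          by (rule components_commuting(14)[OF commuting_sym[OF x_yz]])
      show "commuting K H H T (conv K H T (a y) (a z)) (b x)"
        by (rule H.conv_commuting; rule c)
      show "?F1 (p1 y) (p1 z) \<otimes>\<^bsub>T\<^esub> b x h = b x h \<otimes>\<^bsub>T\<^esub> ?F1 (p1 y) (p1 z)" if "h \<in> carrier H" for h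
        by (rule commutingD(6)[OF commuting_copair _ that]; (rule c Fc)+)
      show "?F1 (p1 y) (p1 z) \<otimes>\<^bsub>T\<^esub> a (conv K B T y z) h = conv K H T (a y) (a z) h \<otimes>\<^bsub>T\<^esub> ?F1 (p1 y)
          (p1 z)"
        if h: "h \<in> carrier H" for h
        using f1_conv[OF points(1)[OF yz] h] conv_B_incl(1)[OF yz alg_homD(1)[OF f1_hom h]] by simp
    qed
    then show ?thesis
      by (subst (asm) H.R_conv_left) (rule c | assumption)+
  qed
  have comm: "?F1 (p1 x) (p1 y) \<otimes>\<^bsub>T\<^esub> ?R (a z) (b y) = ?R (a z) (b y) \<otimes>\<^bsub>T\<^esub> ?F1 (p1 x) (p1 y)"
    "?F1 (p1 x) (p1 y) \<otimes>\<^bsub>T\<^esub> ?R (a z) (b x) = ?R (a z) (b x) \<otimes>\<^bsub>T\<^esub> ?F1 (p1 x) (p1 y)"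
    "?R (a y) (b x) \<otimes>\<^bsub>T\<^esub> ?R (a z) (b y) = ?R (a z) (b y) \<otimes>\<^bsub>T\<^esub> ?R (a y) (b x)"
    "?F2 (p2 y) (p2 z) \<otimes>\<^bsub>T\<^esub> ?R (a y) (b x) = ?R (a y) (b x) \<otimes>\<^bsub>T\<^esub> ?F2 (p2 y) (p2 z)"
    "?F2 (p2 y) (p2 z) \<otimes>\<^bsub>T\<^esub> ?R (a z) (b x) = ?R (a z) (b x) \<otimes>\<^bsub>T\<^esub> ?F2 (p2 y) (p2 z)"
    "?F2 (p2 y) (p2 z) \<otimes>\<^bsub>T\<^esub> ?F1 (p1 y) (p1 z) = ?F1 (p1 y) (p1 z) \<otimes>\<^bsub>T\<^esub> ?F2 (p2 y) (p2 z)"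
    by (rule copair_commute; (rule c closed)+)+
  have comm': "?F2 (p2 x) (p2 y) \<otimes>\<^bsub>T\<^esub> ?G1 = ?G1 \<otimes>\<^bsub>T\<^esub> ?F2 (p2 x) (p2 y)"
    by (rule copair_commute;
      (rule c closed cc1 | (rule commuting_sym[OF H1.conv_commuting]; rule c)))
  have comm'': "?F2 (p2 y) (p2 z) \<otimes>\<^bsub>T\<^esub> ?E1 = ?E1 \<otimes>\<^bsub>T\<^esub> ?F2 (p2 y) (p2 z)"
    by (rule copair_commute;
      (rule c closed cc1 | (rule commuting_sym[OF H1.conv_commuting]; rule c)))
  have cl'': "?R (a z) (b (conv K B T x y)) \<in> carrier T" "?R (a (conv K B T y z)) (b x) \<in> carrier T"
    by (rule copair_closed[OF components_commuting(14)[OF commuting_sym[OF xy_z]] H.R_closed]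
        copair_closed[OF components_commuting(14)[OF commuting_sym[OF x_yz]] H.R_closed])+
  show ?thesis
    unfolding copair_FF[OF xy] copair_FF[OF yz] copair_FF[OF xy_z] copair_FF[OF x_yz]
      conv_B_copair(1)[OF xy commutingD(5)[OF xz] xz yz Fc(1)]
          conv_B_copair(3)[OF xy commutingD(5)[OF xz] xz yz Fc(2)]
      conv_B_copair(2)[OF yz commutingD(4)[OF xy] yx zx Fc(1)]
          conv_B_copair(4)[OF yz commutingD(4)[OF xy] yx zx Fc(2)]
    using H1.twist_cocycle[OF F1 c(1,17,33)] H2.twist_cocycle[OF F2 c(4,20,36)]
    by (intro T.cocycle_word[OF cl(1,3,2) cl'' cl(4-7) cl' L M] comm comm' comm'')
qed

lemma FF_counit:
  "copair K B (counit_pt K B B) (\<lambda>x. x) FF = \<one>\<^bsub>B\<^esub>" "copair K B (\<lambda>x. x) (counit_pt K B B) FF = \<one>\<^bsub>B\<^esub>"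
proof -
  interpret B: assoc_algebra K B by (rule B_algebra)
  note e = B.counit_pt_commuting[OF B_algebra B_algebra alg_hom_id]
  note e' = commuting_sym[OF e]
  note cpt = counit_pt_B[OF B_algebra]
  have i: "p1 (\<lambda>x. x) \<in> alg_hom K H1 B" "p2 (\<lambda>x. x) \<in> alg_hom K H2 B"
    using incl_B by (simp_all add: comp_def)
  note ai = alg_hom_comp[OF f1_hom i(1)] alg_hom_comp[OF f2_hom i(2)]
  have bcpt: "b (counit_pt K B B) h = counit_pt K H B h" "a (counit_pt K B B) h = counit_pt K H B h"
    if h: "h \<in> carrier H" for h
    using cpt(1)[OF alg_homD(1)[OF f1_hom h]] cpt(2)[OF alg_homD(1)[OF f2_hom h]] f1_counit[OF h]
        f2_counit[OF h]
    by (simp_all add: counit_pt_def)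
  have "copair K B (a (\<lambda>x. x)) (b (counit_pt K B B)) R = \<one>\<^bsub>B\<^esub>"
    by (rule trans[OF copair_cong[OF components_commuting(14)[OF e'] H.R_closed refl bcpt(1)]
        H.R_counit(2)[OF B_algebra ai(1)]])
  moreover have "copair K B (p1 (counit_pt K B B)) (p1 (\<lambda>x. x)) F1 = \<one>\<^bsub>B\<^esub>"
    by (rule trans[OF copair_cong[OF points(1)[OF e] Fc(1) cpt(1) refl]
        H1.twist_counit(1)[OF F1 B_algebra i(1)]])
  moreover have "copair K B (p2 (counit_pt K B B)) (p2 (\<lambda>x. x)) F2 = \<one>\<^bsub>B\<^esub>"
    by (rule trans[OF copair_cong[OF points(4)[OF e] Fc(2) cpt(2) refl]
        H2.twist_counit(1)[OF F2 B_algebra i(2)]])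
  ultimately show "copair K B (counit_pt K B B) (\<lambda>x. x) FF = \<one>\<^bsub>B\<^esub>"
    unfolding copair_FF[OF e] by simp
  have "copair K B (a (counit_pt K B B)) (b (\<lambda>x. x)) R = \<one>\<^bsub>B\<^esub>"
    by (rule trans[OF copair_cong[OF components_commuting(14)[OF e] H.R_closed bcpt(2) refl]
        H.R_counit(1)[OF B_algebra ai(2)]])
  moreover have "copair K B (p1 (\<lambda>x. x)) (p1 (counit_pt K B B)) F1 = \<one>\<^bsub>B\<^esub>"
    by (rule trans[OF copair_cong[OF points(1)[OF e'] Fc(1) refl cpt(1)]
        H1.twist_counit(2)[OF F1 B_algebra i(1)]])
  moreover have "copair K B (p2 (\<lambda>x. x)) (p2 (counit_pt K B B)) F2 = \<one>\<^bsub>B\<^esub>"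
    by (rule trans[OF copair_cong[OF points(4)[OF e'] Fc(2) refl cpt(2)]
        H2.twist_counit(2)[OF F2 B_algebra i(2)]])
  ultimately show "copair K B (\<lambda>x. x) (counit_pt K B B) FF = \<one>\<^bsub>B\<^esub>"
    unfolding copair_FF[OF e'] by simp
qed

lemma FF_twist: "is_twist K B FF"
  by (rule B.is_twist_pointsI[OF FF_unit FF_cocycle FF_counit])

lemma D_point:
  assumes p: "p \<in> alg_hom K B T" and T: "assoc_algebra K T" and h: "h \<in> carrier H"
  shows "p (D h) = conv K H T (a p) (b p) h"
proof -
  note c = H.comult_closed[OF h]
  have "D h \<in> carrier B"
    unfolding diagonal_map_def B_carrier by (rule alg_homD(1)[OF
        tensor_map_hom[OF alg alg alg1 alg2 f1_hom f2_hom] c])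
  from copair_p12[OF p T this, symmetric] show ?thesis
    unfolding diagonal_map_def copair_tensor_map[OF point12[OF p T] alg alg f1_hom f2_hom c] conv_def .
qed

lemma D_hom: "D \<in> alg_hom K H B"
proof -
  have "D = tensor_map K H1 H2 f1 f2 \<circ> comult H" by (simp add: fun_eq_iff diagonal_map_def)
  then show ?thesis
    using alg_hom_comp[OF H.comult_alg_hom tensor_map_hom[OF alg alg alg1 alg2 f1_hom f2_hom]]
    by (simp add: same_alg_maps(3)[OF same_alg_refl same])
qed

lemma D_counit:
  assumes h: "h \<in> carrier H"
  shows "counit B (D h) = counit H h"
proof -
  have K: "assoc_algebra K (ground K)" by (rule ground_algebra[OF H12.field])
  note p = B.counit_alg_hom
  have pt: "counit_pt K H (ground K) h = counit H h" if "h \<in> carrier H" for h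
    using H.counit_closed[OF that] by (simp add: counit_pt_def ground_def)
  have ab: "a (counit B) h = counit_pt K H (ground K) h" "b (counit B) h = counit_pt K H (ground K) h"
    if h: "h \<in> carrier H" for h
    using h alg_homD(1)[OF f1_hom h] alg_homD(1)[OF f2_hom h] incl_B[THEN alg_homD(1)]
    by (simp_all add: pt B_counit copair_incl[OF counit_commuting] f1_counit f2_counit)
  have "counit B (D h) = conv K H (ground K) (counit_pt K H (ground K)) (counit_pt K H (ground K)) h"
    unfolding D_point[OF p K h] by (rule H.conv_cong[OF component_commuting(4)[OF p K] h ab])
  also have "\<dots> = counit H h"
    using H.conv_counit(1)[OF K H.counit_pt_hom[OF K] h] pt[OF h] by simp
  finally show ?thesis .
qed

text \<open>The twist by \<open>F1\<close> and \<open>F2\<close> turns the coproducts of \<open>H1\<close> and \<open>H2\<close> into that of \<open>H\<close>, and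
  conjugation by the R-matrix then exchanges the two inner factors.\<close>

lemma D_conv:
  assumes pq: "commuting K B B T p q" and h: "h \<in> carrier H"
  shows "copair K T p q FF \<otimes>\<^bsub>T\<^esub> conv K B T p q (D h) = conv K H T (p \<circ> D) (q \<circ> D) h \<otimes>\<^bsub>T\<^esub> copair K T
      p q FF"
proof -
  interpret T: assoc_algebra K T using pq by (rule commutingD)
  note T = commutingD(3)[OF pq]
  note qp = commuting_sym[OF pq]
  note P = component_commuting[OF commutingD(4)[OF pq] T] component_commuting[OF commutingD(5)[OF pq] T]
  note c = components_commuting[OF pq] components_commuting[OF qp] P P[THEN commuting_sym]
  let ?s = "conv K B T p q"
  let ?R = "copair K T (a q) (b p) R" and ?F1 = "copair K T (p1 p) (p1 q) F1" and ?F2 =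
      "copair K T (p2 p) (p2 q) F2"
  note closed = Fc H.R_closed
  have cl: "?R \<in> carrier T" "?F1 \<in> carrier T" "?F2 \<in> carrier T"
    by (rule copair_closed, rule c, rule closed)+
  note s = B.conv_hom[OF pq]
  note ss = component_commuting[OF s T]
  have comm: "?F1 \<otimes>\<^bsub>T\<^esub> b ?s h = b ?s h \<otimes>\<^bsub>T\<^esub> ?F1" if h: "h \<in> carrier H" for h
  proof -
    note k = alg_homD(1)[OF f2_hom h]
    show ?thesis unfolding comp_assoc[symmetric] comp_apply[of _ f2] conv_B_incl(2)[OF pq k] conv_def
      by (rule copair_commute; (rule c closed H2.comult_closed k)+)
  qed
  have comm': "?F2 \<otimes>\<^bsub>T\<^esub> a ?s h = a ?s h \<otimes>\<^bsub>T\<^esub> ?F2" if h: "h \<in> carrier H" for h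
  proof -
    note k = alg_homD(1)[OF f1_hom h]
    show ?thesis unfolding comp_assoc[symmetric] comp_apply[of _ f1] conv_B_incl(1)[OF pq k] conv_def
      by (rule copair_commute; (rule c closed H1.comult_closed k)+)
  qed
  have tw1: "?F1 \<otimes>\<^bsub>T\<^esub> a ?s h = conv K H T (a p) (a q) h \<otimes>\<^bsub>T\<^esub> ?F1" if h: "h \<in> carrier H" for h
    using f1_conv[OF points(1)[OF pq] h] conv_B_incl(1)[OF pq alg_homD(1)[OF f1_hom h]] by simp
  have tw2: "?F2 \<otimes>\<^bsub>T\<^esub> b ?s h = conv K H T (b p) (b q) h \<otimes>\<^bsub>T\<^esub> ?F2" if h: "h \<in> carrier H" for h
    using f2_conv[OF points(4)[OF pq] h] conv_B_incl(2)[OF pq alg_homD(1)[OF f2_hom h]] by simp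
  have comm3: "?F1 \<otimes>\<^bsub>T\<^esub> ?F2 = ?F2 \<otimes>\<^bsub>T\<^esub> ?F1"
    by (rule copair_commute; (rule c closed)+)
  let ?A = "conv K H T (a p) (a q)" and ?B = "conv K H T (b p) (b q)"
  have A_B: "commuting K H H T ?A ?B"
    by (rule H.conv_commuting; (rule c | rule commuting_sym[OF H.conv_commuting]; rule c))
  have hom: "a ?s \<in> alg_hom K H T" "b ?s \<in> alg_hom K H T" "?A \<in> alg_hom K H T" "?B \<in> alg_hom K H T"
    using commutingD(4,5)[OF ss(4)] commutingD(4,5)[OF A_B] by auto
  note hcl = hom[THEN alg_homD(1)]
  have "(?F1 \<otimes>\<^bsub>T\<^esub> ?F2) \<otimes>\<^bsub>T\<^esub> conv K H T (a ?s) (b ?s) h = conv K H T ?A ?B h \<otimes>\<^bsub>T\<^esub> (?F1 \<otimes>\<^bsub>T\<^esub> ?F2)"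
  proof (rule H.intertwine_conv[OF ss(4) A_B T.m_closed[OF cl(2,3)] _ _ h])
    fix h assume h: "h \<in> carrier H"
    have "(?F1 \<otimes>\<^bsub>T\<^esub> ?F2) \<otimes>\<^bsub>T\<^esub> a ?s h = ?F1 \<otimes>\<^bsub>T\<^esub> (?F2 \<otimes>\<^bsub>T\<^esub> a ?s h)"
      by (rule T.m_assoc[OF cl(2,3) hcl(1)[OF h]])
    also have "\<dots> = ?F1 \<otimes>\<^bsub>T\<^esub> a ?s h \<otimes>\<^bsub>T\<^esub> ?F2"
      unfolding comm'[OF h] by (rule T.m_assoc[OF cl(2) hcl(1)[OF h] cl(3), symmetric])
    also have "\<dots> = ?A h \<otimes>\<^bsub>T\<^esub> (?F1 \<otimes>\<^bsub>T\<^esub> ?F2)"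
      unfolding tw1[OF h] by (rule T.m_assoc[OF hcl(3)[OF h] cl(2,3)])
    finally show "(?F1 \<otimes>\<^bsub>T\<^esub> ?F2) \<otimes>\<^bsub>T\<^esub> a ?s h = ?A h \<otimes>\<^bsub>T\<^esub> (?F1 \<otimes>\<^bsub>T\<^esub> ?F2)" .
    have "(?F1 \<otimes>\<^bsub>T\<^esub> ?F2) \<otimes>\<^bsub>T\<^esub> b ?s h = ?F2 \<otimes>\<^bsub>T\<^esub> (?F1 \<otimes>\<^bsub>T\<^esub> b ?s h)"
      unfolding comm3 by (rule T.m_assoc[OF cl(3,2) hcl(2)[OF h]])
    also have "\<dots> = ?F2 \<otimes>\<^bsub>T\<^esub> b ?s h \<otimes>\<^bsub>T\<^esub> ?F1"
      unfolding comm[OF h] by (rule T.m_assoc[OF cl(3) hcl(2)[OF h] cl(2), symmetric])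
    also have "\<dots> = ?B h \<otimes>\<^bsub>T\<^esub> (?F1 \<otimes>\<^bsub>T\<^esub> ?F2)"
      unfolding tw2[OF h] comm3 by (rule T.m_assoc[OF hcl(4)[OF h] cl(3,2)])
    finally show "(?F1 \<otimes>\<^bsub>T\<^esub> ?F2) \<otimes>\<^bsub>T\<^esub> b ?s h = ?B h \<otimes>\<^bsub>T\<^esub> (?F1 \<otimes>\<^bsub>T\<^esub> ?F2)" .
  qed
  then have step1: "(?F1 \<otimes>\<^bsub>T\<^esub> ?F2) \<otimes>\<^bsub>T\<^esub> ?s (D h) = conv K H T ?A ?B h \<otimes>\<^bsub>T\<^esub> (?F1 \<otimes>\<^bsub>T\<^esub> ?F2)"
    unfolding D_point[OF s T h] .
  let ?M = "conv K H T (a q) (b p)" and ?M' = "conv K H T (b p) (a q)"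
  let ?N = "conv K H T (a p) (b p)" and ?N' = "conv K H T (a q) (b q)"
  have M: "commuting K H H T ?M (b q)" "commuting K H H T ?M' (b q)"
    by (rule H.conv_commuting; rule c)+
  have aM: "commuting K H H T (a p) (conv K H T ?M (b q))"
      "commuting K H H T (a p) (conv K H T ?M' (b q))"
    by (rule commuting_sym[OF H.conv_commuting[OF M(1)]] commuting_sym[OF H.conv_commuting[OF M(2)]];
      (rule c | rule H.conv_commuting; rule c))+
  have step2: "?R \<otimes>\<^bsub>T\<^esub> conv K H T ?A ?B h = conv K H T ?N ?N' h \<otimes>\<^bsub>T\<^esub> ?R"
  proof -
    have "?R \<otimes>\<^bsub>T\<^esub> conv K H T (a p) (conv K H T ?M (b q)) h = conv K H T (a p) (conv K H T ?M' (b q))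
        h \<otimes>\<^bsub>T\<^esub> ?R"
    proof (rule H.intertwine_conv[OF aM cl(1) _ _ h])
      fix h assume h: "h \<in> carrier H"
      show "?R \<otimes>\<^bsub>T\<^esub> a p h = a p h \<otimes>\<^bsub>T\<^esub> ?R"
        by (rule commutingD(6)[OF commuting_copair _ h]; (rule c closed)+)
      show "?R \<otimes>\<^bsub>T\<^esub> conv K H T ?M (b q) h = conv K H T ?M' (b q) h \<otimes>\<^bsub>T\<^esub> ?R"
      proof (rule H.intertwine_conv[OF M cl(1) _ _ h])
        fix h assume h: "h \<in> carrier H"
        show "?R \<otimes>\<^bsub>T\<^esub> ?M h = ?M' h \<otimes>\<^bsub>T\<^esub> ?R" by (rule H.R_swap[OF _ h]) (rule c)
        show "?R \<otimes>\<^bsub>T\<^esub> b q h = b q h \<otimes>\<^bsub>T\<^esub> ?R"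
          by (rule commutingD(6)[OF commuting_copair _ h]; (rule c closed)+)
      qed
    qed
    moreover have "conv K H T ?A ?B h = conv K H T (a p) (conv K H T ?M (b q)) h"
      "conv K H T ?N ?N' h = conv K H T (a p) (conv K H T ?M' (b q)) h"
      by (rule H.conv_assoc4[OF _ _ _ _ _ _ h]; rule c)+
    ultimately show ?thesis by simp
  qed
  have N: "commuting K H H T (p \<circ> D) (q \<circ> D)"
    by (rule commuting_comp2[OF pq D_hom alg D_hom alg])
  have D: "conv K H T (p \<circ> D) (q \<circ> D) h = conv K H T ?N ?N' h"
    by (rule H.conv_cong[OF N h]) (simp_all only: comp_apply D_point[OF commutingD(4)[OF pq] T]
        D_point[OF commutingD(5)[OF pq] T])
  have ccl: "conv K H T ?A ?B h \<in> carrier T" "conv K H T ?N ?N' h \<in> carrier T"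
    using alg_homD(1)[OF H.conv_hom[OF A_B] h] alg_homD(1)[OF H.conv_hom[OF N] h] D by simp_all
  have sD: "?s (D h) \<in> carrier T" by (rule alg_homD(1)[OF s alg_homD(1)[OF D_hom h]])
  note F12 = T.m_closed[OF cl(2,3)]
  have "copair K T p q FF \<otimes>\<^bsub>T\<^esub> ?s (D h) = ?R \<otimes>\<^bsub>T\<^esub> ((?F1 \<otimes>\<^bsub>T\<^esub> ?F2) \<otimes>\<^bsub>T\<^esub> ?s (D h))"
    unfolding copair_FF[OF pq] by (rule T.m_assoc[OF cl(1) F12 sD])
  also have "\<dots> = ?R \<otimes>\<^bsub>T\<^esub> conv K H T ?A ?B h \<otimes>\<^bsub>T\<^esub> (?F1 \<otimes>\<^bsub>T\<^esub> ?F2)"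
    unfolding step1 by (rule T.m_assoc[OF cl(1) ccl(1) F12, symmetric])
  also have "\<dots> = conv K H T (p \<circ> D) (q \<circ> D) h \<otimes>\<^bsub>T\<^esub> copair K T p q FF"
    unfolding step2 D copair_FF[OF pq] by (rule T.m_assoc[OF ccl(2) cl(1) F12])
  finally show ?thesis .
qed

lemma D_bialgebra_hom: "D \<in> bialgebra_hom K H (twisted K B FF)"
  by (rule twisted_homI[OF H.comult_algebra_axioms B.comult_algebra_axioms FF_unit D_hom D_counit
      D_conv])

text \<open>By the hexagon identities \<open>R[a p * b p, a q * b q]\<close> has four factors. The last one cancels
  against the first factor of \<open>FF[p, q]\<close>, the first one is the first factor of \<open>FF[q, p]\<close>, and the
  two in the middle turn \<open>F\<^sub>i[p\<^sub>i, q\<^sub>i]\<close> into \<open>F\<^sub>i[q\<^sub>i, p\<^sub>i] R\<^sub>i[p\<^sub>i, q\<^sub>i]\<close>.\<close>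

lemma D_triangular_hom:
  assumes T1: "triangular_bialgebra K H1 R1" and T2: "triangular_bialgebra K H2 R2"
    and t1: "f1 \<in> triangular_hom K H R (twisted K H1 F1) (twisted_R K H1 F1 R1)"
    and t2: "f2 \<in> triangular_hom K H R (twisted K H2 F2) (twisted_R K H2 F2 R2)"
  shows "D \<in> triangular_hom K H R (twisted K B FF) (twisted_R K B FF (interleave K H1 H2 R1 R2))"
proof -
  interpret R1: triangular_bialgebra K H1 R1 by fact
  interpret R2: triangular_bialgebra K H2 R2 by fact
  note Rc = R1.R_closed R2.R_closed
  note U = H1.twist_unit[OF F1] H2.twist_unit[OF F2]
  show ?thesis
  proof (rule triangular_hom_twistedI[OF H.comult_algebra_axioms B.comult_algebra_axioms FF_unit
      H.R_closed
        interleave_closed[OF Rc] D_bialgebra_hom])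
    fix p q
    let ?T = "tensor K B B"
    assume pq: "commuting K B B ?T p q"
    interpret T: assoc_algebra K ?T using pq by (rule commutingD)
    note T = commutingD(3)[OF pq]
    note qp = commuting_sym[OF pq]
    note P = component_commuting[OF commutingD(4)[OF pq] T]
        component_commuting[OF commutingD(5)[OF pq] T]
    note c = components_commuting[OF pq] components_commuting[OF qp] P P[THEN commuting_sym]
    let ?R = "\<lambda>u v. copair K ?T u v R"
    let ?F1 = "copair K ?T (p1 p) (p1 q) F1" and ?F2 = "copair K ?T (p2 p) (p2 q) F2"
    let ?F1' = "copair K ?T (p1 q) (p1 p) F1" and ?F2' = "copair K ?T (p2 q) (p2 p) F2"
    let ?R1 = "copair K ?T (p1 p) (p1 q) R1" and ?R2 = "copair K ?T (p2 p) (p2 q) R2"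
    let ?N = "conv K H ?T (a p) (b p)" and ?N' = "conv K H ?T (a q) (b q)"
    note closed = Fc Rc H.R_closed
    have cl: "?R (a p) (a q) \<in> carrier ?T" "?R (a p) (b q) \<in> carrier ?T" "?R (b p) (a q) \<in> carrier ?T"
      "?R (b p) (b q) \<in> carrier ?T" "?R (a q) (b p) \<in> carrier ?T" "?F1 \<in> carrier ?T" "?F2 \<in> carrier ?T"
      "?F1' \<in> carrier ?T" "?F2' \<in> carrier ?T" "?R1 \<in> carrier ?T" "?R2 \<in> carrier ?T"
      by (rule copair_closed, rule c, rule closed)+
    have N: "commuting K H H ?T (p \<circ> D) (q \<circ> D)"
      by (rule commuting_comp2[OF pq D_hom alg D_hom alg])
    have N': "commuting K H H ?T ?N (a q)" "commuting K H H ?T ?N (b q)"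
      by (rule H.conv_commuting; rule c)+
    have "copair K ?T (p \<circ> D) (q \<circ> D) R = ?R ?N ?N'"
      by (rule copair_cong[OF N H.R_closed])
        (simp_all only: comp_apply D_point[OF commutingD(4)[OF pq] T]
            D_point[OF commutingD(5)[OF pq] T])
    also have "\<dots> = ?R ?N (b q) \<otimes>\<^bsub>?T\<^esub> ?R ?N (a q)"
      by (rule H.R_conv_right[OF N']) (rule c)
    also have "?R ?N (b q) = ?R (a p) (b q) \<otimes>\<^bsub>?T\<^esub> ?R (b p) (b q)"
      by (rule H.R_conv_left; rule c)
    also have "?R ?N (a q) = ?R (a p) (a q) \<otimes>\<^bsub>?T\<^esub> ?R (b p) (a q)"
      by (rule H.R_conv_left; rule c)
    finally have lhs: "copair K ?T (p \<circ> D) (q \<circ> D) R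
      = (?R (a p) (b q) \<otimes>\<^bsub>?T\<^esub> ?R (b p) (b q)) \<otimes>\<^bsub>?T\<^esub> (?R (a p) (a q) \<otimes>\<^bsub>?T\<^esub> ?R (b p) (a q))" .
    have e1: "?R (a p) (a q) \<otimes>\<^bsub>?T\<^esub> ?F1 = ?F1' \<otimes>\<^bsub>?T\<^esub> ?R1"
      by (rule triangular_hom_twistedD[OF comalg(1,2) U(1) H.R_closed Rc(1) t1]) (rule c)
    have e2: "?R (b p) (b q) \<otimes>\<^bsub>?T\<^esub> ?F2 = ?F2' \<otimes>\<^bsub>?T\<^esub> ?R2"
      by (rule triangular_hom_twistedD[OF comalg(1,3) U(2) H.R_closed Rc(2) t2]) (rule c)
    have e3: "?R (b p) (a q) \<otimes>\<^bsub>?T\<^esub> ?R (a q) (b p) = \<one>\<^bsub>?T\<^esub>"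
      by (rule H.R_inv(2)) (rule c)
    have comm: "?R (b p) (b q) \<otimes>\<^bsub>?T\<^esub> ?F1' = ?F1' \<otimes>\<^bsub>?T\<^esub> ?R (b p) (b q)"
      "?R (b p) (b q) \<otimes>\<^bsub>?T\<^esub> ?R1 = ?R1 \<otimes>\<^bsub>?T\<^esub> ?R (b p) (b q)"
      "?R1 \<otimes>\<^bsub>?T\<^esub> ?F2' = ?F2' \<otimes>\<^bsub>?T\<^esub> ?R1"
      by (rule copair_commute; (rule c closed)+)+
    have "copair K ?T (p \<circ> D) (q \<circ> D) R \<otimes>\<^bsub>?T\<^esub> copair K ?T p q FF
      = ?R (a p) (b q) \<otimes>\<^bsub>?T\<^esub> ?R (b p) (b q) \<otimes>\<^bsub>?T\<^esub> ?R (a p) (a q) \<otimes>\<^bsub>?T\<^esub>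
        (?R (b p) (a q) \<otimes>\<^bsub>?T\<^esub> ?R (a q) (b p)) \<otimes>\<^bsub>?T\<^esub> ?F1 \<otimes>\<^bsub>?T\<^esub> ?F2"
      unfolding lhs copair_FF[OF pq] using cl by (simp add: T.m_assoc)
    also have "\<dots> = ?R (a p) (b q) \<otimes>\<^bsub>?T\<^esub> ?R (b p) (b q) \<otimes>\<^bsub>?T\<^esub> (?R (a p) (a q) \<otimes>\<^bsub>?T\<^esub> ?F1) \<otimes>\<^bsub>?T\<^esub> ?F2"
      unfolding e3 using cl by (simp add: T.m_assoc)
    also have "\<dots> = ?R (a p) (b q) \<otimes>\<^bsub>?T\<^esub> (?R (b p) (b q) \<otimes>\<^bsub>?T\<^esub> ?F1') \<otimes>\<^bsub>?T\<^esub> ?R1 \<otimes>\<^bsub>?T\<^esub> ?F2"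
      unfolding e1 using cl by (simp add: T.m_assoc)
    also have "\<dots> = ?R (a p) (b q) \<otimes>\<^bsub>?T\<^esub> ?F1' \<otimes>\<^bsub>?T\<^esub> (?R (b p) (b q) \<otimes>\<^bsub>?T\<^esub> ?R1) \<otimes>\<^bsub>?T\<^esub> ?F2"
      unfolding comm(1) using cl by (simp add: T.m_assoc)
    also have "\<dots> = ?R (a p) (b q) \<otimes>\<^bsub>?T\<^esub> ?F1' \<otimes>\<^bsub>?T\<^esub> ?R1 \<otimes>\<^bsub>?T\<^esub> (?R (b p) (b q) \<otimes>\<^bsub>?T\<^esub> ?F2)"
      unfolding comm(2) using cl by (simp add: T.m_assoc)
    also have "\<dots> = ?R (a p) (b q) \<otimes>\<^bsub>?T\<^esub> ?F1' \<otimes>\<^bsub>?T\<^esub> (?R1 \<otimes>\<^bsub>?T\<^esub> ?F2') \<otimes>\<^bsub>?T\<^esub> ?R2"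
      unfolding e2 using cl by (simp add: T.m_assoc)
    also have "\<dots> = copair K ?T q p FF \<otimes>\<^bsub>?T\<^esub> copair K ?T p q (interleave K H1 H2 R1 R2)"
      unfolding comm(3) copair_FF[OF qp] copair_interleave[OF pq Rc] using cl by (simp add: T.m_assoc)
    finally show "copair K ?T (p \<circ> D) (q \<circ> D) R \<otimes>\<^bsub>?T\<^esub> copair K ?T p q FF
      = copair K ?T q p FF \<otimes>\<^bsub>?T\<^esub> copair K ?T p q (interleave K H1 H2 R1 R2)" .
  qed
qed

end

section \<open>Invertible 1-cells\<close>

lemma (in assoc_algebra) Units_conj_swap:
  assumes u: "u \<in> Units A" and v: "v \<in> Units A" and c: "a \<in> carrier A" "b \<in> carrier A"
    and eq: "a \<otimes>\<^bsub>A\<^esub> u = v \<otimes>\<^bsub>A\<^esub> b"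
  shows "b \<otimes>\<^bsub>A\<^esub> inv\<^bsub>A\<^esub> u = inv\<^bsub>A\<^esub> v \<otimes>\<^bsub>A\<^esub> a"
proof -
  note cl = Units_closed[OF u] Units_closed[OF v] Units_inv_closed[OF u] Units_inv_closed[OF v]
  have "inv\<^bsub>A\<^esub> v \<otimes>\<^bsub>A\<^esub> a = inv\<^bsub>A\<^esub> v \<otimes>\<^bsub>A\<^esub> (a \<otimes>\<^bsub>A\<^esub> u) \<otimes>\<^bsub>A\<^esub> inv\<^bsub>A\<^esub> u"
    using u c cl by (simp add: m_assoc)
  also have "\<dots> = (inv\<^bsub>A\<^esub> v \<otimes>\<^bsub>A\<^esub> v) \<otimes>\<^bsub>A\<^esub> b \<otimes>\<^bsub>A\<^esub> inv\<^bsub>A\<^esub> u"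
    unfolding eq using c cl by (simp add: m_assoc)
  finally show ?thesis using v c cl by simp
qed

lemma alg_hom_inv_into:
  assumes f: "f \<in> alg_hom K A B" and A: "assoc_algebra K A"
      and bij: "bij_betw f (carrier A) (carrier B)"
  shows "inv_into (carrier A) f \<in> alg_hom K B A"
proof -
  interpret A: assoc_algebra K A by fact
  let ?g = "inv_into (carrier A) f"
  note f' = alg_homD[OF f]
  have g: "?g y \<in> carrier A" "f (?g y) = y" if "y \<in> carrier B" for y
    using that bij by (auto simp: bij_betw_def inv_into_into f_inv_into_f)
  have eq: "?g y = x" if "x \<in> carrier A" "f x = y" for x y
    using that bij by (auto simp: bij_betw_def inv_into_f_f)
  show ?thesis
    by (rule alg_homI) (auto intro!: eq simp: f' g)
qed

lemma onecell_triangular_hom: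
  "is_onecell K H R H' R' (f, F) \<Longrightarrow> f \<in> triangular_hom K H R (twisted K H' F) (twisted_R K H' F R')"
  by (simp add: is_onecell_def)

lemma onecell_hom:
  assumes "is_onecell K H R H' R' (f, F)"
  shows "f \<in> bialgebra_hom K H (twisted K H' F)" "f \<in> alg_hom K H H'"
proof -
  show 1: "f \<in> bialgebra_hom K H (twisted K H' F)"
    using onecell_triangular_hom[OF assms] by (simp add: triangular_hom_def)
  then show "f \<in> alg_hom K H H'"
    by (simp add: bialgebra_hom_def same_alg_maps(3)[OF same_alg_refl twisted_same])
qed

lemma invertible_onecell_bij:
  assumes "invertible_onecell K H R H' R' (f, F)"
  shows "bij_betw f (carrier H) (carrier H')"
proof -
  from assms obtain g G where f: "is_onecell K H R H' R' (f, F)" and g: "is_onecell K H' R' H R (g, G)"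
    and gf: "onecell_eq H (onecell_comp K H (g, G) (f, F)) (onecell_id K H)"
    and fg: "onecell_eq H' (onecell_comp K H' (f, F) (g, G)) (onecell_id K H')"
    unfolding invertible_onecell_def by auto
  show ?thesis
    by (rule bij_betwI[of _ _ _ g])
      (use gf fg alg_homD(1)[OF onecell_hom(2)[OF f]] alg_homD(1)[OF onecell_hom(2)[OF g]]
       in \<open>auto simp: onecell_eq_def onecell_comp_def onecell_id_def\<close>)
qed

text \<open>The inverse of a 1-cell \<open>(f, F)\<close> with \<open>f\<close> bijective is \<open>(g, (g \<otimes> g)(F\<^sup>-\<^sup>1))\<close>, where \<open>g\<close> is
  the inverse map of \<open>f\<close>.\<close>

locale bijective_onecell = H: triangular_bialgebra K H R + H': triangular_bialgebra K H' R'
  for K (structure) and H and R and H' and R' +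
  fixes f F
  assumes one: "is_onecell K H R H' R' (f, F)" and bij: "bij_betw f (carrier H) (carrier H')"
begin

lemma F: "is_twist K H' F"
  using one by (simp add: is_onecell_def)

lemmas alg = H.assoc_algebra_axioms
lemmas alg' = H'.assoc_algebra_axioms
lemmas ca = H.comult_algebra_axioms
lemmas ca' = H'.comult_algebra_axioms
lemmas U = H'.twist_unit[OF F]
lemmas Fc = H'.twist_closed[OF F]
lemmas f = onecell_hom[OF one]

text \<open>\<open>(g, G)\<close> is the inverse 1-cell.\<close>

definition "g = inv_into (carrier H) f"
definition "G = tensor_map K H H g g (inv\<^bsub>tensor K H' H'\<^esub> F)"

lemma g: "g \<in> alg_hom K H' H"
  unfolding g_def by (rule alg_hom_inv_into[OF f(2) alg bij])

lemma fg: "k \<in> carrier H' \<Longrightarrow> f (g k) = k"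
  using bij by (auto simp: g_def bij_betw_def f_inv_into_f)

lemma gf: "h \<in> carrier H \<Longrightarrow> g (f h) = h"
  using bij by (auto simp: g_def bij_betw_def inv_into_f_f)

lemmas gg = tensor_map_hom[OF alg' alg' alg alg g g]

sublocale HH': assoc_algebra K "tensor K H' H'" by (rule H'.HH)
sublocale HH: assoc_algebra K "tensor K H H" by (rule H.HH)

lemma Fi: "inv\<^bsub>tensor K H' H'\<^esub> F \<in> carrier (tensor K H' H')"
  using U by simp

lemma G_unit: "G \<in> Units (tensor K H H)"
  unfolding G_def by (rule alg_hom_Units(1)[OF gg H'.HH H.HH]) (use U in simp)

lemma comp:
  assumes "commuting K H H T x y"
  shows "commuting K H' H' T (x \<circ> g) (y \<circ> g)"
  by (rule commuting_comp2[OF assms g alg' g alg'])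

lemma copair_G: "commuting K H H T x y \<Longrightarrow> copair K T x y G = inv\<^bsub>T\<^esub> (copair K T (x \<circ> g) (y \<circ> g) F)"
  unfolding G_def by (simp add: copair_tensor_map[OF _ alg' alg' g g Fi] copair_Units(2)[OF comp U])

lemma unit_F: "commuting K H H T x y \<Longrightarrow> copair K T (x \<circ> g) (y \<circ> g) F \<in> Units T"
  by (rule copair_Units(1)[OF comp U])

lemma gcomp: "h \<in> carrier H \<Longrightarrow> (x \<circ> g \<circ> f) h = x h"
  by (simp add: gf)

lemma conv_g:
  assumes xy: "commuting K H H T x y" and k: "k \<in> carrier H'"
  shows "copair K T (x \<circ> g) (y \<circ> g) F \<otimes>\<^bsub>T\<^esub> conv K H' T (x \<circ> g) (y \<circ> g) k
    = conv K H T x y (g k) \<otimes>\<^bsub>T\<^esub> copair K T (x \<circ> g) (y \<circ> g) F"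
proof -
  note h = alg_homD(1)[OF g k]
  have "conv K H T (x \<circ> g \<circ> f) (y \<circ> g \<circ> f) (g k) = conv K H T x y (g k)"
    by (rule H.conv_cong[OF commuting_comp2[OF comp[OF xy] f(2) alg f(2) alg] h gcomp gcomp])
  then show ?thesis
    using twisted_homD(3)[OF ca ca' U f(1) comp[OF xy] h] by (simp add: fg[OF k])
qed

lemma G_cocycle:
  assumes xy: "commuting K H H T x y" and xz: "commuting K H H T x z" and yz: "commuting K H H T y z"
  shows "copair K T x y G \<otimes>\<^bsub>T\<^esub> copair K T (conv K H T x y) z G
    = copair K T y z G \<otimes>\<^bsub>T\<^esub> copair K T x (conv K H T y z) G"
proof -
  interpret T: assoc_algebra K T using xy by (rule commutingD)
  note c = comp[OF xy] comp[OF xz] comp[OF yz]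
  note c' = c[THEN commuting_sym]
  note xy_z = H.conv_commuting[OF xy xz yz]
    and x_yz = commuting_sym[OF H.conv_commuting[OF yz commuting_sym[OF xy] commuting_sym[OF xz]]]
  let ?u = "copair K T (x \<circ> g) (y \<circ> g) F" and ?W = "copair K T (conv K H' T (x \<circ> g) (y \<circ> g)) (z \<circ> g) F"
  let ?v = "copair K T (y \<circ> g) (z \<circ> g) F" and ?V = "copair K T (x \<circ> g) (conv K H' T (y \<circ> g) (z \<circ> g)) F"
  let ?E = "copair K T (conv K H T x y \<circ> g) (z \<circ> g) F" and ?E' =
      "copair K T (x \<circ> g) (conv K H T y z \<circ> g) F"
  note un = unit_F[OF xy] unit_F[OF yz] unit_F[OF xy_z] unit_F[OF x_yz]
  have uW: "?u \<otimes>\<^bsub>T\<^esub> ?W = ?E \<otimes>\<^bsub>T\<^esub> ?u"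
  proof (rule intertwine_copair[OF H'.conv_commuting[OF c] comp[OF xy_z] T.Units_closed[OF un(1)] _
      _ Fc])
    show "?u \<otimes>\<^bsub>T\<^esub> conv K H' T (x \<circ> g) (y \<circ> g) k = (conv K H T x y \<circ> g) k \<otimes>\<^bsub>T\<^esub> ?u"
        if "k \<in> carrier H'" for k
      using conv_g[OF xy that] by simp
    show "?u \<otimes>\<^bsub>T\<^esub> (z \<circ> g) k = (z \<circ> g) k \<otimes>\<^bsub>T\<^esub> ?u" if "k \<in> carrier H'" for k
      by (rule commutingD(6)[OF commuting_copair[OF c] Fc that])
  qed
  have vV: "?v \<otimes>\<^bsub>T\<^esub> ?V = ?E' \<otimes>\<^bsub>T\<^esub> ?v"
  proof (rule intertwine_copair[OF commuting_sym[OF H'.conv_commuting[OF c(3) c'(1,2)]]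
      comp[OF x_yz] T.Units_closed[OF un(2)] _ _ Fc])
    show "?v \<otimes>\<^bsub>T\<^esub> conv K H' T (y \<circ> g) (z \<circ> g) k = (conv K H T y z \<circ> g) k \<otimes>\<^bsub>T\<^esub> ?v"
        if "k \<in> carrier H'" for k
      using conv_g[OF yz that] by simp
    show "?v \<otimes>\<^bsub>T\<^esub> (x \<circ> g) k = (x \<circ> g) k \<otimes>\<^bsub>T\<^esub> ?v" if "k \<in> carrier H'" for k
      by (rule commutingD(6)[OF commuting_copair[OF c(3) c'(1,2)] Fc that])
  qed
  have "?E \<otimes>\<^bsub>T\<^esub> ?u = ?E' \<otimes>\<^bsub>T\<^esub> ?v"
    using H'.twist_cocycle[OF F c] uW vV by simp
  then have "inv\<^bsub>T\<^esub> (?E \<otimes>\<^bsub>T\<^esub> ?u) = inv\<^bsub>T\<^esub> (?E' \<otimes>\<^bsub>T\<^esub> ?v)" by simp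
  then show ?thesis
    unfolding copair_G[OF xy] copair_G[OF yz] copair_G[OF xy_z] copair_G[OF x_yz]
      T.Units_inv_mult[OF un(3,1)] T.Units_inv_mult[OF un(4,2)] .
qed

lemma counit_g: "k \<in> carrier H' \<Longrightarrow> counit H (g k) = counit H' k"
  using twisted_homD(2)[OF ca ca' U f(1), of "g k"] alg_homD(1)[OF g] fg by simp

lemma G_counit:
  "copair K H (counit_pt K H H) (\<lambda>x. x) G = \<one>\<^bsub>H\<^esub>" "copair K H (\<lambda>x. x) (counit_pt K H H) G = \<one>\<^bsub>H\<^esub>"
proof -
  note e = H.counit_pt_commuting[OF alg alg alg_hom_id]
  note e' = commuting_sym[OF e]
  have cg: "(counit_pt K H H \<circ> g) k = counit_pt K H' H k" if "k \<in> carrier H'" for k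
    using that by (simp add: counit_pt_def counit_g)
  have ig: "(\<lambda>x. x) \<circ> g \<in> alg_hom K H' H" using g by (simp add: comp_def)
  have one: "inv\<^bsub>H\<^esub> \<one>\<^bsub>H\<^esub> = \<one>\<^bsub>H\<^esub>" by simp
  have "copair K H (counit_pt K H H \<circ> g) ((\<lambda>x. x) \<circ> g) F = \<one>\<^bsub>H\<^esub>"
    by (rule trans[OF copair_cong[OF comp[OF e] Fc cg refl] H'.twist_counit(1)[OF F alg ig]])
  then show "copair K H (counit_pt K H H) (\<lambda>x. x) G = \<one>\<^bsub>H\<^esub>"
    unfolding copair_G[OF e] by (simp only: one)
  have "copair K H ((\<lambda>x. x) \<circ> g) (counit_pt K H H \<circ> g) F = \<one>\<^bsub>H\<^esub>"
    by (rule trans[OF copair_cong[OF comp[OF e'] Fc refl cg] H'.twist_counit(2)[OF F alg ig]])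
  then show "copair K H (\<lambda>x. x) (counit_pt K H H) G = \<one>\<^bsub>H\<^esub>"
    unfolding copair_G[OF e'] by (simp only: one)
qed

lemma G_twist: "is_twist K H G"
  by (rule H.is_twist_pointsI[OF G_unit G_cocycle G_counit])

lemma g_bialgebra_hom: "g \<in> bialgebra_hom K H' (twisted K H G)"
proof (rule twisted_homI[OF ca' ca G_unit g counit_g])
  fix x y k assume xy: "commuting K H H (tensor K H H) x y" and k: "k \<in> carrier H'"
  note u = unit_F[OF xy]
  show "copair K (tensor K H H) x y G \<otimes>\<^bsub>tensor K H H\<^esub> conv K H (tensor K H H) x y (g k)
    = conv K H' (tensor K H H) (x \<circ> g) (y \<circ> g) k \<otimes>\<^bsub>tensor K H H\<^esub> copair K (tensor K H H) x y G"
    unfolding copair_G[OF xy]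
    by (rule HH.Units_conj_swap[OF u u alg_homD(1)[OF H.conv_hom[OF xy] alg_homD(1)[OF g k]]
          alg_homD(1)[OF H'.conv_hom[OF comp[OF xy]] k] conv_g[OF xy k, symmetric], symmetric])
qed

lemma g_triangular_hom: "g \<in> triangular_hom K H' R' (twisted K H G) (twisted_R K H G R)"
proof (rule triangular_hom_twistedI[OF ca' ca G_unit H'.R_closed H.R_closed g_bialgebra_hom])
  fix x y assume xy: "commuting K H H (tensor K H H) x y"
  let ?T = "tensor K H H"
  note c = comp[OF xy]
  have "copair K ?T (x \<circ> g \<circ> f) (y \<circ> g \<circ> f) R = copair K ?T x y R"
    by (rule copair_cong[OF commuting_comp2[OF c f(2) alg f(2) alg] H.R_closed gcomp gcomp])
  then have "copair K ?T x y R \<otimes>\<^bsub>?T\<^esub> copair K ?T (x \<circ> g) (y \<circ> g) F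
    = copair K ?T (y \<circ> g) (x \<circ> g) F \<otimes>\<^bsub>?T\<^esub> copair K ?T (x \<circ> g) (y \<circ> g) R'"
    using triangular_hom_twistedD[OF ca ca' U H.R_closed H'.R_closed onecell_triangular_hom[OF one]
        c] by simp
  then show "copair K ?T (x \<circ> g) (y \<circ> g) R' \<otimes>\<^bsub>?T\<^esub> copair K ?T x y G = copair K ?T y x G \<otimes>\<^bsub>?T\<^esub> copair
      K ?T x y R"
    unfolding copair_G[OF xy] copair_G[OF commuting_sym[OF xy]]
    by (rule HH.Units_conj_swap[OF unit_F[OF xy] unit_F[OF commuting_sym[OF xy]]
      copair_closed[OF xy H.R_closed] copair_closed[OF c H'.R_closed]])
qed

lemma invertible: "invertible_onecell K H R H' R' (f, F)"
proof -
  have g1: "is_onecell K H' R' H R (g, G)"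
    using G_twist g_triangular_hom
    by (simp add: is_onecell_def H.triangular_bialgebra_axioms H'.triangular_bialgebra_axioms)
  have "tensor_map K H H g g F \<otimes>\<^bsub>tensor K H H\<^esub> G = tensor_map K H H g g
      (F \<otimes>\<^bsub>tensor K H' H'\<^esub> inv\<^bsub>tensor K H' H'\<^esub> F)"
    unfolding G_def by (rule alg_homD(2)[OF gg Fc Fi, symmetric])
  also have "\<dots> = \<one>\<^bsub>tensor K H H\<^esub>"
    using U alg_homD(4)[OF gg] by simp
  finally have 1: "onecell_eq H (onecell_comp K H (g, G) (f, F)) (onecell_id K H)"
    by (simp add: onecell_eq_def onecell_comp_def onecell_id_def gf tensor_simps(5))
  note i = commuting_incl[OF alg' alg']
  have "tensor_map K H' H' f f G = copair K (tensor K H' H') (incl1 K H' H' \<circ> f) (incl2 K H' H' \<circ> f) G"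
    by (rule tensor_map_eq_copair[OF alg alg alg' alg' f(2) f(2) HH.Units_closed[OF G_unit]])
  also have "\<dots> = copair K (tensor K H' H') (incl1 K H' H' \<circ> f \<circ> g) (incl2 K H' H' \<circ> f \<circ> g)
      (inv\<^bsub>tensor K H' H'\<^esub> F)"
    unfolding G_def
    by (rule copair_tensor_map[OF commuting_comp2[OF i f(2) alg f(2) alg] alg' alg' g g Fi])
  also have "\<dots> = copair K (tensor K H' H') (incl1 K H' H') (incl2 K H' H') (inv\<^bsub>tensor K H' H'\<^esub> F)"
    by (rule copair_cong[OF i Fi, symmetric]) (simp_all add: fg)
  also have "\<dots> = inv\<^bsub>tensor K H' H'\<^esub> F" by (rule copair_incl_id[OF alg' alg' Fi])
  finally have "tensor_map K H' H' f f G \<otimes>\<^bsub>tensor K H' H'\<^esub> F = \<one>\<^bsub>tensor K H' H'\<^esub>"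
    using U by simp
  then have 2: "onecell_eq H' (onecell_comp K H' (f, F) (g, G)) (onecell_id K H')"
    by (simp add: onecell_eq_def onecell_comp_def onecell_id_def fg tensor_simps(5))
  from one g1 1 2 show ?thesis unfolding invertible_onecell_def by blast
qed

end

section \<open>Untwisting along a surjection\<close>

text \<open>A surjective bialgebra map from a triangular bialgebra to a twist of \<open>H'\<close> makes \<open>H'\<close>
  triangular: push the R-matrix forward and undo the twist.\<close>

locale untwisting = H: triangular_bialgebra K H R + H': bialgebra K H'
  for K (structure) and H and R and H' +
  fixes f F
  assumes F: "is_twist K H' F" and f: "f \<in> bialgebra_hom K H (twisted K H' F)"
    and surj: "f ` carrier H = carrier H'"
begin

lemmas alg = H.assoc_algebra_axioms
lemmas alg' = H'.assoc_algebra_axioms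
lemmas ca = H.comult_algebra_axioms
lemmas ca' = H'.comult_algebra_axioms
lemmas U = H'.twist_unit[OF F]
lemmas Fc = H'.twist_closed[OF F]
lemmas f_hom = twisted_homD(1)[OF ca ca' U f]
lemmas f_conv = twisted_homD(3)[OF ca ca' U f]

text \<open>The solution of \<open>F[y, x] R'[x, y] = R[x f, y f] F[x, y]\<close>.\<close>

definition "R' = inv\<^bsub>tensor K H' H'\<^esub> (tensor_flip K H' H' F) \<otimes>\<^bsub>tensor K H' H'\<^esub>
  (tensor_map K H' H' f f R \<otimes>\<^bsub>tensor K H' H'\<^esub> F)"

lemma
  shows R'_closed: "R' \<in> carrier (tensor K H' H')"
    and f_triangular_hom: "f \<in> triangular_hom K H R (twisted K H' F) (twisted_R K H' F R')"
proof -
  interpret HH': assoc_algebra K "tensor K H' H'" by (rule H'.HH)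
  let ?ff = "tensor_map K H' H' f f R"
  have ff: "?ff \<in> carrier (tensor K H' H')" 
    by (rule alg_homD(1)[OF tensor_map_hom[OF alg alg alg' alg' f_hom f_hom] H.R_closed])
  have flU: "tensor_flip K H' H' F \<in> Units (tensor K H' H')"
    by (rule alg_hom_Units(1)[OF tensor_flip_hom[OF alg' alg'] H'.HH H'.HH U])
  show Rc: "R' \<in> carrier (tensor K H' H')" unfolding R'_def using ff Fc flU by simp
  have "tensor_flip K H' H' F \<otimes>\<^bsub>tensor K H' H'\<^esub> R' = ?ff \<otimes>\<^bsub>tensor K H' H'\<^esub> F"
    unfolding R'_def using ff Fc flU by (simp add: HH'.m_assoc[symmetric] HH'.Units_closed)
  then have "?ff = twisted_R K H' F R'"
    using twisted_R_iff[OF alg alg' U H.R_closed Rc f_hom] by simp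
  then show "f \<in> triangular_hom K H R (twisted K H' F) (twisted_R K H' F R')"
    using f by (simp add: triangular_hom_def same_alg_maps(1)[OF twisted_same twisted_same])
qed

lemmas R'_point = triangular_hom_twistedD[OF ca ca' U H.R_closed R'_closed f_triangular_hom]

lemma comp: "commuting K H' H' T x y \<Longrightarrow> commuting K H H T (x \<circ> f) (y \<circ> f)"
  by (rule commuting_comp2[OF _ f_hom alg f_hom alg])

lemma R'_inv:
  assumes xy: "commuting K H' H' T x y"
  shows "copair K T y x R' \<otimes>\<^bsub>T\<^esub> copair K T x y R' = \<one>\<^bsub>T\<^esub>"
proof -
  interpret T: assoc_algebra K T using xy by (rule commutingD)
  note yx = commuting_sym[OF xy]
  let ?r = "copair K T x y R'" and ?r' = "copair K T y x R'"
  let ?u = "copair K T x y F" and ?u' = "copair K T y x F"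
  let ?q = "copair K T (x \<circ> f) (y \<circ> f) R" and ?q' = "copair K T (y \<circ> f) (x \<circ> f) R"
  note u = copair_Units(1)[OF xy U] copair_Units(1)[OF yx U]
  note cl = copair_closed[OF xy R'_closed] copair_closed[OF yx R'_closed] T.Units_closed[OF u(1)]
      T.Units_closed[OF u(2)]
    copair_closed[OF comp[OF xy] H.R_closed] copair_closed[OF comp[OF yx] H.R_closed]
  have "?u \<otimes>\<^bsub>T\<^esub> (?r' \<otimes>\<^bsub>T\<^esub> ?r) = ?q' \<otimes>\<^bsub>T\<^esub> (?u' \<otimes>\<^bsub>T\<^esub> ?r)"
    using R'_point[OF yx] cl by (simp add: T.m_assoc[symmetric])
  also have "\<dots> = (?q' \<otimes>\<^bsub>T\<^esub> ?q) \<otimes>\<^bsub>T\<^esub> ?u"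
    using R'_point[OF xy] cl by (simp add: T.m_assoc)
  also have "\<dots> = ?u \<otimes>\<^bsub>T\<^esub> \<one>\<^bsub>T\<^esub>"
    using H.R_inv(2)[OF comp[OF xy]] cl by simp
  finally show ?thesis
    by (simp only: T.Units_l_cancel[OF u(1) T.m_closed[OF cl(2,1)] T.one_closed])
qed

lemma R'_swap:
  assumes xy: "commuting K H' H' T x y" and k: "k \<in> carrier H'"
  shows "copair K T x y R' \<otimes>\<^bsub>T\<^esub> conv K H' T x y k = conv K H' T y x k \<otimes>\<^bsub>T\<^esub> copair K T x y R'"
proof -
  interpret T: assoc_algebra K T using xy by (rule commutingD)
  note yx = commuting_sym[OF xy]
  from k surj obtain h where h: "h \<in> carrier H" "k = f h" by auto
  let ?r = "copair K T x y R'" and ?u = "copair K T x y F" and ?u' = "copair K T y x F"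
  let ?q = "copair K T (x \<circ> f) (y \<circ> f) R"
  let ?c = "conv K H' T x y k" and ?c' = "conv K H' T y x k"
  let ?d = "conv K H T (x \<circ> f) (y \<circ> f) h" and ?d' = "conv K H T (y \<circ> f) (x \<circ> f) h"
  note u = copair_Units(1)[OF xy U] copair_Units(1)[OF yx U]
  note cl = copair_closed[OF xy R'_closed] T.Units_closed[OF u(1)] T.Units_closed[OF u(2)]
    copair_closed[OF comp[OF xy] H.R_closed] alg_homD(1)[OF H'.conv_hom[OF xy] k]
        alg_homD(1)[OF H'.conv_hom[OF yx] k]
    alg_homD(1)[OF H.conv_hom[OF comp[OF xy]] h(1)] alg_homD(1)[OF H.conv_hom[OF comp[OF yx]] h(1)]
  have "?u' \<otimes>\<^bsub>T\<^esub> (?r \<otimes>\<^bsub>T\<^esub> ?c) = ?q \<otimes>\<^bsub>T\<^esub> (?u \<otimes>\<^bsub>T\<^esub> ?c)"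
    using R'_point[OF xy, symmetric] cl by (simp add: T.m_assoc[symmetric])
  also have "\<dots> = (?q \<otimes>\<^bsub>T\<^esub> ?d) \<otimes>\<^bsub>T\<^esub> ?u"
    using f_conv[OF xy h(1)] cl by (simp add: h(2) T.m_assoc)
  also have "\<dots> = ?d' \<otimes>\<^bsub>T\<^esub> (?u' \<otimes>\<^bsub>T\<^esub> ?r)"
    unfolding H.R_swap[OF comp[OF xy] h(1)] R'_point[OF xy, symmetric] using cl by (simp add: T.m_assoc)
  also have "\<dots> = ?u' \<otimes>\<^bsub>T\<^esub> (?c' \<otimes>\<^bsub>T\<^esub> ?r)"
    using f_conv[OF yx h(1), symmetric] cl by (simp add: h(2) T.m_assoc[symmetric])
  finally show ?thesis
    using T.Units_l_cancel[OF u(2)] cl by simp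
qed

text \<open>The hexagon identity holds after multiplication by the invertible element \<open>F[y, z] F[y * z,
  x]\<close>; three applications of the cocycle identity move the twists through.\<close>

lemma R'_conv_right:
  assumes xy: "commuting K H' H' T x y" and xz: "commuting K H' H' T x z"
      and yz: "commuting K H' H' T y z"
  shows "copair K T x (conv K H' T y z) R' = copair K T x z R' \<otimes>\<^bsub>T\<^esub> copair K T x y R'"
proof -
  interpret T: assoc_algebra K T using xy by (rule commutingD)
  note yx = commuting_sym[OF xy] and zx = commuting_sym[OF xz] and zy = commuting_sym[OF yz]
  note x_yz = commuting_sym[OF H'.conv_commuting[OF yz yx zx]] and yz_x = H'.conv_commuting[OF yz yx zx]
  note xy_z = H'.conv_commuting[OF xy xz yz] and yx_z = H'.conv_commuting[OF yx yz xz]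
  note y_xz = commuting_sym[OF H'.conv_commuting[OF xz xy zy]] and y_zx =
      commuting_sym[OF H'.conv_commuting[OF zx zy xy]]
  let ?F = "\<lambda>u v. copair K T u v F" and ?R' = "\<lambda>u v. copair K T u v R'"
  let ?R = "\<lambda>u v. copair K T (u \<circ> f) (v \<circ> f) R"
  let ?m = "conv K H' T"
  have cl: "?F y z \<in> carrier T" "?F (?m y z) x \<in> carrier T" "?F x (?m y z) \<in> carrier T"
      "?F x y \<in> carrier T"
    "?F (?m x y) z \<in> carrier T" "?F y x \<in> carrier T" "?F (?m y x) z \<in> carrier T" "?F x z \<in> carrier T"
    "?F y (?m x z) \<in> carrier T" "?F z x \<in> carrier T" "?F y (?m z x) \<in> carrier T"
    by (rule copair_closed[OF _ Fc]; rule xy xz yz yx zx zy x_yz yz_x xy_z yx_z y_xz y_zx)+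
  have cl': "?R' x (?m y z) \<in> carrier T" "?R' x z \<in> carrier T" "?R' x y \<in> carrier T"
    by (rule copair_closed[OF _ R'_closed]; rule xy xz x_yz)+
  have cl'': "?R x (?m y z) \<in> carrier T" "?R x z \<in> carrier T" "?R x y \<in> carrier T"
    by (rule copair_closed[OF comp H.R_closed]; rule xy xz x_yz)+
  have 1: "?F y z \<otimes>\<^bsub>T\<^esub> ?R x (?m y z) = ?R x z \<otimes>\<^bsub>T\<^esub> ?R x y \<otimes>\<^bsub>T\<^esub> ?F y z"
  proof -
    note c = commuting_sym[OF H.conv_commuting[OF comp[OF yz] comp[OF yx] comp[OF zx]]]
    have "?F y z \<otimes>\<^bsub>T\<^esub> ?R x (?m y z)
      = copair K T (x \<circ> f) (conv K H T (y \<circ> f) (z \<circ> f)) R \<otimes>\<^bsub>T\<^esub> ?F y z"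
    proof (rule intertwine_copair[OF comp[OF x_yz] c cl(1) _ _ H.R_closed])
      fix h assume h: "h \<in> carrier H"
      show "?F y z \<otimes>\<^bsub>T\<^esub> (x \<circ> f) h = (x \<circ> f) h \<otimes>\<^bsub>T\<^esub> ?F y z"
        using commutingD(6)[OF commuting_copair[OF yz yx zx] Fc alg_homD(1)[OF f_hom h]] by simp
      show "?F y z \<otimes>\<^bsub>T\<^esub> (?m y z \<circ> f) h = conv K H T (y \<circ> f) (z \<circ> f) h \<otimes>\<^bsub>T\<^esub> ?F y z"
        using f_conv[OF yz h] by simp
    qed
    then show ?thesis unfolding H.R_conv_right[OF comp[OF xy] comp[OF xz] comp[OF yz]] .
  qed
  have 2: "?R' x y \<otimes>\<^bsub>T\<^esub> ?F (?m x y) z = ?F (?m y x) z \<otimes>\<^bsub>T\<^esub> ?R' x y"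
    by (rule intertwine_copair[OF xy_z yx_z cl'(3) R'_swap[OF xy] _ Fc])
      (assumption | rule commutingD(6)[OF commuting_copair[OF xy xz yz] R'_closed])+
  have 3: "?R' x z \<otimes>\<^bsub>T\<^esub> ?F y (?m x z) = ?F y (?m z x) \<otimes>\<^bsub>T\<^esub> ?R' x z"
    by (rule intertwine_copair[OF y_xz y_zx cl'(2) _ R'_swap[OF xz] Fc])
      (assumption | rule commutingD(6)[OF commuting_copair[OF xz xy zy] R'_closed])+
  note coc = H'.twist_cocycle[OF F]
  note m = T.m_assoc
  have "(?F y z \<otimes>\<^bsub>T\<^esub> ?F (?m y z) x) \<otimes>\<^bsub>T\<^esub> ?R' x (?m y z) = ?F y z \<otimes>\<^bsub>T\<^esub>
      (?R x (?m y z) \<otimes>\<^bsub>T\<^esub> ?F x (?m y z))"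
    unfolding R'_point[OF x_yz] using cl cl' by (simp add: m)
  also have "\<dots> = ?R x z \<otimes>\<^bsub>T\<^esub> ?R x y \<otimes>\<^bsub>T\<^esub> (?F y z \<otimes>\<^bsub>T\<^esub> ?F x (?m y z))"
    using 1 cl cl'' by (simp add: m[symmetric])
  also have "\<dots> = ?R x z \<otimes>\<^bsub>T\<^esub> (?R x y \<otimes>\<^bsub>T\<^esub> ?F x y) \<otimes>\<^bsub>T\<^esub> ?F (?m x y) z"
    unfolding coc[OF xy xz yz, symmetric] using cl cl'' by (simp add: m)
  also have "\<dots> = ?R x z \<otimes>\<^bsub>T\<^esub> ?F y x \<otimes>\<^bsub>T\<^esub> (?R' x y \<otimes>\<^bsub>T\<^esub> ?F (?m x y) z)"
    unfolding R'_point[OF xy] using cl cl' cl'' by (simp add: m)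
  also have "\<dots> = ?R x z \<otimes>\<^bsub>T\<^esub> (?F y x \<otimes>\<^bsub>T\<^esub> ?F (?m y x) z) \<otimes>\<^bsub>T\<^esub> ?R' x y"
    unfolding 2 using cl cl' cl'' by (simp add: m)
  also have "\<dots> = (?R x z \<otimes>\<^bsub>T\<^esub> ?F x z) \<otimes>\<^bsub>T\<^esub> ?F y (?m x z) \<otimes>\<^bsub>T\<^esub> ?R' x y"
    unfolding coc[OF yx yz xz] using cl cl' cl'' by (simp add: m)
  also have "\<dots> = ?F z x \<otimes>\<^bsub>T\<^esub> (?R' x z \<otimes>\<^bsub>T\<^esub> ?F y (?m x z)) \<otimes>\<^bsub>T\<^esub> ?R' x y"
    unfolding R'_point[OF xz] using cl cl' by (simp add: m)
  also have "\<dots> = (?F z x \<otimes>\<^bsub>T\<^esub> ?F y (?m z x)) \<otimes>\<^bsub>T\<^esub> (?R' x z \<otimes>\<^bsub>T\<^esub> ?R' x y)"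
    unfolding 3 using cl cl' by (simp add: m)
  also have "\<dots> = (?F y z \<otimes>\<^bsub>T\<^esub> ?F (?m y z) x) \<otimes>\<^bsub>T\<^esub> (?R' x z \<otimes>\<^bsub>T\<^esub> ?R' x y)"
    unfolding coc[OF yz yx zx] ..
  finally show ?thesis
    using T.Units_l_cancel[OF T.Units_m_closed[OF copair_Units(1)[OF yz U]
        copair_Units(1)[OF yz_x U]]] cl' by simp
qed

lemma triangular: "triangular_bialgebra K H' R'"
  by (rule H'.triangular_pointsI[OF R'_closed R'_inv R'_swap R'_conv_right])

end

section \<open>Projections of a tensor product\<close>

lemma bialgebra_homD:
  assumes H: "comult_algebra K H" and H': "comult_algebra K H'" and f: "f \<in> bialgebra_hom K H H'"
  shows "f \<in> alg_hom K H H'"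
    and "\<And>h. h \<in> carrier H \<Longrightarrow> counit H' (f h) = counit H h"
    and "commuting K H' H' T x y \<Longrightarrow> h \<in> carrier H
      \<Longrightarrow> conv K H' T x y (f h) = conv K H T (x \<circ> f) (y \<circ> f) h"
proof -
  note alg = comult_algebra.axioms(1)[OF H]
  show hom: "f \<in> alg_hom K H H'" and "\<And>h. h \<in> carrier H \<Longrightarrow> counit H' (f h) = counit H h"
    using f by (simp_all add: bialgebra_hom_def)
  assume xy: "commuting K H' H' T x y" and h: "h \<in> carrier H"
  then show "conv K H' T x y (f h) = conv K H T (x \<circ> f) (y \<circ> f) h"
    using f copair_tensor_map[OF xy alg alg hom hom comult_algebra.comult_closed[OF H h]]
    by (simp add: bialgebra_hom_def conv_def)
qed

lemma bialgebra_homI: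
  assumes H: "comult_algebra K H" and H': "comult_algebra K H'" and hom: "f \<in> alg_hom K H H'"
    and counit: "\<And>h. h \<in> carrier H \<Longrightarrow> counit H' (f h) = counit H h"
    and comult: "\<And>x y h. commuting K H' H' (tensor K H' H') x y \<Longrightarrow> h \<in> carrier H
      \<Longrightarrow> conv K H' (tensor K H' H') x y (f h) = conv K H (tensor K H' H') (x \<circ> f) (y \<circ> f) h"
  shows "f \<in> bialgebra_hom K H H'"
proof -
  note alg = comult_algebra.axioms(1)[OF H] comult_algebra.axioms(1)[OF H']
  have "comult H' (f h) = tensor_map K H' H' f f (comult H h)" if h: "h \<in> carrier H" for h
    using comult[OF commuting_incl[OF alg(2,2)] h]
    unfolding conv_def tensor_map_eq_copair[OF alg(1,1,2,2) hom hom
        comult_algebra.comult_closed[OF H h], symmetric]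
      copair_incl_id[OF alg(2,2) comult_algebra.comult_closed[OF H' alg_homD(1)[OF hom h]]] .
  with hom counit show ?thesis by (simp add: bialgebra_hom_def)
qed

lemma (in bialgebra) id_bialgebra_hom: "(\<lambda>x. x) \<in> bialgebra_hom K H H"
  by (rule bialgebra_homI[OF comult_algebra_axioms comult_algebra_axioms alg_hom_id])
      (simp_all add: comp_def)

lemma (in bialgebra) counit_pt_bialgebra_hom:
  assumes "bialgebra K G"
  shows "counit_pt K H G \<in> bialgebra_hom K H G"
proof -
  interpret G: bialgebra K G by fact
  note g = G.assoc_algebra_axioms
  note e = counit_pt_hom[OF g]
  show ?thesis
  proof (rule bialgebra_homI[OF comult_algebra_axioms G.comult_algebra_axioms e])
    show "counit G (counit_pt K H G h) = counit H h" if h: "h \<in> carrier H" for h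
      using hom_counit_pt[OF G.counit_alg_hom g h] counit_closed[OF h]
          by (simp add: counit_pt_def ground_def)
    fix x y h
    let ?T = "tensor K G G"
    assume xy: "commuting K G G ?T x y" and h: "h \<in> carrier H"
    note T = commutingD(3)[OF xy]
    have "conv K G ?T x y (counit_pt K H G h) = counit_pt K H ?T h"
      by (rule hom_counit_pt[OF G.conv_hom[OF xy] g h])
    also have "\<dots> = conv K H ?T (counit_pt K H ?T) (counit_pt K H ?T) h"
      by (rule conv_counit(1)[OF T counit_pt_hom[OF T] h, symmetric])
    also have "\<dots> = conv K H ?T (x \<circ> counit_pt K H G) (y \<circ> counit_pt K H G) h"
      by (rule conv_cong[OF commuting_comp2[OF xy e assoc_algebra_axioms e assoc_algebra_axioms] h,
          symmetric])
        (simp_all add: hom_counit_pt[OF commutingD(4)[OF xy] g]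
            hom_counit_pt[OF commutingD(5)[OF xy] g])
    finally show "conv K G ?T x y (counit_pt K H G h) = conv K H ?T (x \<circ> counit_pt K H G)
        (y \<circ> counit_pt K H G) h" .
  qed
qed

text \<open>The multiplication of a bialgebra is a coalgebra map, so bialgebra maps with commuting
  images combine to a bialgebra map on the tensor product.\<close>

lemma (in bialgebra_pair) copair_bialgebra_hom:
  assumes G: "bialgebra K G" and u: "u \<in> bialgebra_hom K H1 G" and v: "v \<in> bialgebra_hom K H2 G"
    and uv: "commuting K H1 H2 G u v"
  shows "copair K G u v \<in> bialgebra_hom K B G"
proof -
  interpret G: bialgebra K G by fact
  note g = G.assoc_algebra_axioms
  note ca = H1.comult_algebra_axioms H2.comult_algebra_axioms G.comult_algebra_axioms
  note u' = bialgebra_homD[OF ca(1,3) u] and v' = bialgebra_homD[OF ca(2,3) v]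
  note w = copair_hom[OF uv, folded B_hom]
  note i = incl_B[THEN alg_homD(1)]
  show ?thesis
  proof (rule bialgebra_homI[OF B.comult_algebra_axioms ca(3) w])
    fix X assume X: "X \<in> carrier B"
    note X' = X[unfolded B_carrier]
    have "counit G (copair K G u v X) = copair K (ground K) (counit G \<circ> u) (counit G \<circ> v) X"
      by (rule hom_copair[OF uv G.counit_alg_hom ground_algebra[OF H12.field] X'])
    also have "\<dots> = copair K (ground K) (counit H1) (counit H2) X"
      by (rule copair_cong[OF commuting_hom[OF uv G.counit_alg_hom ground_algebra[OF H12.field]] X'])
        (simp_all add: u'(2) v'(2))
    finally show "counit G (copair K G u v X) = counit B X" by (simp add: B_counit X)
    fix x y
    let ?T = "tensor K G G" and ?w = "copair K G u v"
    assume xy: "commuting K G G ?T x y"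
    note c = commuting_comp2[OF xy w B_algebra w B_algebra]
    have "conv K B ?T (x \<circ> ?w) (y \<circ> ?w) X
        = copair K ?T (conv K H1 ?T (p1 (x \<circ> ?w)) (p1 (y \<circ> ?w)))
            (conv K H2 ?T (p2 (x \<circ> ?w)) (p2 (y \<circ> ?w))) X"
      by (rule conv_B[OF c X])
    also have "\<dots> = copair K ?T (conv K G ?T x y \<circ> u) (conv K G ?T x y \<circ> v) X"
    proof (rule copair_cong[OF conv_B_commuting[OF c] X'])
      fix h assume h: "h \<in> carrier H1"
      have "conv K H1 ?T (p1 (x \<circ> ?w)) (p1 (y \<circ> ?w)) h = conv K H1 ?T (x \<circ> u) (y \<circ> u) h"
        by (rule H1.conv_cong[OF points(1)[OF c] h]) (simp_all add: copair_incl[OF uv])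
      then show "conv K H1 ?T (p1 (x \<circ> ?w)) (p1 (y \<circ> ?w)) h = (conv K G ?T x y \<circ> u) h"
        using u'(3)[OF xy h] by simp
    next
      fix h assume h: "h \<in> carrier H2"
      have "conv K H2 ?T (p2 (x \<circ> ?w)) (p2 (y \<circ> ?w)) h = conv K H2 ?T (x \<circ> v) (y \<circ> v) h"
        by (rule H2.conv_cong[OF points(4)[OF c] h]) (simp_all add: copair_incl[OF uv])
      then show "conv K H2 ?T (p2 (x \<circ> ?w)) (p2 (y \<circ> ?w)) h = (conv K G ?T x y \<circ> v) h"
        using v'(3)[OF xy h] by simp
    qed
    also have "\<dots> = conv K G ?T x y (?w X)"
      by (rule hom_copair[OF uv G.conv_hom[OF xy] commutingD(3)[OF xy] X', symmetric])
    finally show "conv K G ?T x y (?w X) = conv K B ?T (x \<circ> ?w) (y \<circ> ?w) X" by simp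
  qed
qed

text \<open>A 1-cell can be composed with a morphism of triangular bialgebras, which is a 1-cell with
  trivial twist.\<close>

lemma onecell_compose_hom:
  assumes one: "is_onecell K H R H' R' (f, F)" and tri'': "triangular_bialgebra K H'' R''"
    and w: "w \<in> bialgebra_hom K H' H''"
    and wR: "\<And>x y. commuting K H'' H'' (tensor K H'' H'') x y
      \<Longrightarrow> copair K (tensor K H'' H'') (x \<circ> w) (y \<circ> w) R' = copair K (tensor K H'' H'') x y R''"
  shows "is_twist K H'' (tensor_map K H'' H'' w w F)"
    and "w \<circ> f \<in> triangular_hom K H R (twisted K H'' (tensor_map K H'' H'' w w F))
      (twisted_R K H'' (tensor_map K H'' H'' w w F) R'')"
proof -
  have tri: "triangular_bialgebra K H R" "triangular_bialgebra K H' R'" and F: "is_twist K H' F"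
    using one by (simp_all add: is_onecell_def)
  interpret H: triangular_bialgebra K H R by fact
  interpret H': triangular_bialgebra K H' R' by fact
  interpret H'': triangular_bialgebra K H'' R'' by fact
  note ca = H.comult_algebra_axioms H'.comult_algebra_axioms H''.comult_algebra_axioms
  note alg = H.assoc_algebra_axioms H'.assoc_algebra_axioms H''.assoc_algebra_axioms
  note U = H'.twist_unit[OF F] and Fc = H'.twist_closed[OF F]
  note f = onecell_hom[OF one]
  note w' = bialgebra_homD[OF ca(2,3) w]
  let ?F = "tensor_map K H'' H'' w w F"
  note ww = tensor_map_hom[OF alg(2,2,3,3) w'(1) w'(1)]
  have FU: "?F \<in> Units (tensor K H'' H'')"
    by (rule alg_hom_Units(1)[OF ww H'.HH H''.HH U])
  show "is_twist K H'' ?F"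
  proof (rule H''.is_twist_pointsI[OF FU])
    fix x y z
    let ?T = "tensor K H'' (tensor K H'' H'')"
    assume xy: "commuting K H'' H'' ?T x y" and xz: "commuting K H'' H'' ?T x z"
        and yz: "commuting K H'' H'' ?T y z"
    note xy_z = H''.conv_commuting[OF xy xz yz]
      and x_yz = commuting_sym[OF H''.conv_commuting[OF yz commuting_sym[OF xy] commuting_sym[OF xz]]]
    note pt = commuting_comp2[OF _ w'(1) alg(2) w'(1) alg(2)]
    note j = copair_tensor_map[OF _ alg(2,2) w'(1) w'(1) Fc]
    have 1: "copair K ?T (conv K H'' ?T x y \<circ> w) (z \<circ> w) F = copair K ?T
        (conv K H' ?T (x \<circ> w) (y \<circ> w)) (z \<circ> w) F"
      by (rule copair_cong[OF pt[OF xy_z] Fc]) (simp_all add: w'(3)[OF xy])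
    have 2: "copair K ?T (x \<circ> w) (conv K H'' ?T y z \<circ> w) F = copair K ?T (x \<circ> w)
        (conv K H' ?T (y \<circ> w) (z \<circ> w)) F"
      by (rule copair_cong[OF pt[OF x_yz] Fc]) (simp_all add: w'(3)[OF yz])
    show "copair K ?T x y ?F \<otimes>\<^bsub>?T\<^esub> copair K ?T (conv K H'' ?T x y) z ?F
      = copair K ?T y z ?F \<otimes>\<^bsub>?T\<^esub> copair K ?T x (conv K H'' ?T y z) ?F"
      unfolding j[OF xy] j[OF yz] j[OF xy_z] j[OF x_yz] 1 2
      by (rule H'.twist_cocycle[OF F pt[OF xy] pt[OF xz] pt[OF yz]])
  next
    note e = H''.counit_pt_commuting[OF alg(3,3) alg_hom_id] and e' =
        commuting_sym[OF H''.counit_pt_commuting[OF alg(3,3) alg_hom_id]]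
    have ce: "(counit_pt K H'' H'' \<circ> w) k = counit_pt K H' H'' k" if "k \<in> carrier H'" for k
      using that by (simp add: counit_pt_def w'(2))
    have cw: "((\<lambda>x. x) \<circ> w) = w" by (simp add: comp_def)
    show "copair K H'' (counit_pt K H'' H'') (\<lambda>x. x) ?F = \<one>\<^bsub>H''\<^esub>"
      unfolding copair_tensor_map[OF e alg(2,2) w'(1) w'(1) Fc] cw
      by (rule trans[OF copair_cong[OF commuting_comp2[OF e w'(1) alg(2) w'(1) alg(2), unfolded cw]
          Fc ce refl]
            H'.twist_counit(1)[OF F alg(3) w'(1)]])
    show "copair K H'' (\<lambda>x. x) (counit_pt K H'' H'') ?F = \<one>\<^bsub>H''\<^esub>"
      unfolding copair_tensor_map[OF e' alg(2,2) w'(1) w'(1) Fc] cw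
      by (rule trans[OF copair_cong[OF commuting_comp2[OF e' w'(1) alg(2) w'(1) alg(2), unfolded cw]
          Fc refl ce]
            H'.twist_counit(2)[OF F alg(3) w'(1)]])
  qed
  note wf = alg_hom_comp[OF f(2) w'(1)]
  have bh: "w \<circ> f \<in> bialgebra_hom K H (twisted K H'' ?F)"
  proof (rule twisted_homI[OF ca(1,3) FU wf])
    fix h assume h: "h \<in> carrier H"
    note k = alg_homD(1)[OF f(2) h]
    show "counit H'' ((w \<circ> f) h) = counit H h"
      using twisted_homD(2)[OF ca(1,2) U f(1) h] w'(2)[OF k] by simp
    fix x y
    let ?T = "tensor K H'' H''"
    assume xy: "commuting K H'' H'' ?T x y"
    show "copair K ?T x y ?F \<otimes>\<^bsub>?T\<^esub> conv K H'' ?T x y ((w \<circ> f) h)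
      = conv K H ?T (x \<circ> (w \<circ> f)) (y \<circ> (w \<circ> f)) h \<otimes>\<^bsub>?T\<^esub> copair K ?T x y ?F"
      unfolding copair_tensor_map[OF xy alg(2,2) w'(1) w'(1) Fc] comp_assoc[symmetric]
          comp_apply[of w f] w'(3)[OF xy k]
      by (rule twisted_homD(3)[OF ca(1,2) U f(1) commuting_comp2[OF xy w'(1) alg(2) w'(1) alg(2)] h])
  qed
  show "w \<circ> f \<in> triangular_hom K H R (twisted K H'' ?F) (twisted_R K H'' ?F R'')"
  proof (rule triangular_hom_twistedI[OF ca(1,3) FU H.R_closed H''.R_closed bh])
    fix x y
    let ?T = "tensor K H'' H''"
    assume xy: "commuting K H'' H'' ?T x y"
    show "copair K ?T (x \<circ> (w \<circ> f)) (y \<circ> (w \<circ> f)) R \<otimes>\<^bsub>?T\<^esub> copair K ?T x y ?F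
      = copair K ?T y x ?F \<otimes>\<^bsub>?T\<^esub> copair K ?T x y R''"
      unfolding copair_tensor_map[OF xy alg(2,2) w'(1) w'(1) Fc]
        copair_tensor_map[OF commuting_sym[OF xy] alg(2,2) w'(1) w'(1) Fc] comp_assoc[symmetric]
            wR[OF xy, symmetric]
      by (rule triangular_hom_twistedD[OF ca(1,2) U H.R_closed H'.R_closed
          onecell_triangular_hom[OF one]
            commuting_comp2[OF xy w'(1) alg(2) w'(1) alg(2)]])
  qed
qed

context bialgebra_pair
begin

text \<open>The projections \<open>Id \<otimes> \<epsilon>\<close> and \<open>\<epsilon> \<otimes> Id\<close>, as maps to \<open>H1\<close> and \<open>H2\<close>.\<close>

definition "proj1 = copair K H1 (\<lambda>x. x) (counit_pt K H2 H1)"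
definition "proj2 = copair K H2 (counit_pt K H1 H2) (\<lambda>x. x)"

lemma proj_commuting:
  "commuting K H1 H2 H1 (\<lambda>x. x) (counit_pt K H2 H1)" "commuting K H1 H2 H2 (counit_pt K H1 H2) (\<lambda>x. x)"
  using commuting_sym[OF H2.counit_pt_commuting[OF alg1 alg1 alg_hom_id]]
    H1.counit_pt_commuting[OF alg2 alg2 alg_hom_id] by auto

lemma proj_bialgebra_hom: "proj1 \<in> bialgebra_hom K B H1" "proj2 \<in> bialgebra_hom K B H2"
  unfolding proj1_def proj2_def
  by (rule copair_bialgebra_hom H1.bialgebra_axioms H2.bialgebra_axioms H1.id_bialgebra_hom
      H2.id_bialgebra_hom
    H1.counit_pt_bialgebra_hom H2.counit_pt_bialgebra_hom proj_commuting)+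

lemmas proj_hom =
  bialgebra_homD(1)[OF B.comult_algebra_axioms H1.comult_algebra_axioms proj_bialgebra_hom(1)]
  bialgebra_homD(1)[OF B.comult_algebra_axioms H2.comult_algebra_axioms proj_bialgebra_hom(2)]

lemma proj_incl:
  "h \<in> carrier H1 \<Longrightarrow> proj1 (incl1 K H1 H2 h) = h"
      "k \<in> carrier H2 \<Longrightarrow> proj1 (incl2 K H1 H2 k) = counit_pt K H2 H1 k"
  "h \<in> carrier H1 \<Longrightarrow> proj2 (incl1 K H1 H2 h) = counit_pt K H1 H2 h"
      "k \<in> carrier H2 \<Longrightarrow> proj2 (incl2 K H1 H2 k) = k"
  by (simp_all add: proj1_def proj2_def copair_incl[OF proj_commuting(1)]
      copair_incl[OF proj_commuting(2)])

lemma proj_surj: "proj1 ` carrier B = carrier H1" "proj2 ` carrier B = carrier H2"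
proof -
  note i = incl_B[THEN alg_homD(1)]
  show "proj1 ` carrier B = carrier H1"
    using alg_homD(1)[OF proj_hom(1)] proj_incl(1) i(1) by (auto simp: image_iff) (metis)
  show "proj2 ` carrier B = carrier H2"
    using alg_homD(1)[OF proj_hom(2)] proj_incl(4) i(2) by (auto simp: image_iff) (metis)
qed

lemma proj_pts:
  assumes T: "assoc_algebra K T"
  shows "x \<in> alg_hom K H1 T \<Longrightarrow> h \<in> carrier H1 \<Longrightarrow> p1 (x \<circ> proj1) h = x h"
    "x \<in> alg_hom K H1 T \<Longrightarrow> k \<in> carrier H2 \<Longrightarrow> p2 (x \<circ> proj1) k = counit_pt K H2 T k"
    "y \<in> alg_hom K H2 T \<Longrightarrow> h \<in> carrier H1 \<Longrightarrow> p1 (y \<circ> proj2) h = counit_pt K H1 T h"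
    "y \<in> alg_hom K H2 T \<Longrightarrow> k \<in> carrier H2 \<Longrightarrow> p2 (y \<circ> proj2) k = y k"
  by (simp_all add: proj_incl H1.hom_counit_pt[OF _ alg2] H2.hom_counit_pt[OF _ alg1])

lemma proj_R:
  assumes T1: "triangular_bialgebra K H1 R1" and T2: "triangular_bialgebra K H2 R2"
  shows "commuting K H1 H1 T x y
      \<Longrightarrow> copair K T (x \<circ> proj1) (y \<circ> proj1) (interleave K H1 H2 R1 R2) = copair K T x y R1"
    and "commuting K H2 H2 T x' y'
      \<Longrightarrow> copair K T (x' \<circ> proj2) (y' \<circ> proj2) (interleave K H1 H2 R1 R2) = copair K T x' y' R2"
proof -
  interpret R1: triangular_bialgebra K H1 R1 by fact
  interpret R2: triangular_bialgebra K H2 R2 by fact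
  note Rc = R1.R_closed R2.R_closed
  { assume xy: "commuting K H1 H1 T x y"
    note T = commutingD(3)[OF xy] and x = commutingD(4)[OF xy] and y = commutingD(5)[OF xy]
    interpret T: assoc_algebra K T by (rule T)
    note c = commuting_comp2[OF xy proj_hom(1) B_algebra proj_hom(1) B_algebra]
    have "copair K T (p1 (x \<circ> proj1)) (p1 (y \<circ> proj1)) R1 = copair K T x y R1"
      by (rule copair_cong[OF points(1)[OF c] Rc(1) proj_pts(1)[OF T x] proj_pts(1)[OF T y]])
    moreover have "copair K T (p2 (x \<circ> proj1)) (p2 (y \<circ> proj1)) R2 = \<one>\<^bsub>T\<^esub>"
      by (rule trans[OF copair_cong[OF points(4)[OF c] Rc(2) proj_pts(2)[OF T x] proj_pts(2)[OF T y]]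
            R2.R_counit(1)[OF T H2.counit_pt_hom[OF T]]])
    ultimately show "copair K T (x \<circ> proj1) (y \<circ> proj1) (interleave K H1 H2 R1 R2) = copair K T x y R1"
      using copair_closed[OF xy Rc(1)] by (simp only: copair_interleave[OF c Rc] T.r_one) }
  { assume xy: "commuting K H2 H2 T x' y'"
    note T = commutingD(3)[OF xy] and x = commutingD(4)[OF xy] and y = commutingD(5)[OF xy]
    interpret T: assoc_algebra K T by (rule T)
    note c = commuting_comp2[OF xy proj_hom(2) B_algebra proj_hom(2) B_algebra]
    have "copair K T (p2 (x' \<circ> proj2)) (p2 (y' \<circ> proj2)) R2 = copair K T x' y' R2"
      by (rule copair_cong[OF points(4)[OF c] Rc(2) proj_pts(4)[OF T x] proj_pts(4)[OF T y]])
    moreover have "copair K T (p1 (x' \<circ> proj2)) (p1 (y' \<circ> proj2)) R1 = \<one>\<^bsub>T\<^esub>"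
      by (rule trans[OF copair_cong[OF points(1)[OF c] Rc(1) proj_pts(3)[OF T x] proj_pts(3)[OF T y]]
            R1.R_counit(1)[OF T H1.counit_pt_hom[OF T]]])
    ultimately show "copair K T (x' \<circ> proj2) (y' \<circ> proj2) (interleave K H1 H2 R1 R2) = copair K T x'
        y' R2"
      using copair_closed[OF xy Rc(2)] by (simp only: copair_interleave[OF c Rc] T.l_one) }
qed

lemma proj_incl_commuting: "commuting K B B B (incl1 K H1 H2 \<circ> proj1) (incl2 K H1 H2 \<circ> proj2)"
proof -
  have "commuting K H1 H2 B (incl1 K H1 H2) (incl2 K H1 H2)"
    using commuting_hom[OF commuting_incl[OF alg1 alg2]
        alg_hom_id[of K "tensor K H1 H2", folded same_alg_maps(3)[OF same_alg_refl same]] B_algebra]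
    by (simp add: comp_def)
  then show ?thesis
    by (rule commuting_comp2[OF _ proj_hom(1) B_algebra proj_hom(2) B_algebra])
qed

text \<open>\<open>(proj1 \<otimes> proj2) \<Delta>\<close> is the identity of \<open>H1 \<otimes> H2\<close>.\<close>

lemma conv_proj:
  assumes X: "X \<in> carrier B"
  shows "conv K B B (incl1 K H1 H2 \<circ> proj1) (incl2 K H1 H2 \<circ> proj2) X = X"
proof -
  note c = proj_incl_commuting
  let ?i1 = "incl1 K H1 H2" and ?i2 = "incl2 K H1 H2"
  have "conv K B B (?i1 \<circ> proj1) (?i2 \<circ> proj2) X = copair K B ?i1 ?i2 X"
    unfolding conv_B[OF c X]
  proof (rule copair_cong[OF conv_B_commuting[OF c] X[unfolded B_carrier]])
    fix h assume h: "h \<in> carrier H1"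
    show "conv K H1 B (p1 (?i1 \<circ> proj1)) (p1 (?i2 \<circ> proj2)) h = ?i1 h"
      by (rule trans[OF H1.conv_cong[OF points(1)[OF c] h proj_pts(1)[OF B_algebra incl_B(1)]
          proj_pts(3)[OF B_algebra incl_B(2)]]
            H1.conv_counit(2)[OF B_algebra incl_B(1) h]])
  next
    fix h assume h: "h \<in> carrier H2"
    show "conv K H2 B (p2 (?i1 \<circ> proj1)) (p2 (?i2 \<circ> proj2)) h = ?i2 h"
      by (rule trans[OF H2.conv_cong[OF points(4)[OF c] h proj_pts(2)[OF B_algebra incl_B(1)]
          proj_pts(4)[OF B_algebra incl_B(2)]]
            H2.conv_counit(1)[OF B_algebra incl_B(2) h]])
  qed
  also have "\<dots> = X"
    using copair_incl_id[OF alg1 alg2 X[unfolded B_carrier]] by (simp add: same_alg_copair[OF same])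
  finally show "conv K B B (?i1 \<circ> proj1) (?i2 \<circ> proj2) X = X" .
qed

end

lemma (in assoc_algebra) conj_bij:
  assumes u: "u \<in> Units A" and f: "bij_betw f S (carrier A)"
    and d: "\<And>h. h \<in> S \<Longrightarrow> d h \<in> carrier A" and eq: "\<And>h. h \<in> S \<Longrightarrow> u \<otimes>\<^bsub>A\<^esub> f h = d h \<otimes>\<^bsub>A\<^esub> u"
  shows "bij_betw d S (carrier A)"
proof (rule bij_betw_imageI)
  note c = Units_closed[OF u] Units_inv_closed[OF u]
  have fc: "f h \<in> carrier A" if "h \<in> S" for h using f that by (auto simp: bij_betw_def)
  show "inj_on d S"
  proof (rule inj_onI)
    fix h k assume hk: "h \<in> S" "k \<in> S" "d h = d k"
    then have "u \<otimes>\<^bsub>A\<^esub> f h = u \<otimes>\<^bsub>A\<^esub> f k" by (simp add: eq)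
    then have "f h = f k" using u fc hk by simp
    with f hk show "h = k" by (auto simp: bij_betw_def inj_on_def)
  qed
  have "Z \<in> d ` S" if Z: "Z \<in> carrier A" for Z
  proof -
    have "inv\<^bsub>A\<^esub> u \<otimes>\<^bsub>A\<^esub> Z \<otimes>\<^bsub>A\<^esub> u \<in> carrier A" using Z c by simp
    then have "inv\<^bsub>A\<^esub> u \<otimes>\<^bsub>A\<^esub> Z \<otimes>\<^bsub>A\<^esub> u \<in> f ` S" using f by (simp add: bij_betw_def)
    then obtain h where h: "h \<in> S" "f h = inv\<^bsub>A\<^esub> u \<otimes>\<^bsub>A\<^esub> Z \<otimes>\<^bsub>A\<^esub> u" by (metis imageE)
    have "u \<otimes>\<^bsub>A\<^esub> f h = (u \<otimes>\<^bsub>A\<^esub> inv\<^bsub>A\<^esub> u) \<otimes>\<^bsub>A\<^esub> Z \<otimes>\<^bsub>A\<^esub> u"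
      unfolding h(2) using Z c by (simp only: m_assoc m_closed)
    then have "d h \<otimes>\<^bsub>A\<^esub> u = Z \<otimes>\<^bsub>A\<^esub> u" using u Z c eq[OF h(1)] by simp
    then have "d h \<otimes>\<^bsub>A\<^esub> u \<otimes>\<^bsub>A\<^esub> inv\<^bsub>A\<^esub> u = Z \<otimes>\<^bsub>A\<^esub> u \<otimes>\<^bsub>A\<^esub> inv\<^bsub>A\<^esub> u" by simp
    then have "d h = Z" using u c d[OF h(1)] Z by (simp add: m_assoc)
    with h(1) show ?thesis by blast
  qed
  with d show "d ` S = carrier A" by blast
qed

section \<open>The four characterisations\<close>

context twisted_span
begin

lemma diagonal_onecell_invertible:
  assumes T1: "triangular_bialgebra K H1 R1" and T2: "triangular_bialgebra K H2 R2"
    and t1: "f1 \<in> triangular_hom K H R (twisted K H1 F1) (twisted_R K H1 F1 R1)"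
    and t2: "f2 \<in> triangular_hom K H R (twisted K H2 F2) (twisted_R K H2 F2 R2)"
    and bij: "bij_betw D (carrier H) (carrier B)"
  shows "invertible_onecell K H R B (interleave K H1 H2 R1 R2)
    (diagonal_onecell K H R H1 H2 (f1, F1) (f2, F2))"
proof -
  have tri: "triangular_bialgebra K B (interleave K H1 H2 R1 R2)" by (rule tensor_triangular[OF T1 T2])
  have "is_onecell K H R B (interleave K H1 H2 R1 R2) (D, FF)"
    using tri FF_twist D_triangular_hom[OF T1 T2 t1 t2] H.triangular_bialgebra_axioms
        by (simp add: is_onecell_def)
  then have "invertible_onecell K H R B (interleave K H1 H2 R1 R2) (D, FF)"
    by (intro bijective_onecell.invertible bijective_onecell.intro bijective_onecell_axioms.intro
        H.triangular_bialgebra_axioms tri bij)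
  then show ?thesis by (simp add: diagonal_onecell_def)
qed

end

lemma (in bialgebra_pair) split_bijective_onecell:
  assumes T1: "triangular_bialgebra K H1 R1" and T2: "triangular_bialgebra K H2 R2"
    and one: "is_onecell K H R B (interleave K H1 H2 R1 R2) (f, F)"
    and bij: "bij_betw f (carrier H) (carrier B)"
  defines "f1 \<equiv> proj1 \<circ> f" and "F1 \<equiv> tensor_map K H1 H1 proj1 proj1 F"
    and "f2 \<equiv> proj2 \<circ> f" and "F2 \<equiv> tensor_map K H2 H2 proj2 proj2 F"
  shows "is_twist K H1 F1" "is_twist K H2 F2"
    and "f1 \<in> triangular_hom K H R (twisted K H1 F1) (twisted_R K H1 F1 R1)"
    and "f2 \<in> triangular_hom K H R (twisted K H2 F2) (twisted_R K H2 F2 R2)"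
    and "f1 ` carrier H = carrier H1" "f2 ` carrier H = carrier H2"
    and "invertible_onecell K H R B (interleave K H1 H2 R1 R2)
      (diagonal_onecell K H R H1 H2 (f1, F1) (f2, F2))"
proof -
  have tH: "triangular_bialgebra K H R" and F: "is_twist K B F" using one
      by (simp_all add: is_onecell_def)
  interpret H: triangular_bialgebra K H R by fact
  have c1: "is_twist K H1 F1" "f1 \<in> triangular_hom K H R (twisted K H1 F1) (twisted_R K H1 F1 R1)"
    unfolding F1_def f1_def
    by (rule onecell_compose_hom[OF one T1 proj_bialgebra_hom(1)], rule proj_R(1)[OF T1 T2],
        assumption)+
  have c2: "is_twist K H2 F2" "f2 \<in> triangular_hom K H R (twisted K H2 F2) (twisted_R K H2 F2 R2)"
    unfolding F2_def f2_def
    by (rule onecell_compose_hom[OF one T2 proj_bialgebra_hom(2)], rule proj_R(2)[OF T1 T2],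
        assumption)+
  show "is_twist K H1 F1" "is_twist K H2 F2"
    and "f1 \<in> triangular_hom K H R (twisted K H1 F1) (twisted_R K H1 F1 R1)"
    and "f2 \<in> triangular_hom K H R (twisted K H2 F2) (twisted_R K H2 F2 R2)"
    by (rule c1 c2)+
  have im: "f ` carrier H = carrier B" using bij by (simp add: bij_betw_def)
  show "f1 ` carrier H = carrier H1" "f2 ` carrier H = carrier H2"
    unfolding f1_def f2_def image_comp[symmetric] im by (rule proj_surj)+
  interpret span: twisted_span K H1 H2 H R F1 F2 f1 f2
    using c1 c2 by unfold_locales (auto simp: triangular_hom_def)
  let ?u = "incl1 K H1 H2 \<circ> proj1" and ?v = "incl2 K H1 H2 \<circ> proj2"
  note uv = proj_incl_commuting
  note hom = onecell_hom[OF one]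
  note ca = H.comult_algebra_axioms B.comult_algebra_axioms
  note U = B.twist_unit[OF F]
  have "bij_betw span.D (carrier H) (carrier B)"
  proof (rule assoc_algebra.conj_bij[OF B_algebra copair_Units(1)[OF uv U] bij
      alg_homD(1)[OF span.D_hom]])
    fix h assume h: "h \<in> carrier H"
    note k = alg_homD(1)[OF hom(2) h]
    have "span.D h = conv K H B (?u \<circ> f) (?v \<circ> f) h"
      using span.D_point[OF alg_hom_id B_algebra h] by (simp add: comp_def f1_def f2_def)
    then show "copair K B ?u ?v F \<otimes>\<^bsub>B\<^esub> f h = span.D h \<otimes>\<^bsub>B\<^esub> copair K B ?u ?v F"
      using twisted_homD(3)[OF ca U hom(1) uv h] conv_proj[OF k] by simp
  qed
  then show "invertible_onecell K H R B (interleave K H1 H2 R1 R2)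
      (diagonal_onecell K H R H1 H2 (f1, F1) (f2, F2))"
    by (rule span.diagonal_onecell_invertible[OF T1 T2 c1(2) c2(2)])
qed

lemma triangular_iso_onecell_iff:
  assumes "triangular_bialgebra K H R" "triangular_bialgebra K H' R'"
  shows "is_twist K H' F \<and> f \<in> triangular_iso K H R (twisted K H' F) (twisted_R K H' F R')
    \<longleftrightarrow> is_onecell K H R H' R' (f, F) \<and> bij_betw f (carrier H) (carrier H')"
  using assms by (auto simp: is_onecell_def triangular_iso_def twisted_simps)

lemma triangular_bialgebra_bialgebra: "triangular_bialgebra K H R \<Longrightarrow> bialgebra K H"
  by (simp add: triangular_bialgebra_def quasitriangular_bialgebra_def)

theorem corollary6p6:
  fixes K :: "('k, 'm) ring_scheme"
    and H :: "('k, 'h) bialgebra"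
    and R :: "('k, 'h, 'h) tens"
  assumes "triangular_bialgebra K H R"
  shows
   "let
      P1 = (\<exists>(H1 :: ('k, 'a) bialgebra) R1 (H2 :: ('k, 'b) bialgebra) R2 f F.
              triangular_bialgebra K H1 R1 \<and> triangular_bialgebra K H2 R2 \<and>
              invertible_onecell K H R (tensor_bialgebra K H1 H2) (interleave K H1 H2 R1 R2) (f, F));
      P2 = (\<exists>(H1 :: ('k, 'a) bialgebra) R1 (H2 :: ('k, 'b) bialgebra) R2 f1 F1 f2 F2.
              triangular_bialgebra K H1 R1 \<and> triangular_bialgebra K H2 R2 \<and>
              is_twist K H1 F1 \<and> is_twist K H2 F2 \<and>
              f1 \<in> triangular_hom K H R (twisted K H1 F1) (twisted_R K H1 F1 R1) \<and>
              f2 \<in> triangular_hom K H R (twisted K H2 F2) (twisted_R K H2 F2 R2) \<and>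
              f1 ` carrier H = carrier H1 \<and> f2 ` carrier H = carrier H2 \<and>
              invertible_onecell K H R (tensor_bialgebra K H1 H2) (interleave K H1 H2 R1 R2)
                (diagonal_onecell K H R H1 H2 (f1, F1) (f2, F2)));
      P3 = (\<exists>(H1 :: ('k, 'a) bialgebra) R1 (H2 :: ('k, 'b) bialgebra) R2 F f.
              triangular_bialgebra K H1 R1 \<and> triangular_bialgebra K H2 R2 \<and>
              is_twist K (tensor_bialgebra K H1 H2) F \<and>
              f \<in> triangular_iso K H R (twisted K (tensor_bialgebra K H1 H2) F)
                    (twisted_R K (tensor_bialgebra K H1 H2) F (interleave K H1 H2 R1 R2)));
      P4 = (\<exists>(H1 :: ('k, 'a) bialgebra) (H2 :: ('k, 'b) bialgebra) F1 F2 f1 f2.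
              bialgebra K H1 \<and> bialgebra K H2 \<and>
              is_twist K H1 F1 \<and> is_twist K H2 F2 \<and>
              f1 \<in> bialgebra_hom K H (twisted K H1 F1) \<and>
              f2 \<in> bialgebra_hom K H (twisted K H2 F2) \<and>
              f1 ` carrier H = carrier H1 \<and> f2 ` carrier H = carrier H2 \<and>
              diagonal_map K H H1 H2 f1 f2 \<in>
                bialgebra_iso K H (twisted K (tensor_bialgebra K H1 H2)
                  (diagonal_twist K H R H1 H2 (f1, F1) (f2, F2))))
    in (P1 \<longleftrightarrow> P2) \<and> (P2 \<longleftrightarrow> P3) \<and> (P3 \<longleftrightarrow> P4)"
proof -
  have pair: "bialgebra_pair K H1 H2" if "triangular_bialgebra K H1 R1" "triangular_bialgebra K H2 R2"
    for H1 :: "('k, 'a) bialgebra" and H2 :: "('k, 'b) bialgebra" and R1 R2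
    using that by (intro bialgebra_pair.intro triangular_bialgebra_bialgebra)
  define P1 where "P1 = (\<exists>(H1 :: ('k, 'a) bialgebra) R1 (H2 :: ('k, 'b) bialgebra) R2 f F.
              triangular_bialgebra K H1 R1 \<and> triangular_bialgebra K H2 R2 \<and>
              invertible_onecell K H R (tensor_bialgebra K H1 H2) (interleave K H1 H2 R1 R2) (f, F))"
  define P2 where "P2 = (\<exists>(H1 :: ('k, 'a) bialgebra) R1 (H2 :: ('k, 'b) bialgebra) R2 f1 F1 f2 F2.
              triangular_bialgebra K H1 R1 \<and> triangular_bialgebra K H2 R2 \<and>
              is_twist K H1 F1 \<and> is_twist K H2 F2 \<and>
              f1 \<in> triangular_hom K H R (twisted K H1 F1) (twisted_R K H1 F1 R1) \<and>
              f2 \<in> triangular_hom K H R (twisted K H2 F2) (twisted_R K H2 F2 R2) \<and>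
              f1 ` carrier H = carrier H1 \<and> f2 ` carrier H = carrier H2 \<and>
              invertible_onecell K H R (tensor_bialgebra K H1 H2) (interleave K H1 H2 R1 R2)
                (diagonal_onecell K H R H1 H2 (f1, F1) (f2, F2)))"
  define P3 where "P3 = (\<exists>(H1 :: ('k, 'a) bialgebra) R1 (H2 :: ('k, 'b) bialgebra) R2 F f.
              triangular_bialgebra K H1 R1 \<and> triangular_bialgebra K H2 R2 \<and>
              is_twist K (tensor_bialgebra K H1 H2) F \<and>
              f \<in> triangular_iso K H R (twisted K (tensor_bialgebra K H1 H2) F)
                    (twisted_R K (tensor_bialgebra K H1 H2) F (interleave K H1 H2 R1 R2)))"
  define P4 where "P4 = (\<exists>(H1 :: ('k, 'a) bialgebra) (H2 :: ('k, 'b) bialgebra) F1 F2 f1 f2.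
              bialgebra K H1 \<and> bialgebra K H2 \<and>
              is_twist K H1 F1 \<and> is_twist K H2 F2 \<and>
              f1 \<in> bialgebra_hom K H (twisted K H1 F1) \<and>
              f2 \<in> bialgebra_hom K H (twisted K H2 F2) \<and>
              f1 ` carrier H = carrier H1 \<and> f2 ` carrier H = carrier H2 \<and>
              diagonal_map K H H1 H2 f1 f2 \<in>
                bialgebra_iso K H (twisted K (tensor_bialgebra K H1 H2)
                  (diagonal_twist K H R H1 H2 (f1, F1) (f2, F2))))"
  have "P2 \<Longrightarrow> P1"
    unfolding P1_def P2_def diagonal_onecell_def by (elim exE conjE) (intro exI conjI; assumption)
  moreover have "P1 \<Longrightarrow> P3"
  proof -
    assume P1
    then obtain H1 :: "('k, 'a) bialgebra" and R1 and H2 :: "('k, 'b) bialgebra" and R2 f F where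
      T: "triangular_bialgebra K H1 R1" "triangular_bialgebra K H2 R2"
      and inv: "invertible_onecell K H R (tensor_bialgebra K H1 H2) (interleave K H1 H2 R1 R2) (f, F)"
      unfolding P1_def by (elim exE conjE) (rule that)
    note TT = bialgebra_pair.tensor_triangular[OF pair[OF T] T]
    have "is_onecell K H R (tensor_bialgebra K H1 H2) (interleave K H1 H2 R1 R2) (f, F)"
      using inv by (simp add: invertible_onecell_def)
    then have "is_twist K (tensor_bialgebra K H1 H2) F \<and>
              f \<in> triangular_iso K H R (twisted K (tensor_bialgebra K H1 H2) F)
                    (twisted_R K (tensor_bialgebra K H1 H2) F (interleave K H1 H2 R1 R2))"
      unfolding triangular_iso_onecell_iff[OF assms TT] using invertible_onecell_bij[OF inv] by blast
    then show P3
      unfolding P3_def by (intro exI conjI) (rule T | erule conjunct1 conjunct2)+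
  qed
  moreover have "P3 \<Longrightarrow> P2"
  proof -
    assume P3
    then obtain H1 :: "('k, 'a) bialgebra" and R1 and H2 :: "('k, 'b) bialgebra" and R2 f F where
      T: "triangular_bialgebra K H1 R1" "triangular_bialgebra K H2 R2"
      and iso: "is_twist K (tensor_bialgebra K H1 H2) F \<and>
              f \<in> triangular_iso K H R (twisted K (tensor_bialgebra K H1 H2) F)
                    (twisted_R K (tensor_bialgebra K H1 H2) F (interleave K H1 H2 R1 R2))"
      unfolding P3_def by (elim exE conjE) (rule that, assumption+, rule conjI)
    note TT = bialgebra_pair.tensor_triangular[OF pair[OF T] T]
    from iso have "is_onecell K H R (tensor_bialgebra K H1 H2) (interleave K H1 H2 R1 R2) (f, F)"
      "bij_betw f (carrier H) (carrier (tensor_bialgebra K H1 H2))"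
      unfolding triangular_iso_onecell_iff[OF assms TT] by auto
    note split = bialgebra_pair.split_bijective_onecell[OF pair[OF T] T this]
    show P2
      unfolding P2_def by (intro exI conjI) (rule T split)+
  qed
  moreover have "P2 \<Longrightarrow> P4"
  proof -
    assume P2
    then obtain H1 :: "('k, 'a) bialgebra" and R1 and H2 :: "('k, 'b) bialgebra" and R2 f1 F1 f2 F2
        where
      T: "triangular_bialgebra K H1 R1" "triangular_bialgebra K H2 R2"
      and F: "is_twist K H1 F1" "is_twist K H2 F2"
      and f: "f1 \<in> triangular_hom K H R (twisted K H1 F1) (twisted_R K H1 F1 R1)"
        "f2 \<in> triangular_hom K H R (twisted K H2 F2) (twisted_R K H2 F2 R2)"
        "f1 ` carrier H = carrier H1" "f2 ` carrier H = carrier H2"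
      and inv: "invertible_onecell K H R (tensor_bialgebra K H1 H2) (interleave K H1 H2 R1 R2)
                (diagonal_onecell K H R H1 H2 (f1, F1) (f2, F2))"
      unfolding P2_def by (elim exE conjE) (rule that)
    note inv' = inv[unfolded diagonal_onecell_def fst_conv]
    have "is_onecell K H R (tensor_bialgebra K H1 H2) (interleave K H1 H2 R1 R2)
        (diagonal_map K H H1 H2 f1 f2, diagonal_twist K H R H1 H2 (f1, F1) (f2, F2))"
      using inv' by (simp add: invertible_onecell_def)
    from onecell_hom(1)[OF this] invertible_onecell_bij[OF inv']
    have "diagonal_map K H H1 H2 f1 f2 \<in>
                bialgebra_iso K H (twisted K (tensor_bialgebra K H1 H2)
                  (diagonal_twist K H R H1 H2 (f1, F1) (f2, F2)))"
      by (simp add: bialgebra_iso_def twisted_simps)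
    moreover have "f1 \<in> bialgebra_hom K H (twisted K H1 F1)" "f2 \<in> bialgebra_hom K H (twisted K H2 F2)"
      using f(1,2) by (simp_all add: triangular_hom_def)
    ultimately show P4
      unfolding P4_def by (intro exI conjI) (rule T[THEN triangular_bialgebra_bialgebra] F f(3,4) |
          assumption)+
  qed
  moreover have "P4 \<Longrightarrow> P2"
  proof -
    assume P4
    then obtain H1 :: "('k, 'a) bialgebra" and H2 :: "('k, 'b) bialgebra" and F1 F2 f1 f2 where
      B: "bialgebra K H1" "bialgebra K H2"
      and F: "is_twist K H1 F1" "is_twist K H2 F2"
      and f: "f1 \<in> bialgebra_hom K H (twisted K H1 F1)" "f2 \<in> bialgebra_hom K H (twisted K H2 F2)"
        "f1 ` carrier H = carrier H1" "f2 ` carrier H = carrier H2"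
      and iso: "diagonal_map K H H1 H2 f1 f2 \<in>
                bialgebra_iso K H (twisted K (tensor_bialgebra K H1 H2)
                  (diagonal_twist K H R H1 H2 (f1, F1) (f2, F2)))"
      unfolding P4_def by (elim exE conjE) (rule that)
    interpret u1: untwisting K H R H1 f1 F1
      by (intro untwisting.intro untwisting_axioms.intro assms B F f)
    interpret u2: untwisting K H R H2 f2 F2
      by (intro untwisting.intro untwisting_axioms.intro assms B F f)
    interpret span: twisted_span K H1 H2 H R F1 F2 f1 f2
      by (intro twisted_span.intro twisted_span_axioms.intro bialgebra_pair.intro assms B F f)
    have "bij_betw span.D (carrier H) (carrier (tensor_bialgebra K H1 H2))"
      using iso by (simp add: bialgebra_iso_def twisted_simps)
    note invertible = span.diagonal_onecell_invertible[OF u1.triangular u2.triangular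
        u1.f_triangular_hom u2.f_triangular_hom this]
    show P2
      unfolding P2_def
      by (intro exI conjI)
        (rule invertible u1.triangular u2.triangular F u1.f_triangular_hom u2.f_triangular_hom f(3,4))+
  qed
  ultimately have "(P1 \<longleftrightarrow> P2) \<and> (P2 \<longleftrightarrow> P3) \<and> (P3 \<longleftrightarrow> P4)" by blast
  then show ?thesis unfolding P1_def P2_def P3_def P4_def Let_def .
qed

end
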